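(* Let $\mathbb{F}=\mathbb{R}$ or $\mathbb{C}$, let $m,n\ge 2$ with $(m,n)\neq(2,2)$, and let $T:\mathbf{M}_{m,n}(\mathbb{F})\to \mathbf{M}_{m,n}(\mathbb{F})$ be a nonzero $\mathbb{F}$-linear map. The following conditions are equivalent. (a) $T$ preserves TEA pairs. (b) $T$ preserves parallel pairs and the range space of $T$ has dimension larger than one. (c) There are $U\in\mathbf{U}_m(\mathbb{F})$, $V\in \mathbf{U}_n(\mathbb{F})$ and $\gamma>0$ such that either (1) $T$ has the form $A\mapsto \gamma UAV$, or (2) $m=n$ and $T$ has the form $A\mapsto \gamma UA^{\mathrm{t}}V$.
   Context: $\mathbf{M}_{m,n}(\mathbb{F})$ is the space of $m\times n$ matrices over $\mathbb{F}$ with the spectral (operator) norm $\|A\|=\max\{\|Ax\|: x\in\mathbb{F}^n, \|x\|=1\}$, where $\mathbb{F}^m,\mathbb{F}^n$ carry the usual inner products and norms. $\mathbf{U}_k(\mathbb{F})$ is the group of $k\times k$ complex unitary matrices if $\mathbb{F}=\mathbb{C}$, and of real orthogonal matrices if $\mathbb{F}=\mathbb{R}$. $A^{\mathrm{t}}$ is the transpose of $A$. Matrices $A,B\in \mathbf{M}_{m,n}(\mathbb{F})$ are parallel (form a parallel pair) if $\|A+\mu B\|=\|A\|+\|B\|$ for some $\mu\in\mathbb{F}$ with $|\mu|=1$; they form a triangle equality attaining (TEA) pair if $\|A+B\|=\|A\|+\|B\|$. A linear map $T$ preserves parallel pairs (resp. TEA pairs) if $T(A),T(B)$ are parallel (resp.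 form a TEA pair) whenever $A,B$ are parallel (resp. form a TEA pair). *)

theory Defs
  imports "HOL-Analysis.Analysis"
begin

text \<open>The matrix space $M_{m,n}(F)$ is the type \<open>'a^'n^'m\<close> with rows indexed by \<open>'m\<close> and columns by
  \<open>'n\<close>. The predefined \<open>norm\<close> on this type is the Frobenius norm; on \<open>'a^'n\<close> it is the
  usual Euclidean or Hermitian norm, so the spectral norm is the associated operator norm.\<close>

definition spectral_norm :: "'a::real_normed_field^'n^'m \<Rightarrow> real" where
  "spectral_norm A = onorm (\<lambda>x. A *v x)"

lemma spectral_norm_attained:
  fixes A :: "'a::{real_normed_field,heine_borel}^'n^'m"
  shows "\<exists>x. norm x = 1 \<and> spectral_norm A = norm (A *v x) \<and>
           (\<forall>y. norm y = 1 \<longrightarrow> norm (A *v y) \<le> spectral_norm A)"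
proof -
  let ?S = "sphere 0 1 :: ('a^'n) set"
  have "continuous_on ?S (\<lambda>x. norm (A *v x))"
    unfolding matrix_vector_mult_def by (intro continuous_intros)
  moreover have "norm (axis k 1 :: 'a^'n) = 1" for k
    by (simp add: norm_vec_def L2_set_def axis_def if_distrib[where f = norm]
        if_distrib[where f = "\<lambda>t. t\<^sup>2"] sum.delta cong: if_cong)
  then have "?S \<noteq> {}" by (metis dist_0_norm empty_iff mem_sphere)
  ultimately obtain x where x: "x \<in> ?S" and
    mx: "\<And>y. y \<in> ?S \<Longrightarrow> norm (A *v y) \<le> norm (A *v x)"
    using continuous_attains_sup[OF compact_sphere, of 0 1 "\<lambda>x. norm (A *v x)"] by blast
  have nx: "norm x = 1" using x by simp
  have sc: "A *v (c *\<^sub>R y) = c *\<^sub>R (A *v y)" for c :: real and y :: "'a^'n"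
    by (simp add: matrix_vector_mult_def vec_eq_iff scaleR_sum_right)
  have "norm (A *v y) / norm y \<le> norm (A *v x)" for y
  proof (cases "y = 0")
    case False
    have "norm (A *v ((1 / norm y) *\<^sub>R y)) \<le> norm (A *v x)"
      using False by (intro mx) simp
    then show ?thesis by (simp add: sc)
  qed simp
  then have "spectral_norm A = norm (A *v x)"
    unfolding spectral_norm_def onorm_def using nx
    by (intro cSup_eq_maximum) (auto intro!: image_eqI[where x = x])
  then show ?thesis using nx mx by (intro exI[of _ x]) simp
qed

definition mscale :: "'a::field \<Rightarrow> 'a^'n^'m \<Rightarrow> 'a^'n^'m" where
  "mscale c A = (\<chi> i j. c * A $ i $ j)"

interpretation mat: vector_space "mscale :: 'a::field \<Rightarrow> 'a^'n^'m \<Rightarrow> 'a^'n^'m"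
  by unfold_locales (auto simp: mscale_def vec_eq_iff algebra_simps)

lemma mscale_real: "mscale c A = c *\<^sub>R A" for c :: real and A :: "real^'n^'m"
  by (simp add: mscale_def vec_eq_iff)

definition parallel_pair :: "'a::real_normed_field^'n^'m \<Rightarrow> 'a^'n^'m \<Rightarrow> bool" where
  "parallel_pair A B \<longleftrightarrow>
     (\<exists>\<mu>. norm \<mu> = 1 \<and> spectral_norm (A + mscale \<mu> B) = spectral_norm A + spectral_norm B)"

definition tea_pair :: "'a::real_normed_field^'n^'m \<Rightarrow> 'a^'n^'m \<Rightarrow> bool" where
  "tea_pair A B \<longleftrightarrow> spectral_norm (A + B) = spectral_norm A + spectral_norm B"

definition preserves_pairs :: "('b \<Rightarrow> 'b \<Rightarrow> bool) \<Rightarrow> ('b \<Rightarrow> 'b) \<Rightarrow> bool" where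
  "preserves_pairs R T \<longleftrightarrow> (\<forall>A B. R A B \<longrightarrow> R (T A) (T B))"

definition conj_transpose :: "complex^'n^'m \<Rightarrow> complex^'m^'n" where
  "conj_transpose A = map_matrix cnj (transpose A)"

definition unitary_matrix :: "complex^'n^'n \<Rightarrow> bool" where
  "unitary_matrix U \<longleftrightarrow> conj_transpose U ** U = mat 1 \<and> U ** conj_transpose U = mat 1"

text \<open>When $m = n$, the transpose of a matrix in \<open>'a^'n^'m\<close> has type \<open>'a^'m^'n\<close>. To regard it as an
  element of \<open>'a^'n^'m\<close> again, the two index types are identified along a bijection \<open>\<sigma>\<close>.\<close>

definition transpose_along :: "('m::finite \<Rightarrow> 'n::finite) \<Rightarrow> 'a^'n^'m \<Rightarrow> 'a^'n^'m" where
  "transpose_along \<sigma> A = (\<chi> i j. transpose A $ \<sigma> i $ inv \<sigma> j)"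

lemma transpose_along_id: "transpose_along id A = transpose A" for A :: "'a^'n^'n"
  by (simp add: transpose_along_def vec_eq_iff)

text \<open>The sets \<open>\<U>\<^sub>m\<close> and \<open>\<U>\<^sub>n\<close> stand for the unitary (complex case) or orthogonal (real case) groups.
  The choice of \<open>\<sigma>\<close> is immaterial: changing it amounts to multiplying by permutation matrices,
  which can be absorbed in \<open>U\<close> and \<open>V\<close>.\<close>

definition standard_form ::
  "('a::real_normed_field^'m^'m) set \<Rightarrow> ('a^'n^'n) set \<Rightarrow> ('a^'n^'m \<Rightarrow> 'a^'n^'m) \<Rightarrow> bool" where
  "standard_form \<U>\<^sub>m \<U>\<^sub>n T \<longleftrightarrow>
     (\<exists>U\<in>\<U>\<^sub>m. \<exists>V\<in>\<U>\<^sub>n. \<exists>\<gamma>::real. \<gamma> > 0 \<and>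
        ((\<forall>A. T A = \<gamma> *\<^sub>R (U ** A ** V)) \<or>
         (CARD('m) = CARD('n) \<and>
          (\<exists>\<sigma>::'m \<Rightarrow> 'n. bij \<sigma> \<and> (\<forall>A. T A = \<gamma> *\<^sub>R (U ** transpose_along \<sigma> A ** V))))))"

end

theory Submission
  imports Defs
begin

text \<open>
The proof treats both fields at once: the scalars are any type that is both a \<open>real_normed_field\<close> and
a \<open>euclidean_space\<close>, since conjugation can be recovered from the inner product. Write \<open>x y*\<close> for the
rank-one matrix \<open>outer x y\<close> and \<open>N(A)\<close> for the spectral norm of \<open>T A\<close>.

\<^bold>\<open>From parallel preserver to scaled isometry.\<close> For unit vectors \<open>x\<close>, \<open>y\<close> the matrices
\<open>x y* + C\<close>, where \<open>C\<close> is a contraction from the complement of \<open>y\<close> to the complement of \<open>x\<close>, form a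
face of the unit ball, so their images are pairwise parallel. Choosing a point of this face at which
\<open>N\<close> is smooth, one finds a single functional \<open>G(A) = p* (T A) q\<close> with \<open>|G| = N\<close> on the whole
face (\<open>supporting_functional\<close>). Hence \<open>N(x y* + c u v*) = |h + c f|\<close> for \<open>|c| \<le> 1\<close> whenever \<open>u\<close>
is orthogonal to \<open>x\<close> and \<open>v\<close> to \<open>y\<close>. Comparing with the face of \<open>u v*\<close> shows
that \<open>N(x y*) = N(u v*)\<close> unless the two images are linearly dependent
(\<open>orthogonal_images_dichotomy\<close>). If the range of \<open>T\<close> is not a line, independence holds for one
such quadruple and therefore, along polynomial paths, generically, so by continuity the equality
holds always. Three mutually orthogonal directions then make \<open>N(x y*)\<close> independent of \<open>y\<close>.

It remains to see that \<open>G\<close> vanishes on the matrices \<open>C\<close>. For fixed \<open>x y*\<close> orthogonal to the face of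
\<open>u w*\<close>, rotate \<open>w\<close> inside the complement of \<open>y\<close>. Two neighbouring faces bound each other's
functionals, and the value at \<open>x y*\<close> changes only quadratically in the angle, hence not at all.
But rotating \<open>w\<close> to \<open>- w\<close> changes its sign, so it is zero
(\<open>supporting_functional_vanishes_on_block\<close>). Thus \<open>N\<close> is constant on every face, and the faces of
different \<open>x\<close> are linked by partial isometries of rank two: \<open>T\<close> is a multiple of an isometry
(\<open>parallel_preserver_scaled_isometry\<close>). Having three orthogonal columns or, after transposing, three
orthogonal rows is exactly what excludes the format two by two.

\<^bold>\<open>Isometries.\<close> A linear isometry of the spectral norm maps \<open>x y*\<close> to a rank-one matrix,
because among the \<open>A\<close> of norm one the set of \<open>B\<close> with \<open>A + B\<close> and \<open>A - B\<close> in the unit ball is maximal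
exactly for those of rank one (\<open>isometry_rank_one_unit\<close>). A linear space of matrices of rank at most one has a
common column or a common row direction, and orthogonality forces the same alternative for all rows
of the domain, giving \<open>A \<mapsto> U A V\<close> or its transposed version (\<open>spectral_isometry_form\<close>).

\<^bold>\<open>TEA pairs.\<close> A TEA preserver preserves parallel pairs by multiplying the second matrix with a
scalar of modulus one. Its range is not a line: if it were, one could find \<open>x y*\<close> in the kernel and an
orthogonal \<open>u v*\<close> outside it, and the TEA pair \<open>x y* + u v*\<close>, \<open>x y* - u v*\<close> would be sent to \<open>S\<close>,
\<open>- S\<close> with \<open>S\<close> nonzero (\<open>tea_preserver_rank\<close>).
\<close>

section \<open>Conjugation recovered from the inner product\<close>

text \<open>Reflection in the real axis: the identity on the reals and complex conjugation on the complex
numbers.\<close>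

definition conjugate :: "'a::{real_normed_field,euclidean_space} \<Rightarrow> 'a" where
  "conjugate z = of_real (2 * inner z 1) - z"

lemma inner_one_one [simp]: "inner 1 (1 :: 'a::{real_normed_field,euclidean_space}) = 1"
  by (simp add: power2_norm_eq_inner[symmetric])

text \<open>The norm is multiplicative; polarise.\<close>
lemma inner_mult_mult: "inner (x * y) (x * z) = (norm x)\<^sup>2 * inner y (z :: 'a::{real_normed_field,euclidean_space})"
proof -
  have n: "(norm (x * w))\<^sup>2 = (norm x)\<^sup>2 * (norm w)\<^sup>2" for w :: 'a
    by (simp add: norm_mult power_mult_distrib)
  have "2 * inner (x*y) (x*z) = (norm (x * (y + z)))\<^sup>2 - (norm (x*y))\<^sup>2 - (norm (x*z))\<^sup>2"
    by (simp add: power2_norm_eq_inner algebra_simps inner_commute inner_add_left inner_add_right)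
  also have "\<dots> = (norm x)\<^sup>2 * ((norm (y + z))\<^sup>2 - (norm y)\<^sup>2 - (norm z)\<^sup>2)"
    unfolding n by (simp add: algebra_simps)
  also have "\<dots> = (norm x)\<^sup>2 * (2 * inner y z)"
    by (simp add: power2_norm_eq_inner algebra_simps inner_commute inner_add_left inner_add_right)
  finally show ?thesis by simp
qed

text \<open>Multiplication by \<open>x\<close> has multiplication by the conjugate as its adjoint. Expanding
\<open>inner_mult_mult\<close> for the factor \<open>1 + x\<close> isolates the term that is linear in \<open>x\<close>.\<close>
lemma inner_mult_conjugate: "inner (x * y) z = inner y (conjugate x * (z :: 'a::{real_normed_field,euclidean_space}))"
proof -
  have a: "inner ((1 + x) * y) ((1 + x) * z) = (norm (1 + x))\<^sup>2 * inner y z"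
    by (rule inner_mult_mult)
  have b: "(norm (1 + x))\<^sup>2 = 1 + 2 * inner x 1 + (norm x)\<^sup>2"
    by (simp add: power2_norm_eq_inner inner_add_left inner_add_right inner_commute)
  have c: "inner ((1 + x) * y) ((1 + x) * z) = inner y z + inner (x*y) z + inner y (x*z) + (norm x)\<^sup>2 * inner y z"
    by (simp add: distrib_right inner_add_left inner_add_right inner_mult_mult)
  have d: "inner y (conjugate x * z) = 2 * inner x 1 * inner y z - inner y (x * z)"
    unfolding conjugate_def left_diff_distrib inner_diff_right scaleR_conv_of_real[symmetric] inner_scaleR_right ..
  from a b c d show ?thesis by (simp add: algebra_simps)
qed

lemma conjugate_mult_self: "conjugate z * z = of_real ((norm z)\<^sup>2)" for z :: "'a::{real_normed_field,euclidean_space}"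
proof -
  have "inner y (conjugate z * z) = inner y (of_real ((norm z)\<^sup>2))" for y
  proof -
    have "inner y (conjugate z * z) = inner (z * y) (z * 1)" by (simp add: inner_mult_conjugate)
    also have "\<dots> = inner y (of_real ((norm z)\<^sup>2))"
      by (simp only: inner_mult_mult of_real_def inner_scaleR_right)
    finally show ?thesis .
  qed
  then show ?thesis by (metis vector_eq_ldot)
qed

lemma conjugate_add [simp]: "conjugate (x + y) = conjugate x + conjugate y"
  by (simp add: conjugate_def inner_add_left algebra_simps)
lemma conjugate_diff [simp]: "conjugate (x - y) = conjugate x - conjugate y"
  by (simp add: conjugate_def inner_diff_left algebra_simps)
lemma conjugate_minus [simp]: "conjugate (- x) = - conjugate x"
  by (simp add: conjugate_def)
lemma conjugate_zero [simp]: "conjugate 0 = 0" by (simp add: conjugate_def)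
lemma conjugate_of_real [simp]: "conjugate (of_real r) = of_real r"
  by (simp add: conjugate_def of_real_def inner_one_one scaleR_left_diff_distrib [symmetric] del: scaleR_left_diff_distrib)
    
lemma conjugate_one [simp]: "conjugate 1 = 1" using conjugate_of_real[of 1] by simp

lemma conjugate_mult [simp]: "conjugate (x * y) = conjugate x * conjugate y"
proof (cases "x = 0 \<or> y = 0")
  case False
  have "conjugate (x * y) * (x * y) = (conjugate x * conjugate y) * (x * y)"
    using conjugate_mult_self[of x] conjugate_mult_self[of y] conjugate_mult_self[of "x*y"]
    by (simp add: norm_mult power_mult_distrib mult_ac)
  then show ?thesis using False by simp
qed auto

lemma conjugate_sum [simp]: "conjugate (sum f A) = (\<Sum>i\<in>A. conjugate (f i))"
  by (induction A rule: infinite_finite_induct) auto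

lemma inner_one_conjugate: "inner (conjugate x) 1 = inner x 1" for x :: "'a::{real_normed_field,euclidean_space}"
  using inner_mult_conjugate[of x 1 1] by (simp add: inner_commute)

lemma conjugate_conjugate [simp]: "conjugate (conjugate x) = x"
  by (simp add: conjugate_def[of "conjugate x"] inner_one_conjugate) (simp add: conjugate_def)

lemma norm_conjugate [simp]: "norm (conjugate x) = norm x"
proof -
  have "norm (conjugate x) * norm x = norm x * norm x"
    using arg_cong[OF conjugate_mult_self[of x], of norm] by (simp add: norm_mult power2_eq_square)
  then show ?thesis by (cases "x = 0") auto
qed

lemma conjugate_eq_0_iff [simp]: "conjugate x = 0 \<longleftrightarrow> x = 0"
  by (metis norm_conjugate norm_eq_zero)

lemma inner_eq_conjugate: "inner x y = inner (conjugate x * y) 1" for x y :: "'a::{real_normed_field,euclidean_space}"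
  using inner_mult_conjugate[of x 1 y] by (simp add: inner_commute)

lemma conjugate_real: "conjugate x = x" for x :: real by (simp add: conjugate_def)
lemma conjugate_complex: "conjugate x = cnj x" for x :: complex
  by (simp add: conjugate_def complex_eq_iff inner_complex_def)

section \<open>Hermitian product, rank-one matrices and adjoints\<close>

text \<open>The Hermitian inner product, conjugate linear in the first argument. The inner product of the
vector type is its real part.\<close>
definition hip :: "'a::{real_normed_field,euclidean_space}^'n \<Rightarrow> 'a^'n \<Rightarrow> 'a" where
  "hip x y = (\<Sum>i\<in>UNIV. conjugate (x $ i) * y $ i)"

lemma inner_hip: "inner x y = inner (hip x y) 1"
  by (simp add: hip_def inner_vec_def inner_sum_left inner_eq_conjugate[symmetric])

lemma hip_add_left: "hip (x + y) z = hip x z + hip y z"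
  and hip_add_right: "hip x (y + z) = hip x y + hip x z"
  and hip_diff_left: "hip (x - y) z = hip x z - hip y z"
  and hip_diff_right: "hip x (y - z) = hip x y - hip x z"
  and hip_minus_left: "hip (- x) z = - hip x z"
  and hip_minus_right: "hip x (- z) = - hip x z"
  and hip_zero_left [simp]: "hip 0 z = 0"
  and hip_zero_right [simp]: "hip z 0 = 0"
  by (simp_all add: hip_def sum.distrib sum_subtractf algebra_simps sum_negf)

lemma hip_smult_left: "hip (c *s x) y = conjugate c * hip x y"
  and hip_smult_right: "hip x (c *s y) = c * hip x y"
  by (simp_all add: hip_def sum_distrib_left algebra_simps)

lemma scaleR_smult: "r *\<^sub>R x = of_real r *s (x :: 'a::real_normed_field^'n)"
proof -
  have "(r *\<^sub>R x) $ i = of_real r * x $ i" for i by (simp add: scaleR_conv_of_real[of r "x $ i"])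
  then show ?thesis by (simp add: vec_eq_iff)
qed

lemma hip_scaleR_left: "hip (r *\<^sub>R x) y = of_real r * hip x y"
  and hip_scaleR_right: "hip x (r *\<^sub>R y) = of_real r * hip x y"
  by (simp_all add: scaleR_smult hip_smult_left hip_smult_right)

lemmas hip_simps = hip_add_left hip_add_right hip_diff_left hip_diff_right hip_minus_left
  hip_minus_right hip_smult_left hip_smult_right hip_scaleR_left hip_scaleR_right

lemma conjugate_hip: "conjugate (hip x y) = hip y x"
  by (simp add: hip_def mult.commute)

lemma hip_commute_0: "hip x y = 0 \<Longrightarrow> hip y x = 0"
  by (metis conjugate_hip conjugate_zero)

lemma hip_self: "hip x x = of_real ((norm x)\<^sup>2)"
  by (simp add: hip_def conjugate_mult_self norm_vec_def L2_set_def sum_nonneg del: of_real_power)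

lemma norm_smult: "norm (c *s x) = norm c * norm (x :: 'a::real_normed_field^'n)"
  by (simp add: norm_vec_def vector_scalar_mult_def norm_mult L2_set_right_distrib)

lemma unimodular_align: "\<exists>c::'a::{real_normed_field,euclidean_space}. norm c = 1 \<and> c * z = of_real (norm z)"
proof (cases "z = 0")
  case False
  have "conjugate z / of_real (norm z) * z = of_real (norm z)" using False
    using conjugate_mult_self[of z] by (simp add: field_simps power2_eq_square)
  then show ?thesis using False by (intro exI[of _ "conjugate z / of_real (norm z)"]) (simp add: norm_divide)
qed (auto intro: exI[of _ 1])

lemma hip_Cauchy_Schwarz: "norm (hip x y) \<le> norm x * norm y"
proof -
  obtain c :: 'a where c: "norm c = 1" "c * hip x y = of_real (norm (hip x y))" using unimodular_align by blast
  have "norm (hip x y) = inner (c * hip x y) 1"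
    unfolding c(2) by (simp add: of_real_def norm_eq_1[symmetric])
  also have "\<dots> = inner x (c *s y)" by (simp add: inner_hip hip_smult_right)
  also have "\<dots> \<le> norm x * norm y" using norm_cauchy_schwarz[of x "c *s y"] c by (simp add: norm_smult)
  finally show ?thesis .
qed

lemma norm_add_orthogonal: assumes "hip x y = 0" shows "(norm (x + y))\<^sup>2 = (norm x)\<^sup>2 + (norm y)\<^sup>2"
  using assms inner_hip[of x y] by (simp add: power2_norm_eq_inner inner_add_left inner_add_right inner_commute)

text \<open>The matrix \<open>x y*\<close>.\<close>
definition outer :: "'a::{real_normed_field,euclidean_space}^'m \<Rightarrow> 'a^'n \<Rightarrow> 'a^'n^'m" where
  "outer x y = (\<chi> i j. x $ i * conjugate (y $ j))"

definition adj :: "'a::{real_normed_field,euclidean_space}^'n^'m \<Rightarrow> 'a^'m^'n" where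
  "adj A = (\<chi> i j. conjugate (A $ j $ i))"

lemma outer_mult_vec [simp]: "outer x y *v z = hip y z *s x"
  by (simp add: outer_def matrix_vector_mult_def hip_def vec_eq_iff sum_distrib_left sum_distrib_right mult_ac)

lemma adj_adj [simp]: "adj (adj A) = A" by (simp add: adj_def vec_eq_iff)
lemma adj_add: "adj (A + B) = adj A + adj B" by (simp add: adj_def vec_eq_iff)
lemma adj_diff: "adj (A - B) = adj A - adj B" by (simp add: adj_def vec_eq_iff)
lemma adj_mscale: "adj (mscale c A) = mscale (conjugate c) (adj A)" by (simp add: adj_def mscale_def vec_eq_iff)
lemma adj_zero [simp]: "adj 0 = 0" by (simp add: adj_def vec_eq_iff)
lemma adj_outer [simp]: "adj (outer x y) = outer y x" by (simp add: adj_def outer_def vec_eq_iff mult.commute)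

lemma hip_adj: "hip (A *v x) y = hip x (adj A *v y)"
proof -
  have "hip (A *v x) y = (\<Sum>i\<in>UNIV. \<Sum>j\<in>UNIV. conjugate (A$i$j) * conjugate (x$j) * y$i)"
    by (simp add: hip_def matrix_vector_mult_def sum_distrib_right)
  also have "\<dots> = (\<Sum>j\<in>UNIV. \<Sum>i\<in>UNIV. conjugate (A$i$j) * conjugate (x$j) * y$i)" by (rule sum.swap)
  also have "\<dots> = hip x (adj A *v y)"
    by (simp add: hip_def matrix_vector_mult_def adj_def sum_distrib_left mult_ac)
  finally show ?thesis .
qed

lemma hip_adj_left: "hip (adj A *v x) y = hip x (A *v y)" using hip_adj[of "adj A"] by simp

lemma mscale_mult_vec [simp]: "mscale c A *v x = c *s (A *v x)"
  by (simp add: mscale_def matrix_vector_mult_def vec_eq_iff sum_distrib_left mult_ac)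
lemma mult_vec_smult: "A *v (c *s x) = c *s (A *v (x :: 'a::field^'n))"
  by (simp add: matrix_vector_mult_def vec_eq_iff sum_distrib_left mult_ac)
lemma mult_vec_scaleR: "A *v (r *\<^sub>R x) = r *\<^sub>R (A *v (x :: 'a::real_normed_field^'n))"
  by (simp add: scaleR_smult mult_vec_smult)
lemma scaleR_mscale: "r *\<^sub>R A = mscale (of_real r) (A :: 'a::real_normed_field^'n^'m)"
proof -
  have "(r *\<^sub>R A) $ i $ j = of_real r * A $ i $ j" for i j by (simp add: scaleR_conv_of_real[of r "A $ i $ j"])
  then show ?thesis by (simp add: vec_eq_iff mscale_def)
qed
lemma outer_add_left: "outer (x + x') y = outer x y + outer x' y"
  and outer_add_right: "outer x (y + y') = outer x y + outer x y'"
  and outer_diff_left: "outer (x - x') y = outer x y - outer x' y"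
  and outer_diff_right: "outer x (y - y') = outer x y - outer x y'"
  and outer_smult_left: "outer (c *s x) y = mscale c (outer x y)"
  and outer_smult_right: "outer x (c *s y) = mscale (conjugate c) (outer x y)"
  and outer_minus_left: "outer (- x) y = - outer x y"
  and outer_minus_right: "outer x (- y) = - outer x y"
  and outer_zero_left: "outer 0 y = 0" and outer_zero_right: "outer x 0 = 0"
  by (simp_all add: outer_def mscale_def vec_eq_iff algebra_simps)

lemma outer_scaleR_left: "outer (r *\<^sub>R x) y = mscale (of_real r) (outer x y)"
  and outer_scaleR_right: "outer x (r *\<^sub>R y) = mscale (of_real r) (outer x y)"
  by (simp_all add: scaleR_smult outer_smult_left outer_smult_right)

lemma matrix_eq_vec: "A = B \<longleftrightarrow> (\<forall>x. A *v x = B *v (x :: 'a::field^'n))"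
  by (simp add: matrix_eq)

lemma outer_eq_0_iff: "outer x y = 0 \<longleftrightarrow> x = 0 \<or> y = 0"
  by (auto simp: outer_def vec_eq_iff)

lemma matrix_sum_outer: "A = (\<Sum>j\<in>UNIV. outer (A *v axis j 1) (axis j 1))"
  for A :: "'a::{real_normed_field,euclidean_space}^'n^'m"
proof -
  have "(\<Sum>j\<in>UNIV. (A *v axis j 1) $ i * conjugate (axis j 1 $ k)) = A $ i $ k" for i k
  proof -
    have "(\<Sum>j\<in>UNIV. (A *v axis j 1) $ i * conjugate (axis j 1 $ k)) = (\<Sum>j\<in>UNIV. if j = k then (A *v axis j 1) $ i else 0)"
      by (intro sum.cong) (auto simp: axis_def)
    also have "\<dots> = (\<Sum>j\<in>UNIV. if j = k then A $ i $ k else 0)"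
      by (simp add: matrix_vector_mult_def axis_def if_distrib[of "(*) _"] cong: if_cong)
    also have "\<dots> = A $ i $ k" by simp
    finally show ?thesis .
  qed
  then show ?thesis by (simp add: vec_eq_iff outer_def sum_component)
qed

section \<open>The spectral norm\<close>
lemma norm_mult_vec_le_sum: "norm (A *v x) \<le> (\<Sum>i\<in>(UNIV::'m::finite set). \<Sum>j\<in>(UNIV::'n::finite set). norm A * norm x)"
  for A :: "'a::{real_normed_field,euclidean_space}^'n^'m"
proof -
  have "norm (A *v x) \<le> (\<Sum>i\<in>UNIV. norm ((A *v x) $ i))"
    unfolding norm_vec_def by (rule L2_set_le_sum) auto
  also have "\<dots> \<le> (\<Sum>i\<in>(UNIV::'m set). \<Sum>j\<in>(UNIV::'n set). norm A * norm x)"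
  proof (intro sum_mono)
    fix i
    have "norm ((A *v x) $ i) \<le> (\<Sum>j\<in>UNIV. norm (A $ i $ j * x $ j))"
      unfolding matrix_vector_mult_def by (simp add: norm_sum)
    also have "\<dots> \<le> (\<Sum>j\<in>(UNIV::'n set). norm A * norm x)"
    proof (intro sum_mono)
      fix j show "norm (A $ i $ j * x $ j) \<le> norm A * norm x"
        unfolding norm_mult
        by (intro mult_mono) (use Finite_Cartesian_Product.norm_nth_le[of A i] Finite_Cartesian_Product.norm_nth_le[of "A $ i" j] Finite_Cartesian_Product.norm_nth_le[of x j] in auto)
    qed
    finally show "norm ((A *v x) $ i) \<le> (\<Sum>j\<in>(UNIV::'n set). norm A * norm x)" .
  qed
  finally show ?thesis .
qed

lemma spectral_norm_bound: "norm (A *v x) \<le> spectral_norm A * norm x"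
  for A :: "'a::{real_normed_field,euclidean_space}^'n^'m"
proof (cases "x = 0")
  case False
  obtain z where z: "\<forall>y. norm y = 1 \<longrightarrow> norm (A *v y) \<le> spectral_norm A" using spectral_norm_attained[of A] by blast
  have "norm (A *v ((1 / norm x) *\<^sub>R x)) \<le> spectral_norm A" using False z by auto
  then show ?thesis using False by (simp add: mult_vec_scaleR field_simps)
qed simp

lemma spectral_norm_nonneg [simp]: "spectral_norm A \<ge> 0"
  for A :: "'a::{real_normed_field,euclidean_space}^'n^'m"
  using spectral_norm_attained[of A] by (metis norm_ge_zero)

lemma spectral_norm_le:
  fixes A :: "'a::{real_normed_field,euclidean_space}^'n^'m"
  assumes "\<And>x. norm (A *v x) \<le> b * norm x" shows "spectral_norm A \<le> b"
  using spectral_norm_attained[of A] assms by (metis mult.right_neutral)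

lemma spectral_norm_eqI:
  fixes A :: "'a::{real_normed_field,euclidean_space}^'n^'m"
  assumes "\<And>x. norm (A *v x) \<le> b * norm x" "norm x = 1" "norm (A *v x) = b" shows "spectral_norm A = b"
  using spectral_norm_le[of A b] spectral_norm_bound[of A x] assms by auto

lemma spectral_norm_triangle: "spectral_norm (A + B) \<le> spectral_norm A + spectral_norm B"
  for A :: "'a::{real_normed_field,euclidean_space}^'n^'m"
proof (rule spectral_norm_le)
  fix x show "norm ((A + B) *v x) \<le> (spectral_norm A + spectral_norm B) * norm x"
    using norm_triangle_ineq[of "A *v x" "B *v x"] spectral_norm_bound[of A x] spectral_norm_bound[of B x]
    by (simp add: matrix_vector_mult_add_rdistrib distrib_right)
qed

lemma spectral_norm_0_iff [simp]: "spectral_norm A = 0 \<longleftrightarrow> A = 0"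
  for A :: "'a::{real_normed_field,euclidean_space}^'n^'m"
proof
  assume "spectral_norm A = 0"
  then have "A *v x = 0 *v x" for x using spectral_norm_bound[of A x] by simp
  then show "A = 0" by (simp add: matrix_eq_vec)
next
  show "A = 0 \<Longrightarrow> spectral_norm A = 0" using spectral_norm_attained[of A] by auto
qed

lemma spectral_norm_mscale: "spectral_norm (mscale c A) = norm c * spectral_norm A"
  for A :: "'a::{real_normed_field,euclidean_space}^'n^'m"
proof -
  obtain x where x: "norm x = 1" "spectral_norm A = norm (A *v x)" using spectral_norm_attained[of A] by blast
  show ?thesis
  proof (rule spectral_norm_eqI[of _ _ x])
    show "norm (mscale c A *v z) \<le> norm c * spectral_norm A * norm z" for z
      using mult_left_mono[OF spectral_norm_bound[of A z], of "norm c"] by (simp add: norm_smult mult.assoc)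
  qed (use x in \<open>simp_all add: norm_smult\<close>)
qed

lemma minus_mscale: "- A = mscale (-1) A" by (simp add: mscale_def vec_eq_iff)

lemma spectral_norm_minus [simp]: "spectral_norm (- A) = spectral_norm A"
  for A :: "'a::{real_normed_field,euclidean_space}^'n^'m"
  using spectral_norm_mscale[of "-1" A] by (simp flip: minus_mscale)

lemma spectral_norm_outer [simp]: "spectral_norm (outer x y) = norm x * norm (y :: 'a::{real_normed_field,euclidean_space}^'n)"
proof (cases "y = 0")
  case True then show ?thesis by (simp add: outer_zero_right)
next
  case False
  show ?thesis
  proof (rule spectral_norm_eqI[of _ _ "(1 / norm y) *\<^sub>R y"])
    show "norm (outer x y *v z) \<le> norm x * norm y * norm z" for z
      using mult_left_mono[OF hip_Cauchy_Schwarz[of y z], of "norm x"] by (simp add: norm_smult mult_ac)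
    show "norm (outer x y *v ((1 / norm y) *\<^sub>R y)) = norm x * norm y" using False
      by (simp add: norm_smult hip_scaleR_right hip_self norm_mult norm_divide power2_eq_square norm_power)
  qed (use False in simp)
qed

lemma spectral_norm_adj_le: "spectral_norm (adj A) \<le> spectral_norm A"
proof (rule spectral_norm_le)
  fix y
  let ?w = "adj A *v y"
  have "(norm ?w)\<^sup>2 = norm (hip ?w ?w)" by (simp add: hip_self norm_power)
  also have "\<dots> = norm (hip y (A *v ?w))" by (simp add: hip_adj_left)
  also have "\<dots> \<le> norm y * (spectral_norm A * norm ?w)"
    using hip_Cauchy_Schwarz[of y "A *v ?w"] mult_left_mono[OF spectral_norm_bound[of A ?w], of "norm y"] by simp
  finally show "norm ?w \<le> spectral_norm A * norm y"
    by (cases "norm ?w = 0") (auto simp: power2_eq_square mult_ac)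
qed

lemma spectral_norm_adj [simp]: "spectral_norm (adj A) = spectral_norm A"
  using spectral_norm_adj_le[of A] spectral_norm_adj_le[of "adj A"] by simp

text \<open>The transpose is the entrywise conjugate of the adjoint, and entrywise conjugation preserves
the norms of vectors.\<close>
lemma spectral_norm_transpose [simp]: "spectral_norm (transpose A) = spectral_norm A"
  for A :: "'a::{real_normed_field,euclidean_space}^'n^'m"
proof -
  have le: "spectral_norm (transpose B) \<le> spectral_norm (adj B)" for B :: "'a^'p^'q"
  proof (rule spectral_norm_le)
    fix x
    let ?c = "\<lambda>z::'a^'r. \<chi> i. conjugate (z $ i)"
    have n: "norm (?c z) = norm z" for z :: "'a^'r" by (simp add: norm_vec_def)
    have n': "norm ((\<chi> i. conjugate (z $ i)) :: 'a^'q) = norm z" for z :: "'a^'q" by (simp add: norm_vec_def)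
    have "transpose B *v x = (\<chi> i. conjugate ((adj B *v (\<chi> i. conjugate (x $ i))) $ i))"
      by (simp add: vec_eq_iff adj_def matrix_vector_mult_def transpose_def)
    then have "norm (transpose B *v x) = norm (adj B *v (\<chi> i. conjugate (x $ i)))" by (simp add: norm_vec_def)
    also have "\<dots> \<le> spectral_norm (adj B) * norm x" using spectral_norm_bound[of "adj B" "\<chi> i. conjugate (x $ i)"] n' by simp
    finally show "norm (transpose B *v x) \<le> spectral_norm (adj B) * norm x" .
  qed
  show ?thesis using le[of A] le[of "transpose A"] by simp
qed

lemma spectral_norm_le_norm: "\<exists>L>0. \<forall>A :: 'a::{real_normed_field,euclidean_space}^'n^'m. spectral_norm A \<le> L * norm A"
proof -
  let ?L = "real CARD('m) * real CARD('n)"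
  have "spectral_norm A \<le> ?L * norm A" for A :: "'a^'n^'m"
    by (rule spectral_norm_le) (use norm_mult_vec_le_sum[of A] in \<open>simp add: mult_ac\<close>)
  then show ?thesis by (intro exI[of _ ?L]) auto
qed

abbreviation (input) mlinear where "mlinear T \<equiv> Vector_Spaces.linear mscale mscale T"

lemma mlinear_add: "mlinear T \<Longrightarrow> T (A + B) = T A + T B"
  and mlinear_mscale: "mlinear T \<Longrightarrow> T (mscale c A) = mscale c (T A)"
  and mlinear_diff: "mlinear T \<Longrightarrow> T (A - B) = T A - T B"
  and mlinear_minus: "mlinear T \<Longrightarrow> T (- A) = - T A"
  and mlinear_zero: "mlinear T \<Longrightarrow> T 0 = 0"
  and mlinear_sum: "mlinear T \<Longrightarrow> T (sum f S) = (\<Sum>i\<in>S. T (f i))"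
proof -
  assume "mlinear T"
  then interpret T: Vector_Spaces.linear mscale mscale T .
  show "T (A + B) = T A + T B" "T (mscale c A) = mscale c (T A)" "T (A - B) = T A - T B"
    "T (- A) = - T A" "T 0 = 0" "T (sum f S) = (\<Sum>i\<in>S. T (f i))"
    by (simp_all add: T.add T.scale T.diff T.neg T.zero T.sum)
qed

lemma mlinear_scaleR: "mlinear T \<Longrightarrow> T (r *\<^sub>R A) = r *\<^sub>R T A"
  for T :: "'a::real_normed_field^'n^'m \<Rightarrow> 'a^'q^'p"
  by (simp add: scaleR_mscale mlinear_mscale)

lemma mlinear_bounded_linear: "mlinear T \<Longrightarrow> bounded_linear T"
  for T :: "'a::{real_normed_field,euclidean_space}^'n^'m \<Rightarrow> 'a^'q^'p"
  by (rule linear_conv_bounded_linear[THEN iffD1], rule linearI) (simp_all add: mlinear_add mlinear_scaleR)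

lemma spectral_norm_diff_le: "\<bar>spectral_norm A - spectral_norm B\<bar> \<le> spectral_norm (A - B)"
  for A :: "'a::{real_normed_field,euclidean_space}^'n^'m"
  using spectral_norm_triangle[of "A - B" B] spectral_norm_triangle[of "B - A" A] spectral_norm_minus[of "A - B"]
  by simp

lemma spectral_norm_comp_lipschitz:
  fixes T :: "'a::{real_normed_field,euclidean_space}^'n^'m \<Rightarrow> 'a^'q^'p"
  assumes "mlinear T"
  shows "\<exists>L>0. \<forall>A B. \<bar>spectral_norm (T A) - spectral_norm (T B)\<bar> \<le> L * norm (A - B)"
proof -
  obtain L where L: "L > 0" "\<And>A :: 'a^'q^'p. spectral_norm A \<le> L * norm A"
    using spectral_norm_le_norm by metis
  obtain K where K: "K > 0" "\<And>A. norm (T A) \<le> norm A * K"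
    using bounded_linear.pos_bounded[OF mlinear_bounded_linear[OF assms]] by blast
  have "\<bar>spectral_norm (T A) - spectral_norm (T B)\<bar> \<le> (L * K) * norm (A - B)" for A B
  proof -
    have "\<bar>spectral_norm (T A) - spectral_norm (T B)\<bar> \<le> spectral_norm (T (A - B))"
      using spectral_norm_diff_le[of "T A" "T B"] by (simp add: mlinear_diff[OF assms])
    also have "\<dots> \<le> L * norm (T (A - B))" by (rule L)
    also have "\<dots> \<le> L * (norm (A - B) * K)" using L(1) K(2)[of "A - B"] by (intro mult_left_mono) auto
    finally show ?thesis by (simp add: mult_ac)
  qed
  with L(1) K(1) show ?thesis by (intro exI[of _ "L * K"]) auto
qed

lemma spectral_norm_comp_continuous:
  fixes T :: "'a::{real_normed_field,euclidean_space}^'n^'m \<Rightarrow> 'a^'q^'p"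
  assumes "mlinear T"
  shows "continuous_on S (\<lambda>A. spectral_norm (T A))"
proof -
  obtain L where L: "L > 0" "\<And>A B. \<bar>spectral_norm (T A) - spectral_norm (T B)\<bar> \<le> L * norm (A - B)"
    using spectral_norm_comp_lipschitz[OF assms] by blast
  have "L-lipschitz_on S (\<lambda>A. spectral_norm (T A))"
    by (intro lipschitz_onI) (use L in \<open>auto simp: dist_norm\<close>)
  then show ?thesis by (rule lipschitz_on_continuous_on)
qed

lemma hip_le_spectral_norm:
  assumes "norm p = 1" "norm q = 1" shows "norm (hip p (A *v q)) \<le> spectral_norm A"
  using hip_Cauchy_Schwarz[of p "A *v q"] spectral_norm_bound[of A q] assms by simp

lemma exists_unit: "\<exists>x :: 'a::{real_normed_field,euclidean_space}^'n. norm x = 1"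
  using spectral_norm_attained by metis

lemma exists_dual_unit: "\<exists>p. norm p = 1 \<and> hip p z = of_real (norm (z :: 'a::{real_normed_field,euclidean_space}^'n))"
proof (cases "z = 0")
  case False
  have "hip ((1 / norm z) *\<^sub>R z) z = of_real (norm z)" using False
    by (simp add: hip_scaleR_left hip_self power2_eq_square field_simps)
  with False show ?thesis by (intro exI[of _ "(1 / norm z) *\<^sub>R z"]) auto
qed (use exists_unit in auto)

text \<open>Take \<open>q\<close> where \<open>A + \<mu> B\<close> attains its norm and \<open>p\<close> in the direction of the image; then
equality must hold in every triangle inequality that is used.\<close>
lemma parallel_pairD:
  fixes A B :: "'a::{real_normed_field,euclidean_space}^'n^'m"
  assumes "parallel_pair A B"
  shows "\<exists>p q. norm p = 1 \<and> norm q = 1 \<and> norm (hip p (A *v q)) = spectral_norm A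
           \<and> norm (hip p (B *v q)) = spectral_norm B"
proof -
  obtain \<mu> :: 'a where mu: "norm \<mu> = 1" "spectral_norm (A + mscale \<mu> B) = spectral_norm A + spectral_norm B"
    using assms unfolding parallel_pair_def by blast
  obtain q where q: "norm q = 1" "spectral_norm (A + mscale \<mu> B) = norm ((A + mscale \<mu> B) *v q)"
    using spectral_norm_attained by blast
  obtain p where p: "norm p = 1" "hip p ((A + mscale \<mu> B) *v q) = of_real (norm ((A + mscale \<mu> B) *v q))"
    using exists_dual_unit by blast
  have "spectral_norm A + spectral_norm B = norm (hip p (A *v q) + \<mu> * hip p (B *v q))"
    using p(2) q(2) mu(2) by (simp add: matrix_vector_mult_add_rdistrib hip_simps)
  also have "\<dots> \<le> norm (hip p (A *v q)) + norm (hip p (B *v q))"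
    using norm_triangle_ineq[of "hip p (A *v q)" "\<mu> * hip p (B *v q)"] mu(1) by (simp add: norm_mult)
  finally show ?thesis using hip_le_spectral_norm[OF p(1) q(1), of A] hip_le_spectral_norm[OF p(1) q(1), of B] p(1) q(1)
    by (intro exI[of _ p] exI[of _ q]) auto
qed

section \<open>Faces of the unit ball\<close>

text \<open>The matrices that map the complement of \<open>y\<close> to the complement of \<open>x\<close> and kill \<open>y\<close>. Adding
the contractions among them to \<open>outer x y\<close> gives the matrices of norm one that map \<open>y\<close> to \<open>x\<close>: a
maximal face of the unit ball when \<open>x\<close> and \<open>y\<close> are unit vectors.\<close>
definition orth_block :: "'a::{real_normed_field,euclidean_space}^'m \<Rightarrow> 'a^'n \<Rightarrow> ('a^'n^'m) set" where
  "orth_block x y = {C. C *v y = 0 \<and> adj C *v x = 0}"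

lemma orth_block_add: "C \<in> orth_block x y \<Longrightarrow> D \<in> orth_block x y \<Longrightarrow> C + D \<in> orth_block x y"
  and orth_block_mscale: "C \<in> orth_block x y \<Longrightarrow> mscale c C \<in> orth_block x y"
  by (auto simp: orth_block_def matrix_vector_mult_add_rdistrib adj_add adj_mscale)

lemma orth_block_scaleR: "C \<in> orth_block x y \<Longrightarrow> r *\<^sub>R C \<in> orth_block x y"
  by (simp add: scaleR_mscale orth_block_mscale)

lemma orth_block_zero [simp]: "0 \<in> orth_block x y"
  by (auto simp: orth_block_def)

lemma outer_orth_block: "hip x u = 0 \<Longrightarrow> hip y v = 0 \<Longrightarrow> outer u v \<in> orth_block x y"
  by (simp add: orth_block_def hip_commute_0)

lemma hip_orth_block: "C \<in> orth_block x y \<Longrightarrow> hip x (C *v z) = 0"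
  by (simp add: orth_block_def hip_adj_left[symmetric])

lemma decomp_along_unit:
  assumes "norm (y :: 'a::{real_normed_field,euclidean_space}^'n) = 1"
  obtains z' where "z = hip y z *s y + z'" "hip y z' = 0" "(norm z)\<^sup>2 = (norm (hip y z))\<^sup>2 + (norm z')\<^sup>2"
proof
  let ?z' = "z - hip y z *s y"
  show e: "z = hip y z *s y + ?z'" by simp
  show h: "hip y ?z' = 0" using assms by (simp add: hip_simps hip_self)
  show "(norm z)\<^sup>2 = (norm (hip y z))\<^sup>2 + (norm ?z')\<^sup>2"
    using norm_add_orthogonal[of "hip y z *s y" ?z'] h assms by (simp add: hip_simps norm_smult)
qed

lemma outer_plus_block:
  assumes "norm x = 1" "norm y = 1" "C \<in> orth_block x y" "spectral_norm C \<le> 1"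
  shows "(outer x y + C) *v y = x" "spectral_norm (outer x y + C) = 1"
proof -
  show e: "(outer x y + C) *v y = x"
    using assms by (simp add: matrix_vector_mult_add_rdistrib hip_self orth_block_def)
  show "spectral_norm (outer x y + C) = 1"
  proof (rule spectral_norm_eqI[of _ _ y])
    fix z
    obtain z' where z': "z = hip y z *s y + z'" "hip y z' = 0" "(norm z)\<^sup>2 = (norm (hip y z))\<^sup>2 + (norm z')\<^sup>2"
      using decomp_along_unit[OF assms(2)] by blast
    have Cz: "C *v z = C *v z'" using assms(3)
      by (subst z'(1)) (simp add: matrix_vector_right_distrib mult_vec_smult orth_block_def)
    have "(norm ((outer x y + C) *v z))\<^sup>2 = (norm (hip y z *s x + C *v z))\<^sup>2"
      by (simp add: matrix_vector_mult_add_rdistrib)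
    also have "\<dots> = (norm (hip y z))\<^sup>2 + (norm (C *v z'))\<^sup>2"
      using assms(1,3) norm_add_orthogonal[of "hip y z *s x" "C *v z"]
      by (simp add: hip_simps hip_orth_block norm_smult Cz)
    also have "\<dots> \<le> (norm z)\<^sup>2"
    proof -
      have "norm (C *v z') \<le> spectral_norm C * norm z'" by (rule spectral_norm_bound)
      also have "\<dots> \<le> norm z'" using mult_right_mono[OF assms(4), of "norm z'"] by simp
      finally have "norm (C *v z') \<le> norm z'" .
      then show ?thesis unfolding z'(3) by (simp add: power_mono)
    qed
    finally show "norm ((outer x y + C) *v z) \<le> 1 * norm z"
      unfolding mult_1 by (rule power2_le_imp_le) simp
  qed (use e assms in auto)
qed

lemma mscale_one [simp]: "mscale 1 A = A" by (simp add: mscale_def vec_eq_iff)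

lemma tea_pair_parallel: "tea_pair A B \<Longrightarrow> parallel_pair A B"
  unfolding tea_pair_def parallel_pair_def by (intro exI[of _ 1]) auto

text \<open>Both matrices attain their norm at \<open>y\<close>, in the same direction \<open>x\<close>.\<close>
lemma tea_pair_face:
  assumes "norm x = 1" "norm y = 1" "C \<in> orth_block x y" "spectral_norm C \<le> 1"
    "D \<in> orth_block x y" "spectral_norm D \<le> 1"
  shows "tea_pair (outer x y + C) (outer x y + D)"
proof -
  let ?A = "outer x y + C" and ?B = "outer x y + D"
  have a: "?A *v y = x" "spectral_norm ?A = 1" "?B *v y = x" "spectral_norm ?B = 1"
    using outer_plus_block assms by blast+
  have "(?A + ?B) *v y = 2 *s x" unfolding matrix_vector_mult_add_rdistrib[of ?A] a by (simp add: vec_eq_iff)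
  then have "2 \<le> spectral_norm (?A + ?B)" using spectral_norm_bound[of "?A + ?B" y] assms by (simp add: norm_smult)
  then show ?thesis using spectral_norm_triangle[of ?A ?B] a unfolding tea_pair_def by simp
qed

text \<open>A continuous function on a subspace with a Lipschitz bound at the origin has points close to
the origin where at most one subgradient exists: at a minimiser of \<open>K |C|^2 - N C\<close> the function \<open>N\<close> is touched from above by a
paraboloid, whose derivative any linear minorant must share.\<close>
lemma smooth_point:
  fixes N :: "'v::euclidean_space \<Rightarrow> real"
  assumes W: "subspace W" and cont: "continuous_on W N" and L: "L > 0" "\<And>C. C \<in> W \<Longrightarrow> \<bar>N C - N 0\<bar> \<le> L * norm C"
    and r: "r > 0"
  shows "\<exists>C0\<in>W. norm C0 < r \<and>
    (\<exists>g. \<forall>f. (\<forall>c C. f (c *\<^sub>R C) = c * f C) \<longrightarrow> (\<forall>C D. f (C + D) = f C + f D) \<longrightarrow>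
        (\<forall>C\<in>W. f C + N C0 \<le> N (C0 + C)) \<longrightarrow> (\<forall>C\<in>W. f C = g C))"
proof -
  \<comment> \<open>This weight makes the quadratic term win over the Lipschitz bound before the boundary of the
    ball is reached, so that the minimiser is an interior point.\<close>
  define K where "K = 2 * L / r"
  have K: "K > 0" using L r by (simp add: K_def)
  let ?S = "W \<inter> cball 0 r"
  have "compact ?S" by (simp add: W closed_Int_compact closed_subspace)
  moreover have "0 \<in> ?S" using W r by (simp add: subspace_0)
  moreover have "continuous_on ?S (\<lambda>C. K * (norm C)\<^sup>2 - N C)"
    by (intro continuous_intros continuous_on_subset[OF cont]) auto
  ultimately obtain C0 where C0: "C0 \<in> ?S" and
    min: "\<And>C. C \<in> ?S \<Longrightarrow> K * (norm C0)\<^sup>2 - N C0 \<le> K * (norm C)\<^sup>2 - N C"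
    using continuous_attains_inf[of ?S "\<lambda>C. K * (norm C)\<^sup>2 - N C"] by blast
  have "K * (norm C0)\<^sup>2 \<le> L * norm C0" using min[of 0] \<open>0 \<in> ?S\<close> L(2)[of C0] C0 by auto
  then have "norm C0 < r"
  proof (cases "norm C0 = 0")
    case False
    have "K * norm C0 \<le> L" using \<open>K * (norm C0)\<^sup>2 \<le> L * norm C0\<close> False by (simp add: power2_eq_square)
    then have "2 * norm C0 \<le> r" using L r by (simp add: K_def field_simps)
    then show ?thesis using False by (smt (verit) norm_ge_zero)
  qed (use r in auto)
  moreover have "f C = 2 * K * inner C0 C"
    if f: "\<forall>c C. f (c *\<^sub>R C) = c * f C" "\<forall>C\<in>W. f C + N C0 \<le> N (C0 + C)" and C: "C \<in> W" for f C
  proof -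
    let ?d = "f C - 2 * K * inner C0 C"
    have key: "s * ?d \<le> K * s\<^sup>2 * (norm C)\<^sup>2" if "\<bar>s\<bar> * norm C \<le> r - norm C0" for s :: real
    proof -
      have sC: "C0 + s *\<^sub>R C \<in> W" "s *\<^sub>R C \<in> W" using W C C0 by (auto simp: subspace_add subspace_scale)
      have "norm (C0 + s *\<^sub>R C) \<le> r" using norm_triangle_ineq[of C0 "s *\<^sub>R C"] that by simp
      then have "C0 + s *\<^sub>R C \<in> ?S" using sC by simp
      from min[OF this] have "N (C0 + s *\<^sub>R C) - N C0 \<le> K * ((norm (C0 + s *\<^sub>R C))\<^sup>2 - (norm C0)\<^sup>2)"
        by (simp add: algebra_simps)
      also have "\<dots> = 2 * K * s * inner C0 C + K * s\<^sup>2 * (norm C)\<^sup>2"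
        unfolding power2_norm_eq_inner
        by (simp add: inner_add_left inner_add_right inner_commute algebra_simps power2_eq_square)
      finally show ?thesis using f sC(2) by (auto simp: algebra_simps)
    qed
    have "?d = 0"
    proof (rule ccontr)
      assume d: "?d \<noteq> 0"
      define n where "n = K * (norm C)\<^sup>2 + 1"
      have n: "n > 0" unfolding n_def using K by (smt (verit) mult_nonneg_nonneg zero_le_power2)
      \<comment> \<open>Small enough to stay in the ball and to make the quadratic term smaller than the linear one.\<close>
      define e where "e = min (\<bar>?d\<bar> / n) ((r - norm C0) / (norm C + 1))"
      have e: "e > 0" using d n \<open>norm C0 < r\<close> by (auto simp: e_def divide_pos_pos add_nonneg_pos)
      have "e * norm C \<le> e * (norm C + 1)" using e by simp
      also have "\<dots> \<le> r - norm C0" unfolding e_def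
        by (smt (verit) min.cobounded2 norm_ge_zero pos_le_divide_eq)
      finally have e1: "e * norm C \<le> r - norm C0" .
      have e2: "e * n \<le> \<bar>?d\<bar>" using n by (simp add: e_def min_le_iff_disj pos_le_divide_eq[symmetric])
      have "e * \<bar>?d\<bar> \<le> K * e\<^sup>2 * (norm C)\<^sup>2"
        using key[of "e"] key[of "-e"] e e1 by (cases "?d \<ge> 0") (auto simp: abs_if right_diff_distrib)
      also have "\<dots> < e * (e * n)" using e by (simp add: n_def power2_eq_square algebra_simps)
      also have "\<dots> \<le> e * \<bar>?d\<bar>" using e e2 by simp
      finally show False by simp
    qed
    then show ?thesis by simp
  qed
  ultimately show ?thesis using C0 by (intro bexI[of _ C0] conjI exI[of _ "\<lambda>C. 2 * K * inner C0 C"]) auto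
qed

section \<open>Supporting functionals of a parallel preserver\<close>
lemma inner_le_norm_hip: "inner p z \<le> norm (hip p z)"
  using norm_cauchy_schwarz[of "hip p z" 1] by (simp add: inner_hip)

text \<open>A scalar-linear functional is determined by its real part.\<close>
lemma zero_if_inner_multiples_zero:
  fixes d :: "'a::{real_normed_field,euclidean_space}"
  assumes "\<And>c. inner (c * d) 1 = 0" shows "d = 0"
  using assms[of "conjugate d"] by (simp add: inner_eq_conjugate[symmetric])

lemma dual_pair_align:
  assumes "norm p = 1" "norm (hip p z) = N"
  shows "\<exists>p'. norm p' = 1 \<and> hip p' z = of_real N \<and> (\<forall>w. norm (hip p' w) = norm (hip p w))"
proof -
  obtain c where c: "norm c = 1" "c * hip p z = of_real (norm (hip p z))" using unimodular_align by blast
  show ?thesis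
    by (rule exI[of _ "conjugate c *s p"]) (use c assms in \<open>simp add: norm_smult hip_simps norm_mult\<close>)
qed

lemma subspace_orth_block: "subspace (orth_block x y)"
  by (auto simp: subspace_def orth_block_add orth_block_scaleR)

text \<open>The functional \<open>A \<mapsto> p* (T A) q\<close> is bounded by the spectral norm of \<open>T A\<close>; here it attains
this bound in modulus on the whole face of \<open>outer x y\<close>, with the phase normalised at \<open>outer x y\<close>.\<close>
definition supports where
  "supports T x y p q \<longleftrightarrow> norm p = 1 \<and> norm q = 1 \<and>
     hip p (T (outer x y) *v q) = of_real (spectral_norm (T (outer x y))) \<and>
     (\<forall>C\<in>orth_block x y. spectral_norm C \<le> 1 \<longrightarrow>
        norm (hip p (T (outer x y + C) *v q)) = spectral_norm (T (outer x y + C)))"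

text \<open>Any two matrices of the face have parallel images, but a pairwise statement does not by itself
yield a common norming pair. It does at a smooth point \<open>z\<close> of the face: each matrix of the face
shares a norming pair with \<open>z\<close>, and all the functionals obtained in this way support the norm at \<open>z\<close>,
so they agree on the span of the face. Hence one of them serves for all.\<close>
lemma supporting_functional:
  fixes T :: "'a::{real_normed_field,euclidean_space}^'n^'m \<Rightarrow> 'a^'n^'m"
  assumes lin: "mlinear T" and pres: "preserves_pairs parallel_pair T"
    and xy: "norm x = 1" "norm y = 1"
  shows "\<exists>p q. supports T x y p q"
proof -
  let ?W = "orth_block x y"
  define N where "N C = spectral_norm (T (outer x y + C))" for C
  obtain L where L: "L > 0" "\<And>A B. \<bar>spectral_norm (T A) - spectral_norm (T B)\<bar> \<le> L * norm (A - B)"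
    using spectral_norm_comp_lipschitz[OF lin] by blast
  obtain M where M: "M > 0" "\<And>A :: 'a^'n^'m. spectral_norm A \<le> M * norm A"
    using spectral_norm_le_norm by metis
  have "continuous_on ?W N" unfolding N_def
    by (rule continuous_on_compose2[OF spectral_norm_comp_continuous[OF lin, of UNIV]]) (auto intro!: continuous_intros)
  moreover have "\<bar>N C - N 0\<bar> \<le> L * norm C" for C using L(2)[of "outer x y + C" "outer x y"] by (simp add: N_def)
  moreover have "1 / M > 0" using M(1) by simp
  ultimately have "\<exists>C0\<in>?W. norm C0 < 1 / M \<and>
    (\<exists>g. \<forall>f. (\<forall>c C. f (c *\<^sub>R C) = c * f C) \<longrightarrow> (\<forall>C D. f (C + D) = f C + f D) \<longrightarrow>
        (\<forall>C\<in>?W. f C + N C0 \<le> N (C0 + C)) \<longrightarrow> (\<forall>C\<in>?W. f C = g C))"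
    by (intro smooth_point[OF subspace_orth_block _ L(1)])
  then obtain C0 g where C0: "C0 \<in> ?W" "norm C0 < 1 / M" and
    g: "\<And>f. (\<forall>c C. f (c *\<^sub>R C) = c * f C) \<Longrightarrow> (\<forall>C D. f (C + D) = f C + f D) \<Longrightarrow>
        (\<forall>C\<in>?W. f C + N C0 \<le> N (C0 + C)) \<Longrightarrow> (\<forall>C\<in>?W. f C = g C)"
    by blast
  let ?z = "outer x y + C0"
  have "M * norm C0 \<le> 1" using C0(2) M(1) by (simp add: field_simps)
  then have C0': "spectral_norm C0 \<le> 1" using M(2)[of C0] by simp
  \<comment> \<open>Every functional that norms the image of the smooth point has the same real part on the block.\<close>
  have reg: "inner p (T C *v q) = g C"
    if "norm p = 1" "norm q = 1" "hip p (T ?z *v q) = of_real (N C0)" "C \<in> ?W" for p q C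
  proof -
    have z: "inner p (T ?z *v q) = N C0" using that(3) by (simp add: inner_hip of_real_def)
    have "inner p (T C *v q) + N C0 \<le> N (C0 + C)" for C
    proof -
      have "inner p (T C *v q) + N C0 = inner p (T (outer x y + (C0 + C)) *v q)"
        using z by (simp add: mlinear_add[OF lin] matrix_vector_mult_add_rdistrib inner_add_right)
      also have "\<dots> \<le> N (C0 + C)" unfolding N_def
        using inner_le_norm_hip hip_le_spectral_norm[OF that(1,2)] order_trans by blast
      finally show ?thesis .
    qed
    moreover have "inner p (T (c *\<^sub>R C) *v q) = c * inner p (T C *v q)" for c C
      unfolding mlinear_scaleR[OF lin] scaleR_mscale[of c "T C"] mscale_mult_vec scaleR_smult[symmetric] by simp
    moreover have "inner p (T (C + D) *v q) = inner p (T C *v q) + inner p (T D *v q)" for C D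
      by (simp add: mlinear_add[OF lin] matrix_vector_mult_add_rdistrib inner_add_right)
    ultimately show ?thesis
      using g[of "\<lambda>C. inner p (T C *v q)"] that(4) by blast
  qed
  have ex: "\<exists>p q. norm p = 1 \<and> norm q = 1 \<and> hip p (T ?z *v q) = of_real (N C0)
      \<and> norm (hip p (T (outer x y + C) *v q)) = N C" if C: "C \<in> ?W" "spectral_norm C \<le> 1" for C
  proof -
    have "parallel_pair (T ?z) (T (outer x y + C))"
      using pres tea_pair_parallel[OF tea_pair_face[OF xy C0(1) C0' C]] unfolding preserves_pairs_def by blast
    from parallel_pairD[OF this] obtain p q where pq: "norm p = 1" "norm q = 1"
       "norm (hip p (T ?z *v q)) = N C0" "norm (hip p (T (outer x y + C) *v q)) = N C"
      unfolding N_def by blast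
    from dual_pair_align[OF pq(1,3)] pq show ?thesis by metis
  qed
  obtain p q where pq: "norm p = 1" "norm q = 1" "hip p (T ?z *v q) = of_real (N C0)"
    using ex[OF C0(1) C0'] by blast
  \<comment> \<open>The pair chosen for the smooth point can replace the pair that depends on \<open>C\<close>.\<close>
  have main: "norm (hip p (T (outer x y + C) *v q)) = N C" if C: "C \<in> ?W" "spectral_norm C \<le> 1" for C
  proof -
    obtain p' q' where p': "norm p' = 1" "norm q' = 1" "hip p' (T ?z *v q') = of_real (N C0)"
      "norm (hip p' (T (outer x y + C) *v q')) = N C" using ex[OF C] by blast
    have eq: "hip p (T D *v q) = hip p' (T D *v q')" if D: "D \<in> ?W" for D
    proof -
      have "hip p (T D *v q) - hip p' (T D *v q') = 0"
      proof (rule zero_if_inner_multiples_zero)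
        fix c
        have "inner p (T (mscale c D) *v q) = inner p' (T (mscale c D) *v q')"
          using reg[OF pq] reg[OF p'(1-3)] orth_block_mscale[OF D] by simp
        then show "inner (c * (hip p (T D *v q) - hip p' (T D *v q'))) 1 = 0"
          by (simp add: inner_hip mlinear_mscale[OF lin] hip_simps right_diff_distrib inner_diff_left)
      qed
      then show ?thesis by simp
    qed
    have "hip p (T (outer x y + C) *v q) = hip p' (T (outer x y + C) *v q')"
    proof -
      have "hip r (T (outer x y + C) *v s) = hip r (T ?z *v s) - hip r (T C0 *v s) + hip r (T C *v s)" for r s
        by (simp add: mlinear_add[OF lin] matrix_vector_mult_add_rdistrib hip_simps)
      then show ?thesis using eq[OF C0(1)] eq[OF C(1)] pq(3) p'(3) by simp
    qed
    then show ?thesis using p'(4) by simp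
  qed
  have "norm (hip p (T (outer x y) *v q)) = spectral_norm (T (outer x y))"
    using main[of 0] by (simp add: N_def spectral_norm_0_iff[THEN iffD2])
  from dual_pair_align[OF pq(1) this] main pq(2) show ?thesis unfolding N_def supports_def by metis
qed

section \<open>Images of orthogonal rank-one matrices\<close>
definition dependent_pair where
  "dependent_pair A B \<longleftrightarrow> (\<exists>a b. (a \<noteq> 0 \<or> b \<noteq> 0) \<and> mscale a A + mscale b B = 0)"

lemma norm_add_sq: "(norm (a + b))\<^sup>2 = (norm a)\<^sup>2 + (norm b)\<^sup>2 + 2 * inner a (b::'a::real_inner)"
  by (simp add: power2_norm_eq_inner inner_add_left inner_add_right inner_commute)

lemma two_squares_eq:
  fixes a b c d :: real
  assumes "a\<ge>0" "b\<ge>0" "c\<ge>0" "d\<ge>0" "a\<^sup>2 + b\<^sup>2 = c\<^sup>2 + d\<^sup>2" "a * b = c * d"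
  shows "a = c \<and> b = d \<or> a = d \<and> b = c"
proof -
  have "(a\<^sup>2 - c\<^sup>2) * (a\<^sup>2 - d\<^sup>2) = a\<^sup>2 * (a\<^sup>2 - (c\<^sup>2 + d\<^sup>2)) + (c*d)\<^sup>2" by algebra
  also have "\<dots> = a\<^sup>2 * (- b\<^sup>2) + (a*b)\<^sup>2"
  proof -
    have "a\<^sup>2 - (c\<^sup>2 + d\<^sup>2) = - b\<^sup>2" using assms(5) by simp
    then show ?thesis using assms(6) by simp
  qed
  also have "\<dots> = 0" by algebra
  finally have "a\<^sup>2 = c\<^sup>2 \<or> a\<^sup>2 = d\<^sup>2" by simp
  then show ?thesis using assms by auto
qed

text \<open>The choices \<open>c = 1\<close> and \<open>c = - 1\<close> give equal sums of squares, the choices aligned with \<open>f\<close> and with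
\<open>g\<close> give equal products.\<close>
lemma affine_moduli:
  fixes f g :: "'a::{real_normed_field,euclidean_space}" and h k :: real
  assumes "h \<ge> 0" "k \<ge> 0"
    and eq: "\<And>c. norm c = 1 \<Longrightarrow> norm (of_real h + c * f) = norm (c * of_real k + g)"
  shows "h = k \<and> norm f = norm g \<or> h = norm g \<and> norm f = k"
proof -
  have sq: "h\<^sup>2 + (norm f)\<^sup>2 + 2 * h * inner 1 (c * f) = k\<^sup>2 + (norm g)\<^sup>2 + 2 * k * inner c g" if "norm c = 1" for c
  proof -
    have "(norm (of_real h + c * f))\<^sup>2 = (norm (c * of_real k + g))\<^sup>2" using eq[OF that] by simp
    then show ?thesis using that
      by (simp add: norm_add_sq norm_mult power_mult_distrib of_real_def)
  qed
  have s: "h\<^sup>2 + (norm f)\<^sup>2 = k\<^sup>2 + (norm g)\<^sup>2"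
    using sq[of 1] sq[of "-1"] by simp
  have p: "h * inner 1 (c * f) = k * inner c g" if "norm c = 1" for c using sq[OF that] s by simp
  have le: "inner 1 (c * f) \<le> norm f" "inner c g \<le> norm g" if "norm c = 1" for c
    using norm_cauchy_schwarz[of 1 "c * f"] norm_cauchy_schwarz[of c g] that by (simp_all add: norm_mult)
  obtain c where c: "norm c = 1" "c * f = of_real (norm f)" using unimodular_align by blast
  have "h * norm f \<le> k * norm g"
    using p[OF c(1)] le(2)[OF c(1)] assms(2) c(2) mult_left_mono[OF le(2)[OF c(1)] assms(2)] by (simp add: of_real_def)
  moreover
  obtain d where d: "norm d = 1" "d * g = of_real (norm g)" using unimodular_align by blast
  have "inner (conjugate d) g = norm g"
    using inner_eq_conjugate[of "conjugate d" g] d(2) by (simp add: of_real_def)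
  then have "k * norm g \<le> h * norm f"
    using p[of "conjugate d"] mult_left_mono[OF le(1)[of "conjugate d"] assms(1)] d(1) by simp
  ultimately have "h * norm f = k * norm g" by simp
  from two_squares_eq[OF _ _ _ _ s this] assms show ?thesis by auto
qed

lemma degenerate_affine:
  fixes f :: "'a::{real_normed_field,euclidean_space}"
  assumes "norm (of_real h :: 'a) \<le> norm f"
  shows "\<exists>c. norm c \<le> 1 \<and> of_real h + c * f = 0"
proof (cases "f = 0")
  case False then show ?thesis using assms
    by (intro exI[of _ "- of_real h / f"]) (simp add: norm_divide divide_simps)
qed (use assms in \<open>auto intro: exI[of _ 0]\<close>)

text \<open>The matrix \<open>x y* + c u v*\<close> with \<open>|c| = 1\<close> lies, up to the factor \<open>c\<close>, in the faces of both
rank-one matrices, so the two supporting functionals must give the same modulus for every such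
\<open>c\<close>. By \<open>affine_moduli\<close> the two norms agree or are interchanged with the mixed values; in the
second case one of the two affine functions has a zero in the unit disc, which is a linear relation
between the images.\<close>
lemma orthogonal_images_dichotomy:
  fixes T :: "'a::{real_normed_field,euclidean_space}^'n^'m \<Rightarrow> 'a^'n^'m"
  assumes lin: "mlinear T" and pres: "preserves_pairs parallel_pair T"
    and u: "norm x = 1" "norm y = 1" "norm u = 1" "norm v = 1" and o: "hip x u = 0" "hip y v = 0"
  shows "dependent_pair (T (outer x y)) (T (outer u v)) \<or> spectral_norm (T (outer x y)) = spectral_norm (T (outer u v))"
proof -
  let ?R = "T (outer x y)" and ?S = "T (outer u v)"
  define h where "h = spectral_norm ?R"
  define k where "k = spectral_norm ?S"
  obtain p q where pq: "hip p (?R *v q) = of_real h"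
     "\<And>C. C\<in>orth_block x y \<Longrightarrow> spectral_norm C \<le> 1 \<Longrightarrow>
        norm (hip p (T (outer x y + C) *v q)) = spectral_norm (T (outer x y + C))"
    using supporting_functional[OF lin pres u(1,2)] unfolding h_def supports_def by blast
  obtain p' q' where pq': "hip p' (?S *v q') = of_real k"
     "\<And>C. C\<in>orth_block u v \<Longrightarrow> spectral_norm C \<le> 1 \<Longrightarrow>
        norm (hip p' (T (outer u v + C) *v q')) = spectral_norm (T (outer u v + C))"
    using supporting_functional[OF lin pres u(3,4)] unfolding k_def supports_def by blast
  define f where "f = hip p (?S *v q)"
  define g where "g = hip p' (?R *v q')"
  have 1: "spectral_norm (?R + mscale c ?S) = norm (of_real h + c * f)" if "norm c \<le> 1" for c
    using pq(2)[of "mscale c (outer u v)"] pq(1) that u o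
    by (simp add: orth_block_mscale outer_orth_block spectral_norm_mscale mlinear_add[OF lin] mlinear_mscale[OF lin]
        matrix_vector_mult_add_rdistrib hip_simps f_def)
  have 2: "spectral_norm (mscale c ?R + ?S) = norm (c * g + of_real k)" if "norm c \<le> 1" for c
    using pq'(2)[of "mscale c (outer x y)"] pq'(1) that u o
    by (simp add: orth_block_mscale outer_orth_block hip_commute_0 spectral_norm_mscale mlinear_add[OF lin] mlinear_mscale[OF lin]
        matrix_vector_mult_add_rdistrib hip_simps g_def add.commute)
  have "norm (of_real h + c * f) = norm (c * of_real k + g)" if c: "norm c = 1" for c
  proof -
    have c1: "c * conjugate c = 1" "conjugate c * c = 1"
      using conjugate_mult_self[of c] c by (simp_all add: mult.commute)
    have "mscale c (mscale (conjugate c) ?R + ?S) = ?R + mscale c ?S"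
      by (simp add: mat.scale_right_distrib c1)
    then have "spectral_norm (?R + mscale c ?S) = spectral_norm (mscale (conjugate c) ?R + ?S)"
      using spectral_norm_mscale[of c "mscale (conjugate c) ?R + ?S"] c by simp
    also have "\<dots> = norm c * norm (conjugate c * g + of_real k)" using 2[of "conjugate c"] c by simp
    also have "\<dots> = norm (c * of_real k + g)"
      unfolding norm_mult[symmetric] distrib_left mult.assoc[symmetric] c1 by (simp add: add.commute)
    finally show ?thesis using 1[of c] c by simp
  qed
  from affine_moduli[OF _ _ this] have cases: "h = k \<or> h = norm g \<and> norm f = k"
    by (auto simp: h_def k_def)
  show ?thesis
  proof (cases "h = k")
    case False
    with cases have e: "h = norm g" "norm f = k" by auto
    have "h \<ge> 0" "k \<ge> 0" by (auto simp: h_def k_def)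
    show ?thesis
    proof (cases "h \<le> k")
      case True
      then obtain c where "norm c \<le> 1" "of_real h + c * f = 0"
        using degenerate_affine[of h f] e \<open>h \<ge> 0\<close> by auto
      then have "?R + mscale c ?S = 0" using 1[of c] by simp
      then have "dependent_pair ?R ?S" unfolding dependent_pair_def by (intro exI[of _ 1] exI[of _ c]) simp
      then show ?thesis ..
    next
      case False
      then obtain c where "norm c \<le> 1" "of_real k + c * g = 0"
        using degenerate_affine[of k g] e \<open>k \<ge> 0\<close> by auto
      then have "mscale c ?R + ?S = 0" using 2[of c] by (simp add: add.commute)
      then have "dependent_pair ?R ?S" unfolding dependent_pair_def by (intro exI[of _ c] exI[of _ 1]) simp
      then show ?thesis ..
    qed
  qed (simp add: h_def k_def)
qed

section \<open>Maps that send all orthogonal pairs to dependent pairs\<close>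

text \<open>The scalar multiples of the given vectors span a real subspace of dimension at most
\<open>card X * DIM('a)\<close>, which is not the whole space.\<close>
lemma exists_orthogonal_unit_to_set:
  fixes X :: "('a::{real_normed_field,euclidean_space}^'n) set"
  assumes X: "finite X" "card X < CARD('n)"
  shows "\<exists>v. norm v = 1 \<and> (\<forall>y\<in>X. hip y v = 0)"
proof -
  let ?S = "(\<lambda>(b, y). b *s y) ` ((Basis :: 'a set) \<times> X)"
  have "dim ?S \<le> card ?S" using X(1) by (intro dim_le_card') simp
  also have "\<dots> \<le> card ((Basis :: 'a set) \<times> X)" using X(1) by (intro card_image_le) simp
  also have "\<dots> = card X * DIM('a)" by (simp add: card_cartesian_product mult.commute)
  also have "\<dots> < CARD('n) * DIM('a)" using X(2) by (rule mult_strict_right_mono) simp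
  also have "\<dots> = DIM('a^'n)" by simp
  finally have "dim ?S < DIM('a^'n)" .
  then obtain w where w: "w \<noteq> 0" "\<And>s. s \<in> span ?S \<Longrightarrow> orthogonal w s"
    by (rule orthogonal_to_subspace_exists) (rule that)
  have zero: "hip y w = 0" if "y \<in> X" for y
  proof (rule euclidean_eqI)
    fix b :: 'a assume b: "b \<in> Basis"
    have "orthogonal w (b *s y)" by (intro w(2) span_base) (use b that in auto)
    then have "inner (b *s y) w = 0" by (simp add: orthogonal_def inner_commute)
    then show "inner (hip y w) b = inner 0 b"
      using inner_eq_conjugate[of b "hip y w"] by (simp add: inner_hip hip_simps inner_commute)
  qed
  show ?thesis by (rule exI[of _ "(1 / norm w) *\<^sub>R w"]) (use w(1) zero in \<open>auto simp: hip_simps\<close>)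
qed

lemma exists_orthogonal_unit2:
  fixes y z :: "'a::{real_normed_field,euclidean_space}^'n"
  assumes "CARD('n) \<ge> 3"
  shows "\<exists>v. norm v = 1 \<and> hip y v = 0 \<and> hip z v = 0"
proof -
  have "card {y, z} < CARD('n)" using assms by (cases "y = z") auto
  then show ?thesis using exists_orthogonal_unit_to_set[of "{y, z}"] by auto
qed

lemma exists_orthogonal_unit:
  fixes y :: "'a::{real_normed_field,euclidean_space}^'n"
  assumes "CARD('n) \<ge> 2"
  shows "\<exists>v. norm v = 1 \<and> hip y v = 0"
  using exists_orthogonal_unit_to_set[of "{y}"] assms by auto

definition rank_le_one :: "('a::field^'n^'m \<Rightarrow> 'a^'q^'p) \<Rightarrow> bool" where
  "rank_le_one T \<longleftrightarrow> (\<exists>R. \<forall>A. \<exists>c. T A = mscale c R)"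

text \<open>The scalar multiples of \<open>R\<close>. Unlike \<open>rank_le_one\<close>, this allows partial statements about the images
of some rank-one matrices.\<close>
definition line :: "'a::field^'n^'m \<Rightarrow> ('a^'n^'m) set" where
  "line R = range (\<lambda>c. mscale c R)"

lemma line_0 [simp]: "0 \<in> line R" unfolding line_def by (rule image_eqI[of _ _ 0]) auto
lemma line_self [simp]: "R \<in> line R" unfolding line_def by (rule image_eqI[of _ _ 1]) auto
lemma line_add: "A \<in> line R \<Longrightarrow> B \<in> line R \<Longrightarrow> A + B \<in> line R"
  unfolding line_def by (auto simp: mat.scale_left_distrib[symmetric])
lemma line_mscale: "A \<in> line R \<Longrightarrow> mscale c A \<in> line R"
  unfolding line_def by auto
lemma line_minus: "A \<in> line R \<Longrightarrow> - A \<in> line R"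
  using line_mscale[of A R "-1"] by (simp add: minus_mscale[symmetric])
lemma line_sum: "(\<And>i. i \<in> S \<Longrightarrow> f i \<in> line R) \<Longrightarrow> sum f S \<in> line R"
  by (induction S rule: infinite_finite_induct) (auto intro: line_add)
lemma line_mscale_iff: "c \<noteq> 0 \<Longrightarrow> mscale c A \<in> line R \<longleftrightarrow> A \<in> line R"
  using line_mscale[of "mscale c A" R "inverse c"] line_mscale[of A R c] by auto
lemma line_trans: "A \<in> line R \<Longrightarrow> R \<in> line S \<Longrightarrow> A \<in> line S"
  unfolding line_def by auto

lemma dependent_pair_line: "dependent_pair A B \<Longrightarrow> A \<noteq> 0 \<Longrightarrow> B \<in> line A"
proof -
  assume "dependent_pair A B" and A: "A \<noteq> 0"
  then obtain a b where ab: "a \<noteq> 0 \<or> b \<noteq> 0" "mscale a A + mscale b B = 0" unfolding dependent_pair_def by blast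
  have "b \<noteq> 0"
  proof
    assume "b = 0" then have "mscale a A = 0" using ab by simp
    then show False using ab A \<open>b = 0\<close> by auto
  qed
  moreover have "mscale b B \<in> line A" using ab(2) line_minus[OF line_mscale[OF line_self], of a A]
    by (metis add_eq_0_iff)
  ultimately show ?thesis by (simp add: line_mscale_iff)
qed

lemma rank_le_one_line: "rank_le_one T \<longleftrightarrow> (\<exists>R. \<forall>A. T A \<in> line R)"
  unfolding rank_le_one_def line_def by (auto simp: image_iff)

lemma line_rank_le_oneI:
  fixes T :: "'a::{real_normed_field,euclidean_space}^'n^'m \<Rightarrow> 'a^'q^'p"
  assumes "mlinear T" "\<And>x y. T (outer x y) \<in> line R" shows "rank_le_one T"
  unfolding rank_le_one_line
proof (intro exI[of _ R] allI)
  fix A show "T A \<in> line R"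
    by (subst matrix_sum_outer) (auto simp: mlinear_sum[OF assms(1)] intro: line_sum assms(2))
qed

text \<open>If \<open>T (outer a b)\<close> is nonzero, it stays so for \<open>b + d\<close> or for \<open>b - d\<close>. The complements of \<open>b\<close> and of
this perturbed vector together span everything, so information about \<open>T (outer c z)\<close> for \<open>z\<close> in these
two complements extends to all \<open>z\<close>.\<close>
lemma spread_line:
  fixes T :: "'a::{real_normed_field,euclidean_space}^'n^'m \<Rightarrow> 'a^'q^'p"
  assumes lin: "mlinear T" and b: "norm b = 1" and d: "norm d = 1" "hip b d = 0" and ab: "T (outer a b) \<noteq> 0"
    and spread: "\<And>e z. e = 1 \<or> e = (-1::real) \<Longrightarrow> T (outer a (b + e *\<^sub>R d)) \<noteq> 0 \<Longrightarrow> hip (b + e *\<^sub>R d) z = 0 \<Longrightarrow> T (outer c z) \<in> line R"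
    and base: "\<And>z. hip b z = 0 \<Longrightarrow> T (outer c z) \<in> line R"
  shows "T (outer c z) \<in> line R"
proof -
  obtain e :: real where e: "e = 1 \<or> e = -1" "T (outer a (b + e *\<^sub>R d)) \<noteq> 0"
  proof (cases "T (outer a (b + d)) = 0 \<and> T (outer a (b - d)) = 0")
    case True
    then have "T (outer a (b + d)) + T (outer a (b - d)) = 0" by simp
    then have "T (outer a b) + T (outer a b) = 0"
      by (simp add: mlinear_add[OF lin] mlinear_diff[OF lin] outer_add_right outer_diff_right)
    then have "mscale 2 (T (outer a b)) = 0" by (simp add: mscale_def vec_eq_iff)
    then show ?thesis using ab by auto
  qed (use that[of 1] that[of "-1"] in auto)
  have db: "hip d b = 0" using d(2) by (rule hip_commute_0)
  have "hip (b + e *\<^sub>R d) (b - e *\<^sub>R d) = 0"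
    using b d db e(1) by (auto simp: hip_simps hip_self)
  from spread[OF e this] have "T (outer c (b - e *\<^sub>R d)) \<in> line R" .
  moreover have "T (outer c (e *\<^sub>R d)) \<in> line R" by (rule base) (simp add: hip_simps d)
  ultimately have "T (outer c (b - e *\<^sub>R d)) + T (outer c (e *\<^sub>R d)) \<in> line R" by (rule line_add)
  then have bl: "T (outer c b) \<in> line R" by (simp add: mlinear_add[OF lin, symmetric] outer_add_right[symmetric])
  obtain z' where z': "z = hip b z *s b + z'" "hip b z' = 0" using decomp_along_unit[OF b] by blast
  have "T (outer c z) = mscale (conjugate (hip b z)) (T (outer c b)) + T (outer c z')"
    by (subst z'(1)) (simp add: outer_add_right outer_smult_right mlinear_add[OF lin] mlinear_mscale[OF lin])
  then show ?thesis using bl base[OF z'(2)] by (simp add: line_add line_mscale)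
qed

lemma line_zero: "line 0 = {0}" by (auto simp: line_def)

lemma normalize_nonzero:
  fixes T :: "'a::{real_normed_field,euclidean_space}^'n^'m \<Rightarrow> 'a^'q^'p"
  assumes lin: "mlinear T" and "T (outer x y) \<noteq> 0"
  obtains r s where "r > 0" "s > 0" "norm (r *\<^sub>R x) = 1" "norm (s *\<^sub>R y) = 1" "T (outer (r *\<^sub>R x) (s *\<^sub>R y)) \<noteq> 0"
proof
  have n: "x \<noteq> 0" "y \<noteq> 0" using assms(2) by (auto simp: outer_zero_left outer_zero_right mlinear_zero[OF lin])
  then show "1 / norm x > 0" "1 / norm y > 0" "norm ((1 / norm x) *\<^sub>R x) = 1" "norm ((1 / norm y) *\<^sub>R y) = 1" by auto
  show "T (outer ((1 / norm x) *\<^sub>R x) ((1 / norm y) *\<^sub>R y)) \<noteq> 0"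
    using n assms(2) by (simp add: outer_scaleR_left outer_scaleR_right mlinear_mscale[OF lin])
qed

text \<open>Suppose the range is not a line. If some \<open>T (outer x y)\<close> and some orthogonal
\<open>T (outer u w)\<close> were both nonzero, then spreading from \<open>outer u w\<close> to the row of \<open>x\<close>, and from there to the
rows orthogonal to \<open>x\<close>, would put everything on the line of \<open>T (outer x y)\<close>; the third dimension
provides the direction for the perturbation. So a nonzero \<open>T (outer x y)\<close> forces all rows orthogonal
to \<open>x\<close> to vanish, and applying this to \<open>x + u\<close> and \<open>x - u\<close> as well gives a contradiction.\<close>
lemma all_orthogonal_dependent_rank_le_one:
  fixes T :: "'a::{real_normed_field,euclidean_space}^'n^'m \<Rightarrow> 'a^'q^'p"
  assumes lin: "mlinear T" and m: "CARD('m) \<ge> 2" and n: "CARD('n) \<ge> 3"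
    and dep: "\<And>x y u v. hip x u = 0 \<Longrightarrow> hip y v = 0 \<Longrightarrow> dependent_pair (T (outer x y)) (T (outer u v))"
  shows "rank_le_one T"
proof (rule ccontr)
  assume not1: "\<not> rank_le_one T"
  have dl: "T (outer u v) \<in> line (T (outer x y))" if "hip x u = 0" "hip y v = 0" "T (outer x y) \<noteq> 0" for x y u v
    using dependent_pair_line[OF dep] that by blast
  have n2: "CARD('n) \<ge> 2" using n by simp
  have zero: "T (outer u w) = 0" if L: "T (outer x y) \<noteq> 0" and xy: "norm x = 1" "norm y = 1" and uw: "hip x u = 0" "hip y w = 0" for x y u w
  proof (rule ccontr)
    assume L2: "T (outer u w) \<noteq> 0"
    obtain r s where rs: "r > 0" "s > 0" and un: "norm (r *\<^sub>R u) = 1" "norm (s *\<^sub>R w) = 1"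
      and L': "T (outer (r *\<^sub>R u) (s *\<^sub>R w)) \<noteq> 0" using normalize_nonzero[OF lin L2] by blast
    define u' where "u' = r *\<^sub>R u"
    define w' where "w' = s *\<^sub>R w"
    note un = un[folded u'_def w'_def] and L' = L'[folded u'_def w'_def]
    have o: "hip x u' = 0" "hip y w' = 0" using uw by (simp_all add: u'_def w'_def hip_simps)
    have o': "hip u' x = 0" "hip w' y = 0" using o by (simp_all add: hip_commute_0)
    let ?R = "T (outer x y)"
    have uwR: "T (outer u' w') \<in> line ?R" using dl[OF o L] .
    obtain v where v: "norm v = 1" "hip y v = 0" "hip w' v = 0" using exists_orthogonal_unit2[OF n] by blast
    have xR: "T (outer x z) \<in> line ?R" for z
    proof (rule spread_line[OF lin un(2) v(1,3) L'])
      fix e :: real and z assume ne: "T (outer u' (w' + e *\<^sub>R v)) \<noteq> 0" and h: "hip (w' + e *\<^sub>R v) z = 0"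
      have "T (outer u' (w' + e *\<^sub>R v)) \<in> line ?R" by (rule dl[OF o(1) _ L]) (simp add: hip_simps o v)
      with dl[OF o'(1) h ne] show "T (outer x z) \<in> line ?R" by (rule line_trans)
    next
      fix z assume "hip w' z = 0"
      from dl[OF o'(1) this L'] uwR show "T (outer x z) \<in> line ?R" by (rule line_trans)
    qed
    obtain d where d: "norm d = 1" "hip y d = 0" using exists_orthogonal_unit[OF n2] by blast
    have cR: "T (outer c z) \<in> line ?R" if c: "hip x c = 0" for c z
    proof (rule spread_line[OF lin xy(2) d L])
      fix e :: real and z assume ne: "T (outer x (y + e *\<^sub>R d)) \<noteq> 0" and h: "hip (y + e *\<^sub>R d) z = 0"
      from dl[OF c h ne] xR show "T (outer c z) \<in> line ?R" by (rule line_trans)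
    next
      fix z assume "hip y z = 0" then show "T (outer c z) \<in> line ?R" using dl[OF c _ L] by blast
    qed
    have "T (outer c z) \<in> line ?R" for c z
    proof -
      obtain c' where c': "c = hip x c *s x + c'" "hip x c' = 0" using decomp_along_unit[OF xy(1)] by blast
      have "T (outer c z) = mscale (hip x c) (T (outer x z)) + T (outer c' z)"
        by (subst c'(1)) (simp add: outer_add_left outer_smult_left mlinear_add[OF lin] mlinear_mscale[OF lin])
      then show ?thesis using xR cR[OF c'(2)] by (simp add: line_add line_mscale)
    qed
    from line_rank_le_oneI[OF lin this] not1 show False by simp
  qed
  have zero': "T (outer u w) = 0" if L: "T (outer x y) \<noteq> 0" and uw: "hip x u = 0" "hip y w = 0" for x y u w
  proof -
    obtain r s where rs: "r > 0" "s > 0" and un: "norm (r *\<^sub>R x) = 1" "norm (s *\<^sub>R y) = 1"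
      and L': "T (outer (r *\<^sub>R x) (s *\<^sub>R y)) \<noteq> 0" using normalize_nonzero[OF lin L] by blast
    show ?thesis by (rule zero[OF L' un]) (use uw in \<open>simp_all add: hip_simps\<close>)
  qed
  have "\<exists>x y. T (outer x y) \<noteq> 0"
    using line_rank_le_oneI[OF lin, of 0] not1 by (auto simp: line_zero)
  then obtain x y where L: "T (outer x y) \<noteq> 0" and xy: "norm x = 1" "norm y = 1"
    using normalize_nonzero[OF lin] by metis
  obtain d where d: "norm d = 1" "hip y d = 0" using exists_orthogonal_unit[OF n2] by blast
  have all0: "T (outer u z) = 0" if L: "T (outer x y) \<noteq> 0" and u: "hip x u = 0" for x u z
  proof -
    have "T (outer u z) \<in> line 0"
      by (rule spread_line[OF lin xy(2) d L]) (use zero' u L in \<open>auto simp: line_zero\<close>)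
    then show ?thesis by (simp add: line_zero)
  qed
  obtain u where u: "norm u = 1" "hip x u = 0" using exists_orthogonal_unit[OF m] by blast
  have ux: "hip u x = 0" using u(2) by (rule hip_commute_0)
  have "T (outer (x + u) y) \<noteq> 0" using L all0[OF L u(2), of y] by (simp add: outer_add_left mlinear_add[OF lin])
  from all0[OF this, of "x - u" y] have "T (outer (x - u) y) = 0" using u ux xy by (simp add: hip_simps hip_self)
  then show False using L all0[OF L u(2), of y] by (simp add: outer_diff_left mlinear_diff[OF lin])
qed

section \<open>Equality of norms by density\<close>

text \<open>Linear dependence is the vanishing of minors. Along a curve with polynomial coordinates these
are polynomials in the real parameter, hence nonzero near every point once they are nonzero at one.\<close>
definition polynomial_path :: "(real \<Rightarrow> 'a::{real_normed_field,euclidean_space}) \<Rightarrow> bool" where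
  "polynomial_path f \<longleftrightarrow> (\<exists>p. \<forall>t. f t = poly p (of_real t))"

lemma polynomial_path_const: "polynomial_path (\<lambda>t. c)"
  unfolding polynomial_path_def by (intro exI[of _ "[:c:]"]) simp
lemma polynomial_path_of_real: "polynomial_path (\<lambda>t. of_real t)"
  unfolding polynomial_path_def by (intro exI[of _ "[:0,1:]"]) simp
lemma polynomial_path_add: "polynomial_path f \<Longrightarrow> polynomial_path g \<Longrightarrow> polynomial_path (\<lambda>t. f t + g t)"
  unfolding polynomial_path_def by (metis poly_add)
lemma polynomial_path_diff: "polynomial_path f \<Longrightarrow> polynomial_path g \<Longrightarrow> polynomial_path (\<lambda>t. f t - g t)"
  unfolding polynomial_path_def by (metis poly_diff)
lemma polynomial_path_mult: "polynomial_path f \<Longrightarrow> polynomial_path g \<Longrightarrow> polynomial_path (\<lambda>t. f t * g t)"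
  unfolding polynomial_path_def by (metis poly_mult)
lemma polynomial_path_sum: "(\<And>i. i \<in> S \<Longrightarrow> polynomial_path (f i)) \<Longrightarrow> polynomial_path (\<lambda>t. \<Sum>i\<in>S. f i t)"
  by (induction S rule: infinite_finite_induct) (auto intro: polynomial_path_add polynomial_path_const)
lemma polynomial_path_conjugate: "polynomial_path f \<Longrightarrow> polynomial_path (\<lambda>t. conjugate (f t))"
proof -
  have "conjugate (poly p (of_real t)) = poly (map_poly conjugate p) (of_real t)" for p :: "'a poly" and t
    by (induction p) (auto simp: map_poly_pCons)
  then show "polynomial_path f \<Longrightarrow> ?thesis" unfolding polynomial_path_def by metis
qed

lemma polynomial_path_eventually_nonzero:
  assumes "polynomial_path f" "f a \<noteq> 0"
  shows "\<forall>\<^sub>F t in at b. f t \<noteq> 0"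
proof -
  obtain p where p: "\<And>t. f t = poly p (of_real t)" using assms(1) unfolding polynomial_path_def by blast
  have "p \<noteq> 0" using assms(2) p by auto
  then have "finite {z. poly p z = 0}" by (rule poly_roots_finite)
  then have "finite (of_real -` {z. poly p z = 0} :: real set)" by (rule finite_vimageI) (simp add: inj_of_real)
  then have fin: "finite {t. f t = 0}" by (simp add: p vimage_def)
  have "open (- ({t. f t = 0} - {b}))" using fin by (intro open_Compl finite_imp_closed) auto
  then show ?thesis unfolding eventually_at_topological by (intro exI[of _ "- ({t. f t = 0} - {b})"]) auto
qed

lemma dependent_pair_scale: "a \<noteq> 0 \<Longrightarrow> b \<noteq> 0 \<Longrightarrow> dependent_pair (mscale a A) (mscale b B) \<longleftrightarrow> dependent_pair A B"
proof -
  have d: "dependent_pair (mscale a A) (mscale b B) \<Longrightarrow> a \<noteq> 0 \<Longrightarrow> b \<noteq> 0 \<Longrightarrow> dependent_pair A B" for a b and A B :: "'a^'b^'c"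
    unfolding dependent_pair_def by (metis mat.scale_scale mult_eq_0_iff)
  show "a \<noteq> 0 \<Longrightarrow> b \<noteq> 0 \<Longrightarrow> ?thesis"
    using d[of a A b B] d[of "inverse a" "mscale a A" "inverse b" "mscale b B"] by auto
qed

lemma dependent_pair_zero_left: "dependent_pair 0 B" unfolding dependent_pair_def by (intro exI[of _ 1] exI[of _ 0]) simp
lemma dependent_pair_zero_right: "dependent_pair A 0" unfolding dependent_pair_def by (intro exI[of _ 0] exI[of _ 1]) simp

lemma dependent_pair_iff_minors: "dependent_pair A B \<longleftrightarrow> (\<forall>i j k l. A $ i $ j * B $ k $ l - A $ k $ l * B $ i $ j = 0)"
proof
  assume "dependent_pair A B"
  show "\<forall>i j k l. A $ i $ j * B $ k $ l - A $ k $ l * B $ i $ j = 0"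
  proof (cases "A = 0")
    case False
    from dependent_pair_line[OF \<open>dependent_pair A B\<close> this] obtain c where "B = mscale c A" by (auto simp: line_def)
    then show ?thesis by (simp add: mscale_def)
  qed simp
next
  assume m: "\<forall>i j k l. A $ i $ j * B $ k $ l - A $ k $ l * B $ i $ j = 0"
  show "dependent_pair A B"
  proof (cases "A = 0")
    case False
    then obtain i j where ij: "A $ i $ j \<noteq> 0" by (auto simp: vec_eq_iff)
    have "mscale (- B $ i $ j) A + mscale (A $ i $ j) B = 0"
      using m by (simp add: vec_eq_iff mscale_def algebra_simps)
    then show ?thesis unfolding dependent_pair_def using ij by blast
  qed (simp add: dependent_pair_zero_left)
qed

text \<open>The paths used below do not stay on the unit spheres, so the dichotomy is put in a form without
normalisation.\<close>
lemma dichotomy_homogeneous: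
  fixes T :: "'a::{real_normed_field,euclidean_space}^'n^'m \<Rightarrow> 'a^'n^'m"
  assumes lin: "mlinear T" and pres: "preserves_pairs parallel_pair T"
    and o: "hip x u = 0" "hip y v = 0" and ind: "\<not> dependent_pair (T (outer x y)) (T (outer u v))"
  shows "spectral_norm (T (outer x y)) * (norm u * norm v) = spectral_norm (T (outer u v)) * (norm x * norm y)"
proof -
  have nz: "x \<noteq> 0" "y \<noteq> 0" "u \<noteq> 0" "v \<noteq> 0" using ind
    by (auto simp: outer_zero_left outer_zero_right mlinear_zero[OF lin] dependent_pair_zero_left dependent_pair_zero_right)
  define nrmL where "nrmL z = (1 / norm z) *\<^sub>R z" for z :: "'a^'m"
  define nrmR where "nrmR z = (1 / norm z) *\<^sub>R z" for z :: "'a^'n"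
  have e: "T (outer (nrmL a) (nrmR b)) = mscale (of_real (1 / (norm a * norm b))) (T (outer a b))" for a b
    by (simp add: nrmL_def nrmR_def outer_scaleR_left outer_scaleR_right mlinear_mscale[OF lin] mult.commute)
  have "\<not> dependent_pair (T (outer (nrmL x) (nrmR y))) (T (outer (nrmL u) (nrmR v)))"
    unfolding e using nz ind by (subst dependent_pair_scale) auto
  moreover have "norm (nrmL x) = 1" "norm (nrmR y) = 1" "norm (nrmL u) = 1" "norm (nrmR v) = 1"
    "hip (nrmL x) (nrmL u) = 0" "hip (nrmR y) (nrmR v) = 0"
    using nz o by (simp_all add: nrmL_def nrmR_def hip_simps)
  ultimately have "spectral_norm (T (outer (nrmL x) (nrmR y))) = spectral_norm (T (outer (nrmL u) (nrmR v)))"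
    using orthogonal_images_dichotomy[OF lin pres] by blast
  then show ?thesis unfolding e spectral_norm_mscale using nz
    by (simp add: norm_divide norm_mult field_simps)
qed

lemma matrix_expand: "A = (\<Sum>a\<in>UNIV. \<Sum>b\<in>UNIV. mscale (A $ a $ b) (outer (axis a 1) (axis b 1)))"
  for A :: "'a::{real_normed_field,euclidean_space}^'n^'m"
proof -
  have "(\<Sum>a\<in>UNIV. \<Sum>b\<in>UNIV. mscale (A $ a $ b) (outer (axis a 1) (axis b 1)) $ i $ j) = A $ i $ j" for i j
  proof -
    have "(\<Sum>a\<in>UNIV. \<Sum>b\<in>UNIV. mscale (A $ a $ b) (outer (axis a 1) (axis b 1)) $ i $ j)
      = (\<Sum>a\<in>UNIV. if a = i then (\<Sum>b\<in>UNIV. if b = j then A $ i $ j else 0) else 0)"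
      by (intro sum.cong refl) (auto simp: mscale_def outer_def axis_def simp del: sum.delta sum.delta' intro!: sum.cong)
    then show ?thesis by simp
  qed
  then show ?thesis by (simp add: vec_eq_iff)
qed

lemma polynomial_path_linear_image:
  fixes T :: "'a::{real_normed_field,euclidean_space}^'n^'m \<Rightarrow> 'a^'q^'p"
  assumes lin: "mlinear T" and F: "\<And>i j. polynomial_path (\<lambda>t. F t $ i $ j)"
  shows "polynomial_path (\<lambda>t. T (F t) $ k $ l)"
proof -
  have "T (F t) $ k $ l = (\<Sum>a\<in>UNIV. \<Sum>b\<in>UNIV. F t $ a $ b * T (outer (axis a 1) (axis b 1)) $ k $ l)" for t
    by (subst matrix_expand) (simp add: mlinear_sum[OF lin] mlinear_mscale[OF lin], simp add: mscale_def)
  then show ?thesis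
    by (simp add: polynomial_path_sum polynomial_path_mult F polynomial_path_const)
qed

lemma polynomial_path_segment:
  "polynomial_path (\<lambda>t. ((1 - t) *\<^sub>R c + t *\<^sub>R d) $ a)"
proof -
  have "((1 - t) *\<^sub>R c + t *\<^sub>R d) $ a = (1 - of_real t) * c $ a + of_real t * d $ a" for t
    by (simp add: scaleR_smult left_diff_distrib)
  then show ?thesis
    by (simp add: polynomial_path_add polynomial_path_mult polynomial_path_diff polynomial_path_const polynomial_path_of_real)
qed

lemma polynomial_path_hip:
  assumes "\<And>a. polynomial_path (\<lambda>t. f t $ a)" "\<And>a. polynomial_path (\<lambda>t. g t $ a)"
  shows "polynomial_path (\<lambda>t. hip (f t) (g t))"
  unfolding hip_def by (intro polynomial_path_sum polynomial_path_mult polynomial_path_conjugate assms)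

text \<open>Join the given orthogonal quadruple to one with independent images. The images are independent
for almost all parameters near the start, where the dichotomy gives the equality of norms, and both
sides are continuous.\<close>
lemma orthogonal_outer_norms_eq:
  fixes T :: "'a::{real_normed_field,euclidean_space}^'n^'m \<Rightarrow> 'a^'n^'m"
  assumes lin: "mlinear T" and pres: "preserves_pairs parallel_pair T"
    and m: "CARD('m) \<ge> 2" and n: "CARD('n) \<ge> 3" and rk: "\<not> rank_le_one T"
    and un: "norm x = 1" "norm y = 1" "norm u = 1" "norm v = 1" and o: "hip x u = 0" "hip y v = 0"
  shows "spectral_norm (T (outer x y)) = spectral_norm (T (outer u v))"
proof -
  obtain x1 y1 u1 v1 where o1: "hip x1 u1 = 0" "hip y1 v1 = 0" and
    ind: "\<not> dependent_pair (T (outer x1 y1)) (T (outer u1 v1))"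
    using all_orthogonal_dependent_rank_le_one[OF lin m n] rk by blast
  have nz: "x1 \<noteq> 0" "y1 \<noteq> 0" using ind
    by (auto simp: outer_zero_left outer_zero_right mlinear_zero[OF lin] dependent_pair_zero_left)
  define X where "X t = (1 - t) *\<^sub>R x + t *\<^sub>R x1" for t
  define Y where "Y t = (1 - t) *\<^sub>R y + t *\<^sub>R y1" for t
  \<comment> \<open>Gram-Schmidt without division, which keeps the coordinates polynomial; at \<open>t = 0\<close> it returns
    the given vector.\<close>
  define U where "U t = hip (X t) (X t) *s ((1 - t) *\<^sub>R u + t *\<^sub>R u1) - hip (X t) ((1 - t) *\<^sub>R u + t *\<^sub>R u1) *s X t" for t
  define V where "V t = hip (Y t) (Y t) *s ((1 - t) *\<^sub>R v + t *\<^sub>R v1) - hip (Y t) ((1 - t) *\<^sub>R v + t *\<^sub>R v1) *s Y t" for t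
  have oUV: "hip (X t) (U t) = 0" "hip (Y t) (V t) = 0" for t
    unfolding U_def V_def hip_diff_right hip_smult_right by simp_all
  have at0: "X 0 = x" "Y 0 = y" "U 0 = u" "V 0 = v"
    using un o by (simp_all add: X_def Y_def U_def V_def hip_self)
  have at1: "X 1 = x1" "Y 1 = y1" "U 1 = hip x1 x1 *s u1" "V 1 = hip y1 y1 *s v1"
    using o1 by (simp_all add: X_def Y_def U_def V_def)
  have "\<not> dependent_pair (T (outer (X 1) (Y 1))) (T (outer (U 1) (V 1)))"
  proof -
    have "T (outer (U 1) (V 1)) = mscale (hip x1 x1 * hip y1 y1) (T (outer u1 v1))"
      by (simp add: at1 outer_smult_left outer_smult_right mlinear_mscale[OF lin] conjugate_hip)
    then show ?thesis using ind nz dependent_pair_scale[of 1 "hip x1 x1 * hip y1 y1" "T (outer x1 y1)" "T (outer u1 v1)"] by (simp add: at1 hip_self)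
  qed
  then obtain i j k l where
    ne: "T (outer (X 1) (Y 1)) $ i $ j * T (outer (U 1) (V 1)) $ k $ l
       - T (outer (X 1) (Y 1)) $ k $ l * T (outer (U 1) (V 1)) $ i $ j \<noteq> 0" (is "?minor 1 \<noteq> 0")
    unfolding dependent_pair_iff_minors by blast
  have prX: "polynomial_path (\<lambda>t. X t $ a)" for a unfolding X_def by (rule polynomial_path_segment)
  have prY: "polynomial_path (\<lambda>t. Y t $ a)" for a unfolding Y_def by (rule polynomial_path_segment)
  have prU: "polynomial_path (\<lambda>t. U t $ a)" for a
    unfolding U_def vector_minus_component vector_smult_component
    by (intro polynomial_path_diff polynomial_path_mult polynomial_path_hip prX polynomial_path_segment)
  have prV: "polynomial_path (\<lambda>t. V t $ a)" for a
    unfolding V_def vector_minus_component vector_smult_component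
    by (intro polynomial_path_diff polynomial_path_mult polynomial_path_hip prY polynomial_path_segment)
  have "polynomial_path ?minor"
    by (intro polynomial_path_diff polynomial_path_mult polynomial_path_linear_image[OF lin])
       (simp_all add: outer_def polynomial_path_mult polynomial_path_conjugate prX prY prU prV)
  from polynomial_path_eventually_nonzero[OF this ne]
  have ev: "\<forall>\<^sub>F t in at 0. ?minor t \<noteq> 0" .
  define f where "f t = spectral_norm (T (outer (X t) (Y t))) * (norm (U t) * norm (V t))" for t
  define g where "g t = spectral_norm (T (outer (U t) (V t))) * (norm (X t) * norm (Y t))" for t
  have "\<forall>\<^sub>F t in at 0. f t = g t"
    using ev unfolding f_def g_def
    by (rule eventually_mono) (intro dichotomy_homogeneous[OF lin pres oUV], auto simp: dependent_pair_iff_minors)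
  have cX: "continuous_on UNIV X" "continuous_on UNIV Y" unfolding X_def Y_def by (intro continuous_intros)+
  have cU: "continuous_on UNIV U" "continuous_on UNIV V"
    unfolding U_def V_def hip_def conjugate_def vector_scalar_mult_def
    by (intro continuous_intros cX)+
  have co: "continuous_on UNIV (\<lambda>t. spectral_norm (T (outer (a t) (b t))))"
    if "continuous_on UNIV a" "continuous_on UNIV b" for a :: "real \<Rightarrow> 'a^'m" and b :: "real \<Rightarrow> 'a^'n"
    by (rule continuous_on_compose2[OF spectral_norm_comp_continuous[OF lin, of UNIV]])
       (auto simp: outer_def conjugate_def intro!: continuous_intros that)
  have "continuous_on UNIV f" "continuous_on UNIV g"
    unfolding f_def g_def by (intro continuous_intros co cX cU)+
  then have "(f \<longlongrightarrow> f 0) (at 0)" "(g \<longlongrightarrow> g 0) (at 0)"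
    by (auto simp: continuous_on_def)
  then have "(f \<longlongrightarrow> g 0) (at 0)"
    using tendsto_cong[OF \<open>\<forall>\<^sub>F t in at 0. f t = g t\<close>] by blast
  with \<open>(f \<longlongrightarrow> f 0) (at 0)\<close> have "f 0 = g 0" by (intro tendsto_unique[of "at (0::real)"]) auto
  then show ?thesis by (simp add: f_def g_def at0 un)
qed

section \<open>Supporting functionals vanish off the rank-one direction\<close>

text \<open>A linear functional of norm \<open>h\<close> that attains its norm at a unit vector vanishes on the complement
of that vector; \<open>g\<close> stands for its value at a unit vector of the complement.\<close>
lemma riesz_vanish:
  fixes g :: "'a::{real_normed_field,euclidean_space}"
  assumes h: "h > 0" and b: "\<And>c. norm (of_real h + c * g) \<le> h * sqrt (1 + (norm c)\<^sup>2)"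
  shows "g = 0"
proof (rule ccontr)
  assume g: "g \<noteq> 0"
  obtain d where d: "norm d = 1" "d * g = of_real (norm g)" using unimodular_align by blast
  \<comment> \<open>Aligning the phases turns the bound into \<open>(h + s |g|)^2 \<le> h^2 (1 + s^2)\<close>, which fails for this \<open>s\<close>.\<close>
  define s where "s = norm g / h"
  have s: "s > 0" using g h by (simp add: s_def)
  have e: "of_real h + (of_real s * d) * g = of_real (h + s * norm g)"
    using d(2) by (simp add: mult.assoc)
  have "norm (of_real h + (of_real s * d) * g) \<le> h * sqrt (1 + s\<^sup>2)"
    using b[of "of_real s * d"] s d(1) by (simp only: norm_mult norm_of_real) simp
  then have "h + s * norm g \<le> h * sqrt (1 + s\<^sup>2)" unfolding e norm_of_real by linarith
  then have "(h + s * norm g)\<^sup>2 \<le> (h * sqrt (1 + s\<^sup>2))\<^sup>2" using h s by (intro power_mono) auto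
  then have "(h + s * norm g)\<^sup>2 \<le> h\<^sup>2 * (1 + s\<^sup>2)" by (simp add: power_mult_distrib)
  moreover have "norm g = s * h" using h by (simp add: s_def)
  ultimately have "(h + s * (s * h))\<^sup>2 \<le> h\<^sup>2 * (1 + s\<^sup>2)" by simp
  moreover have "(h + s * (s * h))\<^sup>2 = h\<^sup>2 * (1 + s\<^sup>2) + h\<^sup>2 * s\<^sup>2 + h\<^sup>2 * s\<^sup>2 * s\<^sup>2"
    by (simp add: power2_eq_square algebra_simps)
  moreover have "h\<^sup>2 * s\<^sup>2 > 0" "h\<^sup>2 * s\<^sup>2 * s\<^sup>2 > 0" using h s by simp_all
  ultimately show False by linarith
qed

text \<open>Squaring, the second-order terms \<open>|a|^2\<close> and \<open>|b|^2\<close> would be of first order in \<open>a - b\<close>, but if \<open>|b| \<le> |a|\<close> their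
difference has the favourable sign. What remains, for the phase \<open>c\<close> that turns \<open>c (b - a)\<close> into
\<open>- |b - a|\<close>, bounds \<open>|a - b|\<close> by the defects of \<open>cos d\<close> and \<open>(cos d)^2\<close> from one.\<close>
lemma affine_moduli_close_ordered:
  fixes a b :: "'a::{real_normed_field,euclidean_space}"
  assumes h: "h > 0" and ab: "norm b \<le> norm a" "norm a \<le> h"
    and le: "\<And>c. norm c = 1 \<Longrightarrow> norm (of_real (h * cos d) + c * a) \<le> norm (of_real h + c * b)"
  shows "norm (a - b) \<le> h * d\<^sup>2"
proof -
  obtain c0 where c0: "norm c0 = 1" "c0 * (b - a) = of_real (norm (b - a))" using unimodular_align by blast
  define c where "c = - c0"
  have c: "norm c = 1" "c * (b - a) = - of_real (norm (b - a))" using c0 by (simp_all add: c_def)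
  have "(norm (of_real (h * cos d) + c * a))\<^sup>2 \<le> (norm (of_real h + c * b))\<^sup>2" using le[OF c(1)] by (intro power_mono) auto
  then have 1: "h\<^sup>2 * (cos d)\<^sup>2 + (norm a)\<^sup>2 + 2 * (h * cos d * inner 1 (c * a)) \<le> h\<^sup>2 + (norm b)\<^sup>2 + 2 * (h * inner 1 (c * b))"
    using c(1) by (simp add: norm_add_sq norm_mult power_mult_distrib of_real_def del: of_real_mult)
  have "inner 1 (c * b) = inner 1 (c * a) - norm (b - a)"
    using arg_cong[OF c(2), of "inner 1"] by (simp add: right_diff_distrib inner_diff_right of_real_def)
  then have 2: "h * inner 1 (c * b) = h * inner 1 (c * a) - h * norm (b - a)" by (simp add: right_diff_distrib)
  have 3: "(norm b)\<^sup>2 \<le> (norm a)\<^sup>2" using ab by (intro power_mono) auto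
  have 4: "h\<^sup>2 * (cos d)\<^sup>2 = h\<^sup>2 - h\<^sup>2 * (sin d)\<^sup>2" by (simp add: cos_squared_eq right_diff_distrib)
  have "2 * h * ((1 - cos d) * inner 1 (c * a)) = 2 * (h * inner 1 (c * a)) - 2 * (h * cos d * inner 1 (c * a))"
    by (simp add: algebra_simps)
  with 1 2 3 4 have "2 * h * norm (b - a) \<le> h\<^sup>2 * (sin d)\<^sup>2 + 2 * h * ((1 - cos d) * inner 1 (c * a))"
    by linarith
  also have "\<dots> \<le> h\<^sup>2 * d\<^sup>2 + 2 * h * (d\<^sup>2 / 2 * h)"
  proof (intro add_mono mult_left_mono)
    have "\<bar>sin d\<bar> \<le> \<bar>d\<bar>" by (rule abs_sin_x_le_abs_x)
    then show "(sin d)\<^sup>2 \<le> d\<^sup>2" by (simp add: abs_le_square_iff)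
    have "\<bar>sin (d/2)\<bar> \<le> \<bar>d/2\<bar>" by (rule abs_sin_x_le_abs_x)
    then have "(sin (d/2))\<^sup>2 \<le> (d/2)\<^sup>2" by (rule abs_le_square_iff[THEN iffD1])
    moreover have "cos d = 1 - 2 * (sin (d/2))\<^sup>2" using cos_double_sin[of "d/2"] by simp
    ultimately have cos: "1 - cos d \<le> d\<^sup>2 / 2" by (simp add: power_divide)
    have "inner 1 (c * a) \<le> h"
      using norm_cauchy_schwarz[of 1 "c * a"] c(1) ab by (simp add: norm_mult)
    then have "(1 - cos d) * inner 1 (c * a) \<le> (1 - cos d) * h" by (intro mult_left_mono) auto
    also have "\<dots> \<le> d\<^sup>2 / 2 * h" using cos h by (intro mult_right_mono) auto
    finally show "(1 - cos d) * inner 1 (c * a) \<le> d\<^sup>2 / 2 * h" .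
  qed (use h in auto)
  also have "\<dots> = 2 * h * (h * d\<^sup>2)" by (simp add: power2_eq_square)
  finally show ?thesis using h by (simp add: norm_minus_commute)
qed

lemma affine_moduli_close:
  fixes a b :: "'a::{real_normed_field,euclidean_space}"
  assumes h: "h > 0" and ab: "norm a \<le> h" "norm b \<le> h"
    and le: "\<And>c. norm c = 1 \<Longrightarrow> norm (of_real (h * cos d) + c * a) \<le> norm (of_real h + c * b)"
      "\<And>c. norm c = 1 \<Longrightarrow> norm (of_real (h * cos d) + c * b) \<le> norm (of_real h + c * a)"
  shows "norm (a - b) \<le> h * d\<^sup>2"
  using affine_moduli_close_ordered[OF h _ ab(1) le(1)] affine_moduli_close_ordered[OF h _ ab(2) le(2)]
  by (cases "norm b \<le> norm a") (auto simp: norm_minus_commute)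

lemma quadratic_variation_constant:
  fixes f :: "real \<Rightarrow> 'a::real_normed_vector"
  assumes "\<And>s t. norm (f s - f t) \<le> h * (s - t)\<^sup>2"
  shows "f s = f t"
proof -
  have d: "(f has_derivative (\<lambda>_. 0)) (at x within UNIV)" for x
    unfolding has_derivative_iff_norm
  proof (intro conjI bounded_linear_zero)
    have "((\<lambda>y. h * \<bar>y - x\<bar>) \<longlongrightarrow> h * \<bar>x - x\<bar>) (at x)" by (intro tendsto_intros)
    then have lim: "((\<lambda>y. h * \<bar>y - x\<bar>) \<longlongrightarrow> 0) (at x)" by simp
    show "((\<lambda>y. norm (f y - f x - 0) / norm (y - x)) \<longlongrightarrow> 0) (at x within UNIV)"
    proof (rule tendsto_sandwich[OF _ _ tendsto_const lim])
      show "\<forall>\<^sub>F y in at x. norm (f y - f x - 0) / norm (y - x) \<le> h * \<bar>y - x\<bar>"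
      proof (rule eventually_at_topological[THEN iffD2], intro exI[of _ UNIV] conjI ballI impI)
        fix y assume "y \<noteq> x"
        then show "norm (f y - f x - 0) / norm (y - x) \<le> h * \<bar>y - x\<bar>"
          using assms[of y x] by (simp add: pos_divide_le_eq mult.assoc power2_eq_square flip: abs_mult)
      qed auto
    qed auto
  qed
  have "\<exists>c. \<forall>x\<in>UNIV. f x = c" by (rule has_derivative_zero_constant) (use d in auto)
  then obtain c where "\<forall>x. f x = c" by blast
  then show ?thesis by simp
qed

text \<open>Rotate \<open>w\<close> in the complement of \<open>y\<close> to \<open>\<omega> t\<close> and let \<open>f t\<close> be the value at \<open>outer x y\<close> of the
functional that belongs to \<open>\<omega> t\<close>. By \<open>riesz_vanish\<close> the functional for \<open>\<omega> s\<close> takes the value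
\<open>h cos (t - s)\<close> at \<open>outer u (\<omega> t)\<close>, and it is dominated by the norm, which on the face of \<open>outer u (\<omega> t)\<close> is
given by the functional for \<open>\<omega> t\<close>. So \<open>f\<close> varies quadratically and is constant, although the faces of
\<open>outer u w\<close> and \<open>outer u (- w)\<close> show that \<open>|h + c f|\<close> and \<open>|h - c f|\<close> agree for all \<open>|c| = 1\<close>. Hence \<open>f = 0\<close>.\<close>
lemma supporting_functional_vanishes_on_block:
  fixes T :: "'a::{real_normed_field,euclidean_space}^'n^'m \<Rightarrow> 'a^'n^'m"
  assumes lin: "mlinear T" and n: "CARD('n) \<ge> 3" and h: "h > 0"
    and hu: "\<And>z. norm z = 1 \<Longrightarrow> spectral_norm (T (outer u z)) = h"
    and hx: "\<And>z. norm z = 1 \<Longrightarrow> spectral_norm (T (outer x z)) = h"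
    and sup: "\<And>z. norm z = 1 \<Longrightarrow> supports T u z (P z) (Q z)"
    and un: "norm y = 1" "norm w = 1" and o: "hip u x = 0" "hip w y = 0" and nx: "norm x = 1"
  shows "hip (P w) (T (outer x y) *v Q w) = 0"
proof -
  define G where "G z A = hip (P z) (T A *v Q z)" for z A
  have G_add: "G z (A + B) = G z A + G z B" and G_ms: "G z (mscale c A) = c * G z A" for z A B c
    by (simp_all add: G_def mlinear_add[OF lin] mlinear_mscale[OF lin] matrix_vector_mult_add_rdistrib hip_simps)
  have G_le: "norm (G z A) \<le> spectral_norm (T A)" if "norm z = 1" for z A
    using sup[OF that] unfolding supports_def G_def by (blast intro: hip_le_spectral_norm)
  have G_u: "G z (outer u z) = of_real h" if "norm z = 1" for z
    using sup[OF that] hu[OF that] unfolding supports_def G_def by simp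
  have G_block: "norm (G z (outer u z + C)) = spectral_norm (T (outer u z + C))"
    if "norm z = 1" "C \<in> orth_block u z" "spectral_norm C \<le> 1" for z C
    using sup[OF that(1)] that(2,3) unfolding supports_def G_def by blast
  have G_orth: "G z (outer u z') = 0" if z: "norm z = 1" "norm z' = 1" "hip z z' = 0" for z z'
  proof (rule riesz_vanish[OF h])
    fix c
    let ?w = "z + conjugate c *s z'"
    have nw: "norm ?w = sqrt (1 + (norm c)\<^sup>2)"
      using norm_add_orthogonal[of z "conjugate c *s z'"] z by (simp add: hip_simps norm_smult real_sqrt_unique)
    then have "?w \<noteq> 0" by (smt (verit) norm_zero real_sqrt_gt_0_iff zero_le_power2)
    have "spectral_norm (T (outer u ?w)) = h * norm ?w"
    proof -
      have "?w = norm ?w *\<^sub>R ((1 / norm ?w) *\<^sub>R ?w)" using \<open>?w \<noteq> 0\<close> by simp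
      then have "T (outer u ?w) = mscale (of_real (norm ?w)) (T (outer u ((1 / norm ?w) *\<^sub>R ?w)))"
        by (metis outer_scaleR_right mlinear_mscale[OF lin])
      moreover have "spectral_norm (T (outer u ((1 / norm ?w) *\<^sub>R ?w))) = h" using \<open>?w \<noteq> 0\<close> by (intro hu) simp
      ultimately show ?thesis by (simp add: spectral_norm_mscale)
    qed
    moreover have "G z (outer u ?w) = of_real h + c * G z (outer u z')"
      by (simp add: outer_add_right outer_smult_right G_add G_ms G_u[OF z(1)])
    ultimately show "norm (of_real h + c * G z (outer u z')) \<le> h * sqrt (1 + (norm c)\<^sup>2)"
      using G_le[OF z(1), of "outer u ?w"] nw by simp
  qed
  obtain v where v: "norm v = 1" "hip w v = 0" "hip y v = 0" using exists_orthogonal_unit2[OF n] by blast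
  have vw: "hip v w = 0" "hip v y = 0" using v by (simp_all add: hip_commute_0)
  define \<omega> where "\<omega> t = cos t *\<^sub>R w + sin t *\<^sub>R v" for t
  define \<omega>' where "\<omega>' t = - sin t *\<^sub>R w + cos t *\<^sub>R v" for t
  have hipw: "hip (\<omega> s) (\<omega> t) = of_real (cos s * cos t + sin s * sin t)"
     "hip (\<omega>' s) (\<omega>' t) = of_real (cos s * cos t + sin s * sin t)"
     "hip (\<omega> s) (\<omega>' t) = of_real (sin s * cos t - cos s * sin t)" for s t
    using un v vw by (simp_all add: \<omega>_def \<omega>'_def hip_simps hip_self)
  have nu: "norm z = 1" if "hip z z = 1" for z :: "'a^'n"
    using that hip_self[of z] by (metis norm_ge_zero of_real_eq_1_iff power2_eq_1_iff le_minus_one_simps(3))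
  have n\<omega>: "norm (\<omega> t) = 1" "norm (\<omega>' t) = 1" for t
    by (auto intro!: nu simp: hipw simp flip: power2_eq_square)
  have o\<omega>: "hip (\<omega> t) y = 0" for t using o vw by (simp add: \<omega>_def hip_simps)
  have rot: "\<omega> t = cos (t - s) *\<^sub>R \<omega> s + sin (t - s) *\<^sub>R \<omega>' s" for s t
  proof -
    have "cos t = cos (t - s) * cos s - sin (t - s) * sin s" "sin t = cos (t - s) * sin s + sin (t - s) * cos s"
      using cos_add[of "t - s" s] sin_add[of "t - s" s] by simp_all
    then show ?thesis
      unfolding \<omega>_def \<omega>'_def by (simp add: scaleR_add_right scaleR_add_left scaleR_diff_left scaleR_diff_right)
  qed
  define f where "f t = G (\<omega> t) (outer x y)" for t
  have f_le: "norm (f t) \<le> h" for t using G_le[OF n\<omega>(1), of t "outer x y"] hx[OF un(1)] by (simp add: f_def)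
  have block: "mscale c (outer x y) \<in> orth_block u (\<omega> t)" for c t
    by (intro orth_block_mscale outer_orth_block o o\<omega>)
  have val: "spectral_norm (T (outer u (\<omega> t) + mscale c (outer x y))) = norm (of_real h + c * f t)" if "norm c = 1" for c t
    using G_block[OF n\<omega>(1) block, of c] that by (simp add: G_add G_ms G_u n\<omega> spectral_norm_mscale nx un f_def)
  have key: "norm (of_real (h * cos (t - s)) + c * f s) \<le> norm (of_real h + c * f t)" if c: "norm c = 1" for c s t
  proof -
    have "outer u (\<omega> t) = mscale (of_real (cos (t - s))) (outer u (\<omega> s)) + mscale (of_real (sin (t - s))) (outer u (\<omega>' s))"
      unfolding rot[of t s] outer_add_right outer_scaleR_right ..
    then have "G (\<omega> s) (outer u (\<omega> t)) = of_real (h * cos (t - s))"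
      by (simp add: G_add G_ms G_u n\<omega> G_orth hipw)
    then show ?thesis using G_le[OF n\<omega>(1), of s "outer u (\<omega> t) + mscale c (outer x y)"] val[OF c, of t]
      by (simp add: G_add G_ms f_def)
  qed
  have "norm (f s - f t) \<le> h * (s - t)\<^sup>2" for s t
  proof (rule affine_moduli_close[OF h f_le f_le])
    show "norm (of_real (h * cos (s - t)) + c * f s) \<le> norm (of_real h + c * f t)" if "norm c = 1" for c
      using key[OF that, of t s] by (metis cos_minus minus_diff_eq)
    show "norm (of_real (h * cos (s - t)) + c * f t) \<le> norm (of_real h + c * f s)" if "norm c = 1" for c
      using key[OF that, of s t] .
  qed
  then have fpi: "f pi = f 0" by (rule quadratic_variation_constant)
  have "norm (of_real h + c * f 0) = norm (of_real h - c * f 0)" if c: "norm c = 1" for c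
  proof -
    have w0: "\<omega> 0 = w" "\<omega> pi = - w" by (simp_all add: \<omega>_def)
    have "T (outer u (\<omega> pi) + mscale c (outer x y)) = - T (outer u (\<omega> 0) + mscale (- c) (outer x y))"
      by (simp add: w0 outer_minus_right mlinear_minus[OF lin, symmetric] mat.scale_minus_left)
    then have "norm (of_real h + c * f pi) = norm (of_real h + (- c) * f 0)"
      using val[OF c, of pi] val[of "- c" 0] c by simp
    then show ?thesis by (simp add: fpi)
  qed
  moreover obtain c where c: "norm c = 1" "c * f 0 = of_real (norm (f 0))" using unimodular_align by blast
  ultimately have "norm (of_real h + of_real (norm (f 0)) :: 'a) = norm (of_real h - of_real (norm (f 0)) :: 'a)" by metis
  then have "\<bar>h + norm (f 0)\<bar> = \<bar>h - norm (f 0)\<bar>"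
    by (metis norm_of_real of_real_add of_real_diff)
  then have "f 0 = 0" using h by (simp add: abs_if split: if_splits)
  then show ?thesis by (simp add: f_def G_def \<omega>_def)
qed

section \<open>Parallel preservers are scaled isometries\<close>

text \<open>Every matrix of norm at most one that maps a unit vector to a unit vector lies in the corresponding
face.\<close>
lemma norming_decomposition:
  fixes B :: "'a::{real_normed_field,euclidean_space}^'n^'m"
  assumes B: "spectral_norm B \<le> 1" and y: "norm y = 1" and x: "norm x = 1" and By: "B *v y = x"
  shows "B - outer x y \<in> orth_block x y" "spectral_norm (B - outer x y) \<le> 1" "adj B *v x = y"
proof -
  let ?d = "adj B *v x"
  have nd: "norm ?d \<le> 1" using spectral_norm_bound[of "adj B" x] B x by simp
  have "hip y ?d = 1" using hip_adj[of B y x] x By hip_self[of x] by simp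
  then have "inner y ?d = 1" by (simp add: inner_hip)
  moreover have "inner y y = 1" using y by (simp add: dot_square_norm)
  ultimately have "(norm (?d - y))\<^sup>2 = (norm ?d)\<^sup>2 - 1"
    unfolding power2_norm_eq_inner by (simp add: inner_diff_left inner_diff_right inner_commute)
  also have "\<dots> \<le> 0" using nd by (simp add: power_le_one)
  finally show d: "?d = y" by simp
  show "B - outer x y \<in> orth_block x y"
    using By d x y by (simp add: orth_block_def matrix_vector_mult_diff_rdistrib adj_diff hip_self)
  show "spectral_norm (B - outer x y) \<le> 1"
  proof (rule spectral_norm_le)
    fix z
    obtain z' where z': "z = hip y z *s y + z'" "(norm z)\<^sup>2 = (norm (hip y z))\<^sup>2 + (norm z')\<^sup>2"
      using decomp_along_unit[OF y] by blast
    have "(B - outer x y) *v z = B *v z'"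
    proof -
      have "B *v z = hip y z *s x + B *v z'"
        by (subst z'(1)) (simp add: matrix_vector_right_distrib mult_vec_smult By)
      then show ?thesis by (simp add: matrix_vector_mult_diff_rdistrib)
    qed
    also have "norm (B *v z') \<le> spectral_norm B * norm z'" by (rule spectral_norm_bound)
    also have "\<dots> \<le> norm z'" using mult_right_mono[OF B, of "norm z'"] by simp
    also have "\<dots> \<le> norm z" by (rule power2_le_imp_le) (simp_all add: z'(2))
    finally show "norm ((B - outer x y) *v z) \<le> 1 * norm z" by simp
  qed
qed

lemma mult_vec_sum: "A *v sum f S = (\<Sum>i\<in>S. A *v f i)" for A :: "'a::field^'n^'m"
  by (induction S rule: infinite_finite_induct) (auto simp: matrix_vector_right_distrib)

text \<open>Project the second factors of the column expansion onto the complement of \<open>y\<close>; the correction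
terms add up to \<open>outer (C *v y) y = 0\<close>.\<close>
lemma orth_block_sum_outer:
  fixes C :: "'a::{real_normed_field,euclidean_space}^'b^'c"
  assumes C: "C \<in> orth_block x y" and y: "norm y = 1"
  shows "C = (\<Sum>j\<in>UNIV. outer (C *v axis j 1) (axis j 1 - hip y (axis j 1) *s y))"
proof -
  have "(\<Sum>j\<in>UNIV. outer (C *v axis j 1) (axis j 1 - hip y (axis j 1) *s y))
     = (\<Sum>j\<in>UNIV. outer (C *v axis j 1) (axis j 1)) - (\<Sum>j\<in>UNIV. outer (conjugate (hip y (axis j 1)) *s (C *v axis j 1)) y)"
    by (simp add: outer_diff_right outer_smult_right outer_smult_left sum_subtractf)
  also have "(\<Sum>j\<in>UNIV. outer (conjugate (hip y (axis j 1)) *s (C *v axis j 1)) y) = outer (C *v y) y"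
  proof -
    have ax: "conjugate (hip y (axis j 1)) = y $ j" for j
    proof -
      have "hip (axis j 1) y = (\<Sum>i\<in>UNIV. if i = j then y $ i else 0)"
        unfolding hip_def by (intro sum.cong) (auto simp: axis_def)
      then show ?thesis by (simp add: conjugate_hip)
    qed
    have os: "(\<Sum>j\<in>S. outer (f j) y) = outer (\<Sum>j\<in>S. f j) y" for S and f :: "'b \<Rightarrow> 'a^'c"
      by (induction S rule: infinite_finite_induct) (auto simp: outer_add_left outer_zero_left)
    have "y = (\<Sum>j\<in>UNIV. y $ j *s axis j 1)" by (simp add: basis_expansion)
    then have "C *v y = (\<Sum>j\<in>UNIV. y $ j *s (C *v axis j 1))"
      using mult_vec_sum[of C "\<lambda>j. y $ j *s axis j 1" UNIV] by (simp add: mult_vec_smult)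
    then show ?thesis by (simp add: ax os)
  qed
  also have "outer (C *v y) y = 0" using C by (simp add: orth_block_def outer_zero_left)
  finally show ?thesis using matrix_sum_outer[of C] by simp
qed

text \<open>On the face of \<open>outer x y\<close> the norm of the image is constant, and with at least three columns the
constant \<open>H x\<close> depends on \<open>x\<close> only.\<close>
proposition parallel_preserver_scaled_isometry_wide:
  fixes T :: "'a::{real_normed_field,euclidean_space}^'n^'m \<Rightarrow> 'a^'n^'m"
  assumes lin: "mlinear T" and pres: "preserves_pairs parallel_pair T"
    and m: "CARD('m) \<ge> 2" and n: "CARD('n) \<ge> 3" and rk: "\<not> rank_le_one T"
  shows "\<exists>\<gamma>>0. \<forall>A. spectral_norm (T A) = \<gamma> * spectral_norm A"
proof -
  let ?N = "\<lambda>A. spectral_norm (T A)"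
  note E = orthogonal_outer_norms_eq[OF lin pres m n rk]
  obtain y0 :: "'a^'n" where y0: "norm y0 = 1" using exists_unit by blast
  define H where "H x = ?N (outer x y0)" for x
  have H: "?N (outer x y) = H x" if xy: "norm x = 1" "norm y = 1" for x y
  proof -
    obtain u where u: "norm u = 1" "hip x u = 0" using exists_orthogonal_unit[OF m] by blast
    obtain v where v: "norm v = 1" "hip y v = 0" "hip y0 v = 0" using exists_orthogonal_unit2[OF n] by blast
    show ?thesis unfolding H_def using E[OF xy u(1) v(1) u(2) v(2)] E[OF xy(1) y0 u(1) v(1) u(2) v(3)] by simp
  qed
  have n2: "CARD('n) \<ge> 2" using n by simp
  have Ho: "H u = H x" if "norm x = 1" "norm u = 1" "hip x u = 0" for x u
  proof -
    obtain v where v: "norm v = 1" "hip y0 v = 0" using exists_orthogonal_unit[OF n2] by blast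
    show ?thesis using E[OF that(1) y0 that(2) v(1) that(3) v(2)] H[OF that(1) y0] H[OF that(2) v(1)] by simp
  qed
  have pos: "H x > 0" if x: "norm x = 1" for x
  proof (rule ccontr)
    assume "\<not> H x > 0"
    moreover have "H x \<ge> 0" by (simp add: H_def)
    ultimately have "H x = 0" by simp
    have z: "T (outer u z) = 0" if u: "norm u = 1" "H u = 0" for u z
    proof (rule ccontr)
      assume "T (outer u z) \<noteq> 0"
      from normalize_nonzero[OF lin this] obtain r s where "r > 0" "norm (r *\<^sub>R u) = 1" "norm (s *\<^sub>R z) = 1"
        "T (outer (r *\<^sub>R u) (s *\<^sub>R z)) \<noteq> 0" by blast
      moreover from this u have "r = 1" by simp
      ultimately show False using H[of u "s *\<^sub>R z"] u by simp
    qed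
    have "T (outer u z) \<in> line 0" for u z
    proof -
      obtain u' where u': "u = hip x u *s x + u'" "hip x u' = 0" using decomp_along_unit[OF x] by blast
      have "T (outer u' z) = 0"
      proof (cases "u' = 0")
        case False
        then have "H ((1 / norm u') *\<^sub>R u') = 0" using Ho[of x "(1 / norm u') *\<^sub>R u'"] x u'(2) \<open>H x = 0\<close> by (simp add: hip_simps)
        then have "T (outer ((1 / norm u') *\<^sub>R u') z) = 0" using False by (intro z) auto
        then show ?thesis using False by (simp add: outer_scaleR_left mlinear_mscale[OF lin])
      qed (simp add: outer_zero_left mlinear_zero[OF lin])
      then have "T (outer u z) = 0" using z[OF x \<open>H x = 0\<close>]
        by (subst u'(1)) (simp add: outer_add_left outer_smult_left mlinear_add[OF lin] mlinear_mscale[OF lin])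
      then show ?thesis by simp
    qed
    from line_rank_le_oneI[OF lin this] rk show False by simp
  qed
  have face: "?N B = H x" if B: "spectral_norm B \<le> 1" "norm y = 1" "norm x = 1" "B *v y = x" for B x y
  proof -
    have "\<exists>p q. supports T x z p q" if "norm z = 1" for z
      using supporting_functional[OF lin pres \<open>norm x = 1\<close> that] .
    then obtain P Q where PQ: "\<And>z. norm z = 1 \<Longrightarrow> supports T x z (P z) (Q z)" by metis
    have van1: "hip (P y) (T (outer a b) *v Q y) = 0" if ab: "norm a = 1" "norm b = 1" "hip x a = 0" "hip y b = 0" for a b
      by (rule supporting_functional_vanishes_on_block[OF lin n pos[OF B(3)] _ _ PQ ab(2) B(2) ab(3,4,1)])
         (use H B(3) ab Ho in auto)
    have van: "hip (P y) (T (outer a b) *v Q y) = 0" if ab: "hip x a = 0" "hip y b = 0" for a b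
    proof (rule ccontr)
      assume "hip (P y) (T (outer a b) *v Q y) \<noteq> 0"
      then have "T (outer a b) \<noteq> 0" by auto
      from normalize_nonzero[OF lin this] obtain r s where rs: "r > 0" "s > 0" "norm (r *\<^sub>R a) = 1" "norm (s *\<^sub>R b) = 1" by metis
      have "hip (P y) (T (outer (r *\<^sub>R a) (s *\<^sub>R b)) *v Q y) = 0" using rs ab by (intro van1) (auto simp: hip_simps)
      then show False using rs \<open>hip (P y) (T (outer a b) *v Q y) \<noteq> 0\<close>
        by (simp add: outer_scaleR_left outer_scaleR_right mlinear_mscale[OF lin] hip_simps)
    qed
    define C where "C = B - outer x y"
    have C: "C \<in> orth_block x y" "spectral_norm C \<le> 1" unfolding C_def using norming_decomposition[OF B] by auto
    have BC: "B = outer x y + C" by (simp add: C_def)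
    have hs: "hip p (sum f S *v q) = (\<Sum>i\<in>S. hip p (f i *v q))" for p q S and f :: "'n \<Rightarrow> 'a^'n^'m"
      by (induction S rule: infinite_finite_induct) (auto simp: matrix_vector_mult_add_rdistrib hip_simps)
    have "hip (P y) (T C *v Q y) = 0"
      by (subst orth_block_sum_outer[OF C(1) B(2)])
         (simp add: mlinear_sum[OF lin] hs van hip_orth_block[OF C(1)] hip_diff_right hip_smult_right hip_self B(2))
    then have "norm (of_real (?N (outer x y)) :: 'a) = ?N B"
      using PQ[OF B(2)] C unfolding supports_def BC
      by (auto simp: mlinear_add[OF lin] matrix_vector_mult_add_rdistrib hip_simps)
    then show ?thesis using H[OF B(3,2)] pos[OF B(3)] by simp
  qed
  obtain x0 :: "'a^'m" where x0: "norm x0 = 1" using exists_unit by blast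
  have const: "H x = H x0" if x: "norm x = 1" for x
  proof -
    obtain x' where x': "x = hip x0 x *s x0 + x'" "hip x0 x' = 0" using decomp_along_unit[OF x0] by blast
    obtain u where u: "norm u = 1" "hip x0 u = 0" "x' = hip u x' *s u"
    proof (cases "x' = 0")
      case True then show ?thesis using exists_orthogonal_unit[OF m, of x0] that by auto
    next
      case False
      have "hip ((1 / norm x') *\<^sub>R x') x' *s ((1 / norm x') *\<^sub>R x') = x'"
        using False by (simp add: hip_simps hip_self scaleR_smult power2_eq_square field_simps flip: of_real_mult of_real_divide)
      then show ?thesis using that[of "(1 / norm x') *\<^sub>R x'"] False x'(2) by (simp add: hip_simps)
    qed
    have ux0: "hip u x0 = 0" using u(2) by (rule hip_commute_0)
    have "hip u x = hip u x'" by (subst x'(1)) (simp add: hip_simps ux0)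
    then have xx: "x = hip x0 x *s x0 + hip u x *s u" using x'(1) u(3) by simp
    obtain v where v: "norm v = 1" "hip y0 v = 0" using exists_orthogonal_unit[OF n2] by blast
    have vy0: "hip v y0 = 0" using v(2) by (rule hip_commute_0)
    \<comment> \<open>This partial isometry attains its norm on the whole plane spanned by \<open>x0\<close> and \<open>u\<close>, so it lies in
      a face of \<open>x0\<close> and in a face of \<open>x\<close>.\<close>
    define B where "B = outer x0 y0 + outer u v"
    have B1: "spectral_norm B = 1" "B *v y0 = x0" unfolding B_def
      using outer_plus_block[OF x0 y0 outer_orth_block[OF u(2) v(2)]] u v by auto
    define y where "y = hip x0 x *s y0 + hip u x *s v"
    have By: "B *v y = x"
      unfolding B_def y_def using xx v vy0 y0
      by (simp add: matrix_vector_mult_add_rdistrib hip_simps hip_self)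
    have "(norm y)\<^sup>2 = (norm (hip x0 x))\<^sup>2 + (norm (hip u x))\<^sup>2"
      unfolding y_def using norm_add_orthogonal[of "hip x0 x *s y0" "hip u x *s v"] v y0
      by (simp add: hip_simps norm_smult)
    also have "\<dots> = (norm x)\<^sup>2"
      using norm_add_orthogonal[of "hip x0 x *s x0" "hip u x *s u"] u x0 xx
      by (simp add: hip_simps norm_smult)
    finally have "norm y = 1" using x power2_eq_iff_nonneg[of "norm y" 1] by simp
    from face[OF _ this x By] face[OF _ y0 x0 B1(2)] B1(1) show ?thesis by simp
  qed
  have "?N A = H x0 * spectral_norm A" for A
  proof (cases "A = 0")
    case False
    let ?s = "spectral_norm A"
    have s: "?s > 0" using False spectral_norm_nonneg[of A] spectral_norm_0_iff[of A] by linarith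
    define B where "B = (1 / ?s) *\<^sub>R A"
    have A: "A = ?s *\<^sub>R B" using s by (simp add: B_def)
    have B: "spectral_norm B = 1" using s False by (simp add: B_def scaleR_mscale spectral_norm_mscale norm_divide)
    obtain y where y: "norm y = 1" "norm (B *v y) = 1" using spectral_norm_attained[of B] B by auto
    have "?N B = H x0" using face[OF _ y(1) y(2) refl] B const[OF y(2)] by simp
    moreover have "?N A = ?s * ?N B"
      by (subst A) (simp add: scaleR_mscale mlinear_mscale[OF lin] spectral_norm_mscale)
    ultimately show ?thesis by simp
  qed (simp add: mlinear_zero[OF lin] spectral_norm_0_iff[THEN iffD2])
  with pos[OF x0] show ?thesis by blast
qed

section \<open>Isometries map rank-one matrices to rank-one matrices\<close>
lemma parallelogram_vanish:
  fixes a b :: "'b::real_inner"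
  assumes "norm (a + b) \<le> 1" "norm (a - b) \<le> 1" "norm a = 1" shows "b = 0"
proof -
  have "(norm (a + b))\<^sup>2 + (norm (a - b))\<^sup>2 = 2 * (norm a)\<^sup>2 + 2 * (norm b)\<^sup>2"
    unfolding power2_norm_eq_inner by (simp add: inner_add_left inner_add_right inner_diff_left inner_diff_right inner_commute)
  moreover have "(norm (a + b))\<^sup>2 \<le> 1" "(norm (a - b))\<^sup>2 \<le> 1" using assms by (simp_all add: power_le_one)
  ultimately have "2 * (norm b)\<^sup>2 \<le> 0" unfolding assms(3) power_one by linarith
  then show ?thesis by simp
qed

text \<open>The unit vector \<open>x\<close> is the midpoint of \<open>x + B y\<close> and \<open>x - B y\<close> in the unit ball of a Euclidean norm,
so \<open>B y = 0\<close>; the same holds for the adjoint.\<close>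
lemma block_of_norm_one_segment:
  fixes E B :: "'a::{real_normed_field,euclidean_space}^'n^'m"
  assumes "spectral_norm E \<le> 1" "norm y = 1" "norm x = 1" "E *v y = x"
    "spectral_norm (E + B) \<le> 1" "spectral_norm (E - B) \<le> 1"
  shows "B \<in> orth_block x y"
proof -
  have ad: "adj E *v x = y" by (rule norming_decomposition(3)[OF assms(1-4)])
  have "B *v y = 0"
  proof (rule parallelogram_vanish)
    show "norm (x + B *v y) \<le> 1" "norm (x - B *v y) \<le> 1"
      using spectral_norm_bound[of "E + B" y] spectral_norm_bound[of "E - B" y] assms
      by (simp_all add: matrix_vector_mult_add_rdistrib matrix_vector_mult_diff_rdistrib)
  qed (rule assms)
  moreover have "adj B *v x = 0"
  proof (rule parallelogram_vanish)
    show "norm (y + adj B *v x) \<le> 1" "norm (y - adj B *v x) \<le> 1"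
      using spectral_norm_bound[of "adj (E + B)" x] spectral_norm_bound[of "adj (E - B)" x] assms ad
      unfolding spectral_norm_adj
      by (simp_all add: adj_add adj_diff matrix_vector_mult_add_rdistrib matrix_vector_mult_diff_rdistrib)
  qed (rule assms)
  ultimately show ?thesis by (simp add: orth_block_def)
qed

lemma vanish_of_units:
  fixes M :: "'a::{real_normed_field,euclidean_space}^'p^'q"
  assumes "\<And>d. norm d = 1 \<Longrightarrow> hip r d = 0 \<Longrightarrow> M *v d = 0" "hip r d = 0"
  shows "M *v d = 0"
proof (cases "d = 0")
  case False
  then have "M *v ((1 / norm d) *\<^sub>R d) = 0" using assms(2) by (intro assms(1)) (auto simp: hip_simps)
  then show ?thesis using False by (simp add: mult_vec_scaleR)
qed simp

lemma isometry_surj: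
  fixes T :: "'a::{real_normed_field,euclidean_space}^'n^'m \<Rightarrow> 'a^'n^'m"
  assumes lin: "mlinear T" and iso: "\<And>A. spectral_norm (T A) = spectral_norm A"
  shows "surj T"
proof (rule linear_injective_imp_surjective)
  show l: "linear T" using mlinear_bounded_linear[OF lin] by (rule bounded_linear.linear)
  show "inj T"
  proof (rule injI)
    fix A B assume "T A = T B"
    then have "spectral_norm (T (A - B)) = 0" by (simp add: mlinear_diff[OF lin])
    then show "A = B" by (simp add: iso)
  qed
qed simp

text \<open>Let the image \<open>E\<close> of \<open>outer x y\<close> attain its norm at \<open>y'\<close> with value \<open>x'\<close>, and let \<open>A\<close> be the preimage of
\<open>outer x' y'\<close>. A contraction \<open>B\<close> in the block of \<open>(x, y)\<close> is mapped into the block of \<open>(x', y')\<close>, since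
\<open>E + T B\<close> and \<open>E - T B\<close> have norm one. Therefore \<open>outer x' y' + T B\<close> has norm one, and so does \<open>A + B\<close>. Applied to
all \<open>B = outer c d\<close>, this forces \<open>A\<close> to vanish on the complement of \<open>y\<close> and to have its range along \<open>x\<close>, so \<open>A\<close> is a multiple of
\<open>outer x y\<close>.\<close>
lemma isometry_rank_one_unit:
  fixes T :: "'a::{real_normed_field,euclidean_space}^'n^'m \<Rightarrow> 'a^'n^'m"
  assumes lin: "mlinear T" and iso: "\<And>A. spectral_norm (T A) = spectral_norm A"
    and m: "CARD('m) \<ge> 2" and n: "CARD('n) \<ge> 2" and xy: "norm x = 1" "norm y = 1"
  shows "\<exists>a b. norm a = 1 \<and> norm b = 1 \<and> T (outer x y) = outer a b"
proof -
  let ?E = "T (outer x y)"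
  have E1: "spectral_norm ?E = 1" using iso xy by simp
  obtain y' where y': "norm y' = 1" "norm (?E *v y') = 1" using spectral_norm_attained[of ?E] E1 by auto
  define x' where "x' = ?E *v y'"
  have x': "norm x' = 1" using y' by (simp add: x'_def)
  obtain A where A: "T A = outer x' y'" using isometry_surj[OF lin iso] by (metis surjD)
  have tb: "spectral_norm (A + B) \<le> 1" if B: "B \<in> orth_block x y" "spectral_norm B \<le> 1" for B
  proof -
    have B': "- B \<in> orth_block x y" using orth_block_mscale[OF B(1), of "-1"] by (simp add: minus_mscale[symmetric])
    have "T B \<in> orth_block x' y'"
    proof (rule block_of_norm_one_segment[OF _ y'(1) x' x'_def[symmetric]])
      show "spectral_norm (?E + T B) \<le> 1" "spectral_norm (?E - T B) \<le> 1"
        using outer_plus_block(2)[OF xy B] outer_plus_block(2)[OF xy B'] B(2) iso[of "outer x y + B"] iso[of "outer x y - B"]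
        by (simp_all add: mlinear_add[OF lin] mlinear_diff[OF lin])
    qed (use E1 in simp)
    from outer_plus_block(2)[OF x' y'(1) this] iso[of B] B(2)
    have "spectral_norm (T (A + B)) = 1" by (simp add: mlinear_add[OF lin] A)
    then show ?thesis by (simp add: iso)
  qed
  obtain u where u: "norm u = 1" "hip x u = 0" using exists_orthogonal_unit[OF m] by blast
  obtain v where v: "norm v = 1" "hip y v = 0" using exists_orthogonal_unit[OF n] by blast
  have A_block: "A \<in> orth_block c d" if cd: "norm c = 1" "norm d = 1" "hip x c = 0" "hip y d = 0" for c d
  proof (rule block_of_norm_one_segment[where E = "outer c d"])
    show "spectral_norm (outer c d + A) \<le> 1"
      using tb[OF outer_orth_block[OF cd(3,4)]] cd by (simp add: add.commute)
    have "hip x (- c) = 0" using cd by (simp add: hip_minus_right)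
    from tb[OF outer_orth_block[OF this cd(4)]] cd have "spectral_norm (A - outer c d) \<le> 1"
      by (simp add: outer_minus_left)
    then show "spectral_norm (outer c d - A) \<le> 1"
      using spectral_norm_minus[of "A - outer c d"] by simp
  qed (use cd in \<open>simp_all add: hip_self\<close>)
  have Ad: "A *v d = 0" if "norm d = 1" "hip y d = 0" for d
    using A_block[OF u(1) that(1) u(2) that(2)] by (simp add: orth_block_def)
  have Ac: "adj A *v c = 0" if "norm c = 1" "hip x c = 0" for c
    using A_block[OF that(1) v(1) that(2) v(2)] by (simp add: orth_block_def)
  obtain w where w: "A *v y = hip x (A *v y) *s x + w" "hip x w = 0" using decomp_along_unit[OF xy(1)] by blast
  have "hip w (A *v y) = hip w (hip x (A *v y) *s x + w)" using w(1) by (rule arg_cong)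
  then have "hip w w = hip w (A *v y)" by (simp add: hip_add_right hip_smult_right hip_commute_0[OF w(2)])
  also have "\<dots> = hip (adj A *v w) y" by (simp add: hip_adj_left)
  also have "\<dots> = 0" using vanish_of_units[OF Ac w(2)] by simp
  finally have "w = 0" by (simp add: hip_self)
  define c where "c = hip x (A *v y)"
  have Ay: "A *v y = c *s x" using w(1) \<open>w = 0\<close> by (simp add: c_def)
  have "A *v z = outer (c *s x) y *v z" for z
  proof -
    obtain z' where z': "z = hip y z *s y + z'" "hip y z' = 0" using decomp_along_unit[OF xy(2)] by blast
    show ?thesis
      by (subst z'(1)) (simp add: matrix_vector_right_distrib mult_vec_smult Ay vanish_of_units[OF Ad z'(2)])
  qed
  then have Ac: "A = mscale c (outer x y)" by (simp add: matrix_eq_vec outer_smult_left)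
  have "spectral_norm A = 1" using iso[of A] x' y' unfolding A by simp
  then have "norm c = 1" using xy by (simp add: Ac spectral_norm_mscale)
  then have "conjugate c * c = 1" by (simp add: conjugate_mult_self)
  then have "?E = mscale (conjugate c) (T A)" by (simp add: Ac mlinear_mscale[OF lin])
  also have "\<dots> = outer (conjugate c *s x') y'" by (simp add: A outer_smult_left)
  finally show ?thesis using \<open>norm c = 1\<close> x' y' by (intro exI[of _ "conjugate c *s x'"] exI[of _ y']) (simp add: norm_smult)
qed

section \<open>The form of spectral isometries\<close>

text \<open>If \<open>b\<close> and \<open>d\<close> are independent, evaluating at vectors orthogonal to one of them but not to the
other shows that both \<open>a\<close> and \<open>c\<close> are multiples of \<open>p\<close>.\<close>
lemma sum_of_outers_rank_one:
  assumes "outer a b + outer c d = outer p q" "a \<noteq> 0" "b \<noteq> 0" "c \<noteq> 0" "d \<noteq> 0"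
  shows "(\<exists>k. c = k *s a) \<or> (\<exists>k. d = k *s b)"
proof (rule disjCI)
  assume nd: "\<not> (\<exists>k. d = k *s b)"
  have v: "hip b z *s a + hip d z *s c = hip q z *s p" for z
    using arg_cong[OF assms(1), of "\<lambda>M. M *v z"] by (simp add: matrix_vector_mult_add_rdistrib)
  define z where "z = d - (hip b d / hip b b) *s b"
  have bb: "hip b b \<noteq> 0" "hip d d \<noteq> 0" using assms by (simp_all add: hip_self)
  have bz: "hip b z = 0" using bb by (simp add: z_def hip_simps)
  have "z \<noteq> 0" using nd by (auto simp: z_def)
  have "hip z z = hip d z"
    using hip_commute_0[OF bz] by (subst (1) z_def) (simp add: hip_diff_left hip_smult_left bz)
  then have dz: "hip d z \<noteq> 0" using \<open>z \<noteq> 0\<close> by (metis hip_self norm_eq_zero of_real_eq_0_iff power_eq_0_iff)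
  have c: "hip d z *s c = hip q z *s p" using v[of z] bz by simp
  then have "hip q z \<noteq> 0" using dz assms(4) by auto
  then have "p = (hip d z / hip q z) *s c"
    using arg_cong[OF c, of "\<lambda>x. inverse (hip q z) *s x"] by (simp add: field_simps)
  moreover define w where "w = b - (hip d b / hip d d) *s d"
  have dw: "hip d w = 0" using bb by (simp add: w_def hip_simps)
  have "hip b w \<noteq> 0"
  proof
    assume "hip b w = 0"
    have "hip w w = hip b w" by (subst (1) w_def) (simp add: hip_diff_left hip_smult_left dw)
    then have "w = 0" using \<open>hip b w = 0\<close> by (simp add: hip_self)
    then have "b = (hip d b / hip d d) *s d" by (simp add: w_def)
    moreover from this have "hip d b \<noteq> 0" using assms(3) by auto
    ultimately have "d = (hip d d / hip d b) *s b" using bb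
      by (metis (no_types, opaque_lifting) divide_self_if times_divide_times_eq mult.commute vector_smult_assoc vector_smult_lid)
    then show False using nd by blast
  qed
  moreover have "hip b w *s a = hip q w *s p" using v[of w] dw by simp
  ultimately have e: "hip b w *s a = (hip q w * (hip d z / hip q z)) *s c" by (metis vector_smult_assoc)
  let ?k = "hip q w * (hip d z / hip q z)"
  have "?k \<noteq> 0" using e \<open>hip b w \<noteq> 0\<close> assms(2) by auto
  then have "c = (hip b w / ?k) *s a"
    using arg_cong[OF e, of "\<lambda>x. inverse ?k *s x"] by (simp add: field_simps)
  then show "\<exists>k. c = k *s a" by blast
qed

lemma norm_decompose_scale:
  obtains x' where "norm x' = 1" "x = norm x *\<^sub>R (x' :: 'a::{real_normed_field,euclidean_space}^'n)"
proof (cases "x = 0")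
  case True then show ?thesis using exists_unit that by auto
next
  case False then show ?thesis using that[of "(1 / norm x) *\<^sub>R x"] by auto
qed

lemma isometry_rank_one:
  fixes T :: "'a::{real_normed_field,euclidean_space}^'n^'m \<Rightarrow> 'a^'n^'m"
  assumes lin: "mlinear T" and iso: "\<And>A. spectral_norm (T A) = spectral_norm A"
    and m: "CARD('m) \<ge> 2" and n: "CARD('n) \<ge> 2"
  shows "\<exists>a b. T (outer x y) = outer a b"
proof -
  obtain x' where x': "norm x' = 1" "x = norm x *\<^sub>R x'" by (rule norm_decompose_scale)
  obtain y' where y': "norm y' = 1" "y = norm y *\<^sub>R y'" by (rule norm_decompose_scale)
  obtain a b where "T (outer x' y') = outer a b" using isometry_rank_one_unit[OF lin iso m n x'(1) y'(1)] by blast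
  then have "T (outer x y) = outer (norm x *\<^sub>R a) (norm y *\<^sub>R b)"
    by (subst x'(2), subst y'(2)) (simp add: outer_scaleR_left outer_scaleR_right mlinear_mscale[OF lin])
  then show ?thesis by blast
qed

text \<open>A linear space of matrices of rank at most one: if neither a common left factor nor a common
right factor exists, three of its elements contradict \<open>sum_of_outers_rank_one\<close>.\<close>
lemma row_dichotomy:
  fixes T :: "'a::{real_normed_field,euclidean_space}^'n^'m \<Rightarrow> 'a^'q^'p"
  assumes lin: "mlinear T" and r1: "\<And>x y. \<exists>a b. T (outer x y) = outer a b"
    and inj: "\<And>y. y \<noteq> 0 \<Longrightarrow> T (outer x y) \<noteq> 0"
  shows "(\<exists>a. a \<noteq> 0 \<and> (\<forall>y. \<exists>z. T (outer x y) = outer a z)) \<or> (\<exists>b. b \<noteq> 0 \<and> (\<forall>y. \<exists>z. T (outer x y) = outer z b))"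
proof -
  obtain y1 :: "'a^'n" where "norm y1 = 1" using exists_unit by blast
  then have "y1 \<noteq> 0" by auto
  obtain a b where 1: "T (outer x y1) = outer a b" using r1 by blast
  then have ab: "a \<noteq> 0" "b \<noteq> 0" using inj[OF \<open>y1 \<noteq> 0\<close>] by (auto simp: outer_zero_left outer_zero_right)
  have sum: "\<exists>p q. outer a' b' + outer c' d' = outer p q" if "T (outer x y) = outer a' b'" "T (outer x v) = outer c' d'" for y v a' b' c' d'
    using r1[of x "y + v"] that by (simp add: outer_add_right mlinear_add[OF lin])
  have sl: "outer (k *s p) q = outer p (conjugate k *s q)" for k and p :: "'a^'p" and q :: "'a^'q"
    by (simp add: outer_smult_left outer_smult_right)
  show ?thesis
  proof (rule disj_commute[THEN iffD1], rule disjCI)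
    assume na: "\<not> (\<exists>a. a \<noteq> 0 \<and> (\<forall>y. \<exists>z. T (outer x y) = outer a z))"
    then obtain v where v: "\<And>z. T (outer x v) \<noteq> outer a z" using ab by blast
    obtain c0 d0 where 2: "T (outer x v) = outer c0 d0" using r1 by blast
    have cd0: "c0 \<noteq> 0" "d0 \<noteq> 0" using v[of 0] 2 by (auto simp: outer_zero_left outer_zero_right)
    have nca: "\<not> (\<exists>k. c0 = k *s a)" using v 2 sl by metis
    then obtain k where k: "d0 = k *s b" using sum[OF 1 2] sum_of_outers_rank_one ab cd0 by blast
    have "\<forall>y. \<exists>z. T (outer x y) = outer z b"
    proof
      fix y
      obtain g h where 3: "T (outer x y) = outer g h" using r1 by blast
      show "\<exists>z. T (outer x y) = outer z b"
      proof (cases "g = 0 \<or> h = 0")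
        case True then show ?thesis using 3 by (intro exI[of _ 0]) (auto simp: outer_zero_left outer_zero_right)
      next
        case False
        then have gh: "g \<noteq> 0" "h \<noteq> 0" by auto
        have "\<exists>k. h = k *s b"
        proof (rule ccontr)
          assume nh: "\<not> (\<exists>k. h = k *s b)"
          then obtain i where i: "g = i *s a" using sum[OF 1 3] sum_of_outers_rank_one ab gh by blast
          have "k \<noteq> 0" using k cd0 by auto
          then have b0: "b = inverse k *s d0" by (simp add: k)
          have "\<not> (\<exists>k. h = k *s d0)" using nh k by (metis vector_smult_assoc)
          then obtain j where j: "g = j *s c0" using sum[OF 2 3] sum_of_outers_rank_one cd0 gh by blast
          have "j \<noteq> 0" using j gh by auto
          then have "c0 = (inverse j * i) *s a" using i j
            by (metis left_inverse vector_smult_assoc vector_smult_lid)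
          then show False using nca by blast
        qed
        then show ?thesis using 3 by (metis outer_smult_left outer_smult_right conjugate_conjugate)
      qed
    qed
    then show "\<exists>b. b \<noteq> 0 \<and> (\<forall>y. \<exists>z. T (outer x y) = outer z b)" using ab by blast
  qed
qed

lemma norm_preserving_adj:
  fixes U :: "'a::{real_normed_field,euclidean_space}^'n^'m"
  assumes "\<And>z. norm (U *v z) = norm z"
  shows "adj U ** U = mat 1"
proof -
  have pol: "inner (U *v z) (U *v w) = inner z w" for z w
  proof -
    have "(norm (U *v (z + w)))\<^sup>2 = (norm (z + w))\<^sup>2" "(norm (U *v z))\<^sup>2 = (norm z)\<^sup>2" "(norm (U *v w))\<^sup>2 = (norm w)\<^sup>2"
      using assms by simp_all
    then show ?thesis by (simp add: norm_add_sq matrix_vector_right_distrib)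
  qed
  have "adj U *v (U *v z) = z" for z
  proof -
    have "inner w (adj U *v (U *v z)) = inner w z" for w
      using pol[of w z] by (simp add: inner_hip hip_adj)
    then show ?thesis by (metis vector_eq_ldot)
  qed
  then show ?thesis by (simp add: matrix_eq_vec matrix_vector_mul_assoc[symmetric])
qed

lemma norm_preserving_of_adj:
  fixes U :: "'a::{real_normed_field,euclidean_space}^'n^'m"
  assumes "adj U ** U = mat 1" shows "norm (U *v z) = norm z"
proof -
  have "hip (U *v z) (U *v z) = hip z z"
    using assms by (simp add: hip_adj matrix_vector_mul_assoc)
  then show ?thesis by (simp add: hip_self flip: of_real_power)
qed

definition unitary :: "'a::{real_normed_field,euclidean_space}^'n^'n \<Rightarrow> bool" where
  "unitary U \<longleftrightarrow> adj U ** U = mat 1"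

lemma unitary_iff_norm: "unitary U \<longleftrightarrow> (\<forall>z. norm (U *v z) = norm z)"
  unfolding unitary_def using norm_preserving_adj norm_preserving_of_adj by blast

lemma unitary_right: "unitary U \<Longrightarrow> U ** adj U = mat 1"
  unfolding unitary_def using matrix_left_right_inverse by blast

lemma unitary_adj: "unitary U \<Longrightarrow> unitary (adj U)"
  using unitary_right[of U] by (simp add: unitary_def)

lemma adj_mult: "adj (A ** B) = adj B ** adj A"
  by (simp add: adj_def matrix_matrix_mult_def vec_eq_iff mult.commute)

lemma mult_outer_mult: "U ** outer x y ** adj W = outer (U *v x) (W *v y)"
proof -
  have "(U ** outer x y ** adj W) *v z = outer (U *v x) (W *v y) *v z" for z
    by (simp add: matrix_vector_mul_assoc[symmetric] mult_vec_smult hip_adj)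
  then show ?thesis by (simp add: matrix_eq_vec)
qed

lemma norm_unit_axis [simp]: "norm (axis i 1 :: 'a::{real_normed_field,euclidean_space}^'n) = 1"
  by (simp add: norm_eq_sqrt_inner inner_axis')

lemma outer_sum_left: "outer (sum f S) y = (\<Sum>i\<in>S. outer (f i) y)"
  by (induction S rule: infinite_finite_induct) (auto simp: outer_add_left outer_zero_left)

lemma matrix_mult_sum: "U ** sum f S ** V = (\<Sum>i\<in>S. U ** f i ** V)" for U :: "'a::field^'n^'m"
  by (induction S rule: infinite_finite_induct)
     (auto simp: matrix_matrix_mult_def vec_eq_iff sum.distrib distrib_left distrib_right)

text \<open>With the common left factor normalised, the right factor depends linearly and isometrically on
\<open>y\<close>.\<close>
lemma row_map:
  fixes T :: "'a::{real_normed_field,euclidean_space}^'n^'m \<Rightarrow> 'a^'q^'p"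
  assumes lin: "mlinear T" and iso: "\<And>A. spectral_norm (T A) = spectral_norm A"
    and x: "norm x = 1" and row: "\<exists>a. a \<noteq> 0 \<and> (\<forall>y. \<exists>z. T (outer x y) = outer a z)"
  shows "\<exists>a S. norm a = 1 \<and> (\<forall>y. T (outer x y) = outer a (S y)) \<and> (\<forall>y. norm (S y) = norm y) \<and>
    (\<forall>y z. S (y + z) = S y + S z) \<and> (\<forall>c y. S (c *s y) = c *s S y)"
proof -
  obtain a0 where a0: "a0 \<noteq> 0" "\<And>y. \<exists>z. T (outer x y) = outer a0 z" using row by blast
  then obtain S0 where S0: "\<And>y. T (outer x y) = outer a0 (S0 y)" by metis
  define a where "a = (1 / norm a0) *\<^sub>R a0"
  define S where "S y = norm a0 *\<^sub>R S0 y" for y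
  have na: "norm a = 1" using a0(1) by (simp add: a_def)
  have S: "T (outer x y) = outer a (S y)" for y
    using a0(1) by (simp add: S0 a_def S_def outer_scaleR_left outer_scaleR_right flip: of_real_mult)
  have nS: "norm (S y) = norm y" for y using iso[of "outer x y"] by (simp add: S na x)
  have inj: "b = c" if "outer a b = outer a c" for b c
  proof -
    have "outer a (b - c) = 0" using that by (simp add: outer_diff_right)
    then show ?thesis using na by (auto simp: outer_eq_0_iff)
  qed
  have "S (y + z) = S y + S z" for y z
    by (rule inj) (simp add: S[symmetric] outer_add_right mlinear_add[OF lin])
  moreover have "S (c *s y) = c *s S y" for c y
    by (rule inj) (simp add: S[symmetric] outer_smult_right mlinear_mscale[OF lin])
  ultimately show ?thesis using na S nS by blast
qed

text \<open>For unit basis vectors \<open>axis i 1\<close> the image of \<open>outer (axis i 1) y\<close> is \<open>outer (a i) (S i y)\<close>. Distinct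
left factors are independent, as otherwise the images of two orthogonal rank-one matrices would
share a left factor and the parallelogram law would be violated. As sums of two rows keep rank one,
\<open>S i y\<close> is a multiple of \<open>S i0 y\<close>, with a factor that by linearity does not depend on \<open>y\<close> and can be
moved to the left. The codomain may have a different format, because the lemma is also applied to the
transposed map.\<close>
lemma isometry_form_of_rows:
  fixes T :: "'a::{real_normed_field,euclidean_space}^'n^'m \<Rightarrow> 'a^'q^'p"
  assumes lin: "mlinear T" and iso: "\<And>A. spectral_norm (T A) = spectral_norm A"
    and n: "CARD('n) \<ge> 2" and r1: "\<And>x y. \<exists>a b. T (outer x y) = outer a b"
    and rows: "\<And>i. \<exists>a. a \<noteq> 0 \<and> (\<forall>y. \<exists>z. T (outer (axis i 1) y) = outer a z)"
  shows "\<exists>U W. (\<forall>z. norm (U *v z) = norm z) \<and> (\<forall>z. norm (W *v z) = norm z) \<and> (\<forall>A. T A = U ** A ** adj W)"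
proof -
  define e where "e i = (axis i 1 :: 'a^'m)" for i
  define f where "f j = (axis j 1 :: 'a^'n)" for j
  have ne: "norm (e i) = 1" for i by (simp add: e_def)
  have "\<exists>a S. norm a = 1 \<and> (\<forall>y. T (outer (e i) y) = outer a (S y)) \<and> (\<forall>y. norm (S y) = norm y) \<and>
    (\<forall>y z. S (y + z) = S y + S z) \<and> (\<forall>c y. S (c *s y) = c *s S y)" for i
    using row_map[OF lin iso ne rows[folded e_def]] .
  then obtain a S where na: "\<And>i. norm (a i) = 1" and S: "\<And>i y. T (outer (e i) y) = outer (a i) (S i y)"
    and nS: "\<And>i y. norm (S i y) = norm y" and S_add: "\<And>i y z. S i (y + z) = S i y + S i z"
    and S_smult: "\<And>i c y. S i (c *s y) = c *s S i y" by metis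
  have S_sum: "S i (sum g X) = (\<Sum>j\<in>X. S i (g j))" for i g and X :: "'n set"
  proof -
    have "S i 0 = 0" using nS[of i 0] by simp
    then show ?thesis by (induction X rule: infinite_finite_induct) (auto simp: S_add)
  qed
  have S_0: "S i y = 0 \<longleftrightarrow> y = 0" for i y using nS[of i y] by (metis norm_eq_zero)
  obtain y0 :: "'a^'n" where y0: "norm y0 = 1" using exists_unit by blast
  obtain v :: "'a^'n" where v: "norm v = 1" "hip y0 v = 0" using exists_orthogonal_unit[OF n] by blast
  \<comment> \<open>an arbitrary row, with which the others are compared\<close>
  define i0 where "i0 = (undefined :: 'm)"
  have indep: "\<not> (\<exists>k. a i = k *s a i0)" if i: "i \<noteq> i0" for i
  proof
    assume "\<exists>k. a i = k *s a i0"
    then obtain k where k: "a i = k *s a i0" by blast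
    have nk: "norm k = 1" using arg_cong[OF k, of norm] na by (simp add: norm_smult)
    have ee: "hip (e i) (e i0) = 0" unfolding e_def hip_def using i by (intro sum.neutral) (auto simp: axis_def)
    have sp: "norm (conjugate k *s S i y0 + c *\<^sub>R S i0 v) \<le> 1" if c: "\<bar>c\<bar> = 1" for c :: real
    proof -
      have "c *\<^sub>R outer (e i0) v \<in> orth_block (e i) y0"
        by (intro orth_block_scaleR outer_orth_block ee v)
      moreover have "spectral_norm (c *\<^sub>R outer (e i0) v) \<le> 1"
        using c v by (simp add: scaleR_mscale spectral_norm_mscale ne)
      ultimately have "spectral_norm (outer (e i) y0 + c *\<^sub>R outer (e i0) v) = 1"
        by (rule outer_plus_block(2)[OF ne y0])
      moreover have "T (outer (e i) y0 + c *\<^sub>R outer (e i0) v) = outer (a i0) (conjugate k *s S i y0 + c *\<^sub>R S i0 v)"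
        by (simp add: mlinear_add[OF lin] mlinear_mscale[OF lin] S k outer_add_right outer_smult_left outer_smult_right
            outer_scaleR_right scaleR_mscale)
      ultimately show ?thesis using iso[of "outer (e i) y0 + c *\<^sub>R outer (e i0) v"] by (simp add: na)
    qed
    have "S i0 v = 0"
      by (rule parallelogram_vanish[of "conjugate k *s S i y0"])
         (use sp[of 1] sp[of "-1"] nk y0 in \<open>simp_all add: norm_smult nS\<close>)
    then show False using v S_0[of i0 v] by auto
  qed
  have scal: "\<exists>k. \<forall>y. S i y = k *s S i0 y" for i
  proof (cases "i = i0")
    case True then show ?thesis by (intro exI[of _ 1]) simp
  next
    case False
    have pt: "\<exists>k. S i y = k *s S i0 y" for y
    proof (cases "y = 0")
      case True then show ?thesis by (simp add: S_0[THEN iffD2])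
    next
      case False
      obtain p q where "T (outer (e i0 + e i) y) = outer p q" using r1 by blast
      then have "outer (a i0) (S i0 y) + outer (a i) (S i y) = outer p q"
        by (simp add: outer_add_left mlinear_add[OF lin] S)
      from sum_of_outers_rank_one[OF this] show ?thesis
        using indep[OF \<open>i \<noteq> i0\<close>] na[of i] na[of i0] S_0 False by fastforce
    qed
    obtain k1 where k1: "S i y0 = k1 *s S i0 y0" using pt by blast
    have "S i y = k1 *s S i0 y" for y
    proof -
      obtain k2 where k2: "S i y = k2 *s S i0 y" using pt by blast
      obtain k3 where k3: "S i (y + y0) = k3 *s S i0 (y + y0)" using pt by blast
      have "S i0 ((k3 - k2) *s y + (k3 - k1) *s y0) = 0"
      proof -
        have "S i0 ((k3 - k2) *s y + (k3 - k1) *s y0) = (k3 - k2) *s S i0 y + (k3 - k1) *s S i0 y0"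
          by (simp only: S_add S_smult)
        also have "\<dots> = k3 *s (S i0 y + S i0 y0) - (k2 *s S i0 y + k1 *s S i0 y0)"
          by (simp add: vec.scale_left_diff_distrib vec.scale_right_distrib)
        also have "\<dots> = 0" using k3 by (simp add: S_add flip: k1 k2)
        finally show ?thesis .
      qed
      then have z: "(k3 - k2) *s y + (k3 - k1) *s y0 = 0" by (simp add: S_0)
      show ?thesis
      proof (cases "k3 = k2")
        case True
        then have "(k3 - k1) *s y0 = 0" using z by simp
        then have "k3 = k1" using y0 by auto
        then show ?thesis using k2 True by simp
      next
        case False
        have "(k3 - k2) *s y = (k1 - k3) *s y0" using z
          by (metis add_eq_0_iff2 minus_diff_eq vec.scale_minus_left)
        then have "inverse (k3 - k2) *s ((k3 - k2) *s y) = inverse (k3 - k2) *s ((k1 - k3) *s y0)" by (rule arg_cong)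
        then have "y = (inverse (k3 - k2) * (k1 - k3)) *s y0" using False by (simp only: vector_smult_assoc) simp
        then show ?thesis using k1 by (simp add: S_smult mult.commute)
      qed
    qed
    then show ?thesis by blast
  qed
  then obtain k where k: "\<And>i y. S i y = k i *s S i0 y" by metis
  define U where "U = (\<chi> r i. (conjugate (k i) *s a i) $ r)"
  define W where "W = (\<chi> r j. S i0 (f j) $ r)"
  have Ux: "U *v x = (\<Sum>i\<in>UNIV. x $ i *s (conjugate (k i) *s a i))" for x
    by (simp add: U_def matrix_vector_mult_def vec_eq_iff mult_ac)
  have Wy: "W *v y = S i0 y" for y
  proof -
    have "y = (\<Sum>j\<in>UNIV. y $ j *s f j)" by (simp add: basis_expansion f_def)
    then have "S i0 y = (\<Sum>j\<in>UNIV. y $ j *s S i0 (f j))"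
      using S_sum[of i0 "\<lambda>j. y $ j *s f j" UNIV] by (simp add: S_smult)
    then show ?thesis by (simp add: W_def matrix_vector_mult_def vec_eq_iff mult_ac)
  qed
  have Sk: "S i y = k i *s (W *v y)" for i y unfolding Wy by (rule k)
  have Tout: "T (outer x y) = outer (U *v x) (W *v y)" for x y
  proof -
    have "x = (\<Sum>i\<in>UNIV. x $ i *s e i)" by (simp add: basis_expansion e_def)
    then have "T (outer x y) = (\<Sum>i\<in>UNIV. T (outer (x $ i *s e i) y))"
      using outer_sum_left[of "\<lambda>i. x $ i *s e i" UNIV y] by (simp add: mlinear_sum[OF lin])
    also have "\<dots> = (\<Sum>i\<in>UNIV. outer (x $ i *s (conjugate (k i) *s a i)) (W *v y))"
      by (simp add: outer_smult_left mlinear_mscale[OF lin] S Sk outer_smult_right)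
    finally show ?thesis by (simp add: Ux outer_sum_left)
  qed
  have nW: "norm (W *v y) = norm y" for y by (simp add: Wy nS)
  have nU: "norm (U *v x) = norm x" for x
    using iso[of "outer x y0"] y0 by (simp add: Tout nW)
  have "T A = U ** A ** adj W" for A
  proof -
    have "T A = (\<Sum>j\<in>UNIV. U ** outer (A *v axis j 1) (axis j 1) ** adj W)"
      using arg_cong[OF matrix_sum_outer[of A], of T] by (simp only: mlinear_sum[OF lin] Tout mult_outer_mult)
    also have "\<dots> = U ** A ** adj W"
      using arg_cong[OF matrix_sum_outer[of A], of "\<lambda>M. U ** M ** adj W"] by (simp only: matrix_mult_sum)
    finally show ?thesis .
  qed
  with nU nW show ?thesis by blast
qed

lemma norm_preserving_card_le:
  fixes U :: "'a::{real_normed_field,euclidean_space}^'n^'m"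
  assumes "\<And>z. norm (U *v z) = norm z" shows "CARD('n) \<le> CARD('m)"
proof -
  have l: "linear (\<lambda>z. U *v z)"
    by (rule linearI) (simp_all add: matrix_vector_right_distrib mult_vec_scaleR)
  have "inj (\<lambda>z. U *v z)" unfolding linear_injective_0[OF l] using assms by (metis norm_eq_zero)
  then have "dim ((\<lambda>z. U *v z) ` UNIV) = dim (UNIV :: ('a^'n) set)"
    by (intro dim_image_eq[OF l]) simp
  then have "DIM('a^'n) \<le> DIM('a^'m)" using dim_subset_UNIV[of "range (\<lambda>z. U *v z)"] by simp
  then show ?thesis by simp
qed

lemma mlinearI:
  assumes "\<And>A B. T (A + B) = T A + T B" "\<And>c A. T (mscale c A) = mscale c (T A)"
  shows "mlinear T"
  unfolding Vector_Spaces.linear_iff by (intro conjI allI assms mat.vector_space_axioms)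

lemma transpose_add: "transpose (A + B) = transpose A + transpose B"
  by (simp add: transpose_def vec_eq_iff)
lemma transpose_mscale: "transpose (mscale c A) = mscale c (transpose A)"
  by (simp add: transpose_def mscale_def vec_eq_iff)

text \<open>Suppose \<open>outer x y\<close> is mapped to \<open>outer a (S y)\<close> and \<open>outer u v\<close> to \<open>outer (Z v) b\<close>. By the dimension
hypothesis \<open>S\<close> is onto, so \<open>S y\<close> can be made parallel to \<open>b\<close>; but for \<open>v\<close> orthogonal to \<open>y\<close> the right factors
\<open>S y\<close> and \<open>b\<close> must be orthogonal.\<close>
lemma rows_not_mixed:
  fixes T :: "'a::{real_normed_field,euclidean_space}^'n^'m \<Rightarrow> 'a^'q^'p"
  assumes lin: "mlinear T" and iso: "\<And>A. spectral_norm (T A) = spectral_norm A"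
    and n: "CARD('n) \<ge> 2" and nq: "CARD('q) \<le> CARD('n)"
    and xu: "norm x = 1" "norm u = 1" "hip x u = 0"
    and row: "\<exists>a. a \<noteq> 0 \<and> (\<forall>y. \<exists>z. T (outer x y) = outer a z)"
    and row': "\<exists>b. b \<noteq> 0 \<and> (\<forall>y. \<exists>z. T (outer u y) = outer z b)"
  shows False
proof -
  obtain a S where na: "norm a = 1" and S: "\<And>y. T (outer x y) = outer a (S y)" and nS: "\<And>y. norm (S y) = norm y"
    and Sadd: "\<And>y z. S (y + z) = S y + S z" and Ssm: "\<And>c y. S (c *s y) = c *s S y"
    using row_map[OF lin iso xu(1) row] by blast
  obtain b Z where b: "b \<noteq> 0" and Z: "\<And>y. T (outer u y) = outer (Z y) b" using row' by metis
  have l: "linear S" by (rule linearI) (simp_all add: Sadd scaleR_smult Ssm)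
  have "inj S" unfolding linear_injective_0[OF l] using nS by (metis norm_eq_zero)
  then have "dim (S ` UNIV) = DIM('a^'n)" using dim_image_eq[OF l, of UNIV] by simp
  moreover have "DIM('a^'q) \<le> DIM('a^'n)" using nq by simp
  ultimately have "dim (range S) = DIM('a^'q)" using dim_subset_UNIV[of "range S"] by simp
  then have "span (range S) = UNIV" by (rule dim_eq_full[THEN iffD1])
  moreover have "span (range S) = range S" using linear_subspace_image[OF l subspace_UNIV] by (rule span_eq_iff[THEN iffD2])
  ultimately have "surj S" by simp
  then obtain y where y: "S y = (1 / norm b) *\<^sub>R b" by (metis surjD)
  then have ny: "norm y = 1" using nS[of y] b by simp
  obtain v where v: "norm v = 1" "hip y v = 0" using exists_orthogonal_unit[OF n] by blast
  have B: "outer (Z v) b \<in> orth_block a (S y)"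
  proof (rule block_of_norm_one_segment[where E = "outer a (S y)"])
    show "spectral_norm (outer a (S y) + outer (Z v) b) \<le> 1"
      using outer_plus_block(2)[OF xu(1) ny outer_orth_block[OF xu(3) v(2)]] xu v
        iso[of "outer x y + outer u v"] by (simp add: mlinear_add[OF lin] S Z)
    have "hip x (- u) = 0" using xu by (simp add: hip_minus_right)
    from outer_plus_block(2)[OF xu(1) ny outer_orth_block[OF this v(2)]]
    show "spectral_norm (outer a (S y) - outer (Z v) b) \<le> 1" using xu v
        iso[of "outer x y - outer u v"] by (simp add: mlinear_diff[OF lin] S Z outer_minus_left)
  qed (use na nS ny in \<open>simp_all add: hip_self\<close>)
  have "norm (Z v) * norm b = 1" using iso[of "outer u v"] xu v by (simp add: Z)
  then have "Z v \<noteq> 0" by auto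
  have "hip b (S y) *s Z v = 0" using B by (simp add: orth_block_def)
  then have "hip b (S y) = 0" using \<open>Z v \<noteq> 0\<close> by simp
  then show False using b by (simp add: y hip_simps hip_self)
qed

lemma reindex_mult_vec:
  fixes M :: "'a::field^'n^'p"
  assumes "bij (\<sigma> :: 'm::finite \<Rightarrow> 'n)"
  shows "(\<chi> i k. M $ i $ \<sigma> k) *v z = M *v (\<chi> j. z $ inv \<sigma> j)"
proof -
  have "(\<Sum>j\<in>UNIV. M $ i $ j * z $ inv \<sigma> j) = (\<Sum>k\<in>UNIV. M $ i $ \<sigma> k * z $ k)" for i
    using sum.reindex_bij_betw[OF assms, of "\<lambda>j. M $ i $ j * z $ inv \<sigma> j"] assms
    by (simp add: bij_is_inj)
  then show ?thesis by (simp add: matrix_vector_mult_def vec_eq_iff)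
qed

lemma norm_reindex:
  assumes "bij (\<sigma> :: 'm::finite \<Rightarrow> 'n::finite)"
  shows "norm (\<chi> k. z $ \<sigma> k) = norm (z :: 'a::real_normed_vector^'n)"
  unfolding norm_vec_def L2_set_def
  using sum.reindex_bij_betw[OF assms, of "\<lambda>j. (norm (z $ j))\<^sup>2"] by simp

lemma unitary_reindex:
  fixes M :: "'a::{real_normed_field,euclidean_space}^'n^'m"
  assumes s: "bij (\<sigma> :: 'm \<Rightarrow> 'n)" and M: "\<And>z. norm (M *v z) = norm z"
  shows "unitary (\<chi> i k. M $ i $ \<sigma> k)"
  unfolding unitary_iff_norm reindex_mult_vec[OF s] M
  by (simp add: norm_reindex[OF bij_imp_bij_inv[OF s]])

lemma unitary_transpose: "unitary U \<Longrightarrow> unitary (transpose U)"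
proof -
  assume "unitary U"
  then have "transpose (U ** adj U) = transpose (mat 1)" by (simp add: unitary_right)
  then have "transpose (adj U) ** transpose U = mat 1" by (simp add: matrix_transpose_mul transpose_mat)
  moreover have "transpose (adj U) = adj (transpose U)" by (simp add: transpose_def adj_def vec_eq_iff)
  ultimately show ?thesis by (simp add: unitary_def)
qed

definition conjugate_vec :: "'a::{real_normed_field,euclidean_space}^'n \<Rightarrow> 'a^'n" where
  "conjugate_vec x = (\<chi> i. conjugate (x $ i))"

lemma norm_conjugate_vec [simp]: "norm (conjugate_vec x) = norm x"
  by (simp add: conjugate_vec_def norm_vec_def)

lemma conjugate_vec_eq_0 [simp]: "conjugate_vec x = 0 \<longleftrightarrow> x = 0"
  by (metis norm_conjugate_vec norm_eq_zero)

lemma transpose_outer: "transpose (outer x y) = outer (conjugate_vec y) (conjugate_vec x)"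
  by (simp add: transpose_def outer_def conjugate_vec_def vec_eq_iff mult.commute)

lemma transpose_adj_norm:
  assumes "\<And>z. norm (W *v z) = norm z" shows "norm (transpose (adj W) *v z) = norm z"
proof -
  have "transpose (adj W) *v z = conjugate_vec (W *v conjugate_vec z)"
    by (simp add: transpose_def adj_def conjugate_vec_def matrix_vector_mult_def vec_eq_iff)
  then show ?thesis by (simp add: assms)
qed

text \<open>Identifying the index types along \<open>\<sigma>\<close> turns the rectangular types of the factors into square
ones.\<close>
lemma transpose_along_product:
  fixes P :: "'a::field^'n^'m" and Q :: "'a^'n^'m"
  assumes s: "bij (\<sigma> :: 'm \<Rightarrow> 'n)"
  shows "P ** transpose A ** Q = (\<chi> i k. P $ i $ \<sigma> k) ** transpose_along \<sigma> A ** (\<chi> k. Q $ inv \<sigma> k)"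
proof -
  have "(P ** transpose A ** Q) *v z = ((\<chi> i k. P $ i $ \<sigma> k) ** transpose_along \<sigma> A ** (\<chi> k. Q $ inv \<sigma> k)) *v z" for z
  proof -
    let ?w = "Q *v z"
    have 1: "(\<chi> k. Q $ inv \<sigma> k) *v z = (\<chi> j. ?w $ inv \<sigma> j)"
      by (simp add: matrix_vector_mult_def vec_eq_iff)
    have 2: "transpose_along \<sigma> A *v (\<chi> j. ?w $ inv \<sigma> j) = (\<chi> i. (transpose A *v ?w) $ \<sigma> i)"
    proof -
      have "(\<Sum>j\<in>UNIV. transpose A $ \<sigma> i $ inv \<sigma> j * ?w $ inv \<sigma> j) = (\<Sum>k\<in>UNIV. transpose A $ \<sigma> i $ k * ?w $ k)" for i
        using sum.reindex_bij_betw[OF bij_imp_bij_inv[OF s], of "\<lambda>k. transpose A $ \<sigma> i $ k * ?w $ k"] .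
      then show ?thesis by (simp add: transpose_along_def matrix_vector_mult_def vec_eq_iff)
    qed
    have 3: "(\<chi> j. (\<chi> i. (transpose A *v ?w) $ \<sigma> i) $ inv \<sigma> j) = transpose A *v ?w"
      using s by (simp add: vec_eq_iff bij_is_surj surj_f_inv_f)
    show ?thesis by (simp only: matrix_vector_mul_assoc[symmetric] 1 2 reindex_mult_vec[OF s] 3)
  qed
  then show ?thesis by (simp add: matrix_eq_vec)
qed

text \<open>Either all rows have a common left factor, or all have a common right factor. In the second case
the transposed map falls under the first, with norm-preserving factors in both directions between the
two vector spaces, so that the two dimensions agree.\<close>
proposition spectral_isometry_form:
  fixes T :: "'a::{real_normed_field,euclidean_space}^'n^'m \<Rightarrow> 'a^'n^'m"
  assumes lin: "mlinear T" and iso: "\<And>A. spectral_norm (T A) = spectral_norm A"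
    and m: "CARD('m) \<ge> 2" and n: "CARD('n) \<ge> 2"
  shows "(\<exists>U V. unitary U \<and> unitary V \<and> (\<forall>A. T A = U ** A ** V)) \<or>
    (CARD('m) = CARD('n) \<and> (\<exists>U V. \<exists>\<sigma> :: 'm \<Rightarrow> 'n. unitary U \<and> unitary V \<and> bij \<sigma> \<and> (\<forall>A. T A = U ** transpose_along \<sigma> A ** V)))"
proof -
  define e where "e i = (axis i 1 :: 'a^'m)" for i
  have ne: "norm (e i) = 1" for i by (simp add: e_def)
  have r1: "\<exists>a b. T (outer x y) = outer a b" for x y by (rule isometry_rank_one[OF lin iso m n])
  have inj: "T (outer x y) \<noteq> 0" if "x \<noteq> 0" "y \<noteq> 0" for x y
    using iso[of "outer x y"] that by (auto simp: spectral_norm_0_iff[THEN iffD2])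
  define left where "left i \<longleftrightarrow> (\<exists>a. a \<noteq> 0 \<and> (\<forall>y. \<exists>z. T (outer (e i) y) = outer a z))" for i
  define right where "right i \<longleftrightarrow> (\<exists>b. b \<noteq> 0 \<and> (\<forall>y. \<exists>z. T (outer (e i) y) = outer z b))" for i
  have lr: "left i \<or> right i" for i unfolding left_def right_def
    by (rule row_dichotomy[OF lin r1]) (rule inj, use ne[of i] in auto)
  have mixed: "\<not> (left i \<and> right k)" if "i \<noteq> k" for i k
  proof
    assume "left i \<and> right k"
    moreover have "hip (e i) (e k) = 0" unfolding e_def hip_def using that by (intro sum.neutral) (auto simp: axis_def)
    ultimately show False unfolding left_def right_def
      using rows_not_mixed[OF lin iso n order_refl ne ne] by blast
  qed
  show ?thesis
  proof (cases "\<forall>i. left i")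
    case True
    then obtain U W where "\<And>z. norm (U *v z) = norm z" "\<And>z. norm (W *v z) = norm z" "\<And>A. T A = U ** A ** adj W"
      using isometry_form_of_rows[OF lin iso n r1] unfolding left_def e_def by blast
    moreover from this have "unitary U" "unitary (adj W)" using unitary_adj[of W] by (simp_all add: unitary_iff_norm)
    ultimately show ?thesis by blast
  next
    case False
    then obtain i0 where i0: "\<not> left i0" by blast
    have right: "right i" for i
      using lr[of i] lr[of i0] mixed[of i i0] i0 by blast
    define T' where "T' A = transpose (T A)" for A
    have lin': "mlinear T'"
      by (rule mlinearI) (simp_all add: T'_def mlinear_add[OF lin] mlinear_mscale[OF lin] transpose_add transpose_mscale)
    have iso': "spectral_norm (T' A) = spectral_norm A" for A by (simp add: T'_def iso)
    have r1': "\<exists>a b. T' (outer x y) = outer a b" for x y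
      using r1[of x y] unfolding T'_def by (metis transpose_outer)
    have rows': "\<exists>a. a \<noteq> 0 \<and> (\<forall>y. \<exists>z. T' (outer (axis i 1) y) = outer a z)" for i
    proof -
      obtain b where b: "b \<noteq> 0" "\<And>y. \<exists>z. T (outer (e i) y) = outer z b" using right[of i] unfolding right_def by blast
      have "\<exists>z. T' (outer (axis i 1) y) = outer (conjugate_vec b) z" for y
        using b(2)[of y] unfolding T'_def e_def by (metis transpose_outer)
      then show ?thesis using b(1) by (intro exI[of _ "conjugate_vec b"]) simp
    qed
    obtain U W where U: "\<And>z. norm (U *v z) = norm z" and W: "\<And>z. norm (W *v z) = norm z" and
      form: "\<And>A. T' A = U ** A ** adj W"
      using isometry_form_of_rows[OF lin' iso' n r1' rows'] by blast
    have card: "CARD('m) = CARD('n)"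
      using norm_preserving_card_le[of U] norm_preserving_card_le[of W] U W by simp
    then obtain \<sigma> :: "'m \<Rightarrow> 'n" where s: "bij \<sigma>"
      using finite_same_card_bij[of "UNIV :: 'm set" "UNIV :: 'n set"] by auto
    let ?P = "transpose (adj W)" and ?Q = "transpose U"
    have "T A = (\<chi> i k. ?P $ i $ \<sigma> k) ** transpose_along \<sigma> A ** (\<chi> k. ?Q $ inv \<sigma> k)" for A
    proof -
      have "T A = transpose (T' A)" by (simp add: T'_def)
      also have "\<dots> = ?P ** transpose A ** ?Q" by (simp add: form matrix_transpose_mul matrix_mul_assoc)
      finally show ?thesis by (simp only: transpose_along_product[OF s])
    qed
    moreover have "unitary (\<chi> i k. ?P $ i $ \<sigma> k)"
      by (rule unitary_reindex[OF s transpose_adj_norm[OF W]])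
    moreover have "unitary (\<chi> k. ?Q $ inv \<sigma> k)"
    proof -
      have "(\<chi> k. ?Q $ inv \<sigma> k) = transpose (\<chi> j k. U $ j $ inv \<sigma> k)"
        by (simp add: transpose_def vec_eq_iff)
      then show ?thesis using unitary_transpose[OF unitary_reindex[OF bij_imp_bij_inv[OF s] U]] by simp
    qed
    ultimately show ?thesis using card s by blast
  qed
qed

section \<open>TEA preservers and the equivalence\<close>
lemma spectral_norm_unitary_mult:
  fixes U :: "'a::{real_normed_field,euclidean_space}^'m^'m"
  assumes "unitary U" shows "spectral_norm (U ** A) = spectral_norm A"
proof -
  have "norm ((U ** A) *v x) = norm (A *v x)" for x
    using assms by (simp add: unitary_iff_norm matrix_vector_mul_assoc[symmetric])
  then show ?thesis by (simp add: spectral_norm_def onorm_def)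
qed

lemma spectral_norm_mult_unitary:
  assumes "unitary V" shows "spectral_norm (A ** V) = spectral_norm A"
  using spectral_norm_unitary_mult[OF unitary_adj[OF assms], of "adj A"]
  by (metis adj_mult spectral_norm_adj)

text \<open>Up to multiplication by permutation matrices \<open>P\<close> this is the ordinary transpose.\<close>
lemma spectral_norm_transpose_along:
  fixes A :: "'a::{real_normed_field,euclidean_space}^'n^'m"
  assumes s: "bij (\<sigma> :: 'm \<Rightarrow> 'n)" shows "spectral_norm (transpose_along \<sigma> A) = spectral_norm A"
proof -
  define P :: "'a^'n^'m" where "P = (\<chi> i k. if k = \<sigma> i then 1 else 0)"
  have P1: "(\<chi> i k. P $ i $ \<sigma> k) = mat 1" "(\<chi> k. P $ inv \<sigma> k) = mat 1"
    using s by (auto simp: P_def mat_def vec_eq_iff bij_is_inj inj_eq bij_is_surj surj_f_inv_f)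
  have nP: "norm (P *v z) = norm z" for z
  proof -
    have "P *v z = (\<chi> i. z $ \<sigma> i)"
      by (simp add: P_def matrix_vector_mult_def vec_eq_iff if_distrib[of "\<lambda>t. t * _"] cong: if_cong)
    then show ?thesis by (simp add: norm_reindex[OF s])
  qed
  have nP': "norm (adj P *v z) = norm z" for z
  proof -
    have "P *v (adj P *v z) = z" 
    proof -
      have "adj P *v z = (\<chi> k. z $ inv \<sigma> k)"
      proof -
        have "(k = \<sigma> i) = (i = inv \<sigma> k)" for k i using s by (metis bij_inv_eq_iff)
        then show ?thesis
        by (simp add: P_def adj_def matrix_vector_mult_def vec_eq_iff if_distrib[of "\<lambda>t. t * _"] if_distrib[of conjugate] cong: if_cong)
      qed
      moreover have "P *v w = (\<chi> i. w $ \<sigma> i)" for w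
        by (simp add: P_def matrix_vector_mult_def vec_eq_iff if_distrib[of "\<lambda>t. t * _"] cong: if_cong)
      ultimately show ?thesis using s by (simp add: vec_eq_iff bij_is_inj)
    qed
    then show ?thesis using nP[of "adj P *v z"] by simp
  qed
  have "transpose_along \<sigma> A = P ** transpose A ** P"
    using transpose_along_product[OF s, of P A P] by (simp add: P1)
  moreover have "spectral_norm (P ** (transpose A ** P)) = spectral_norm (transpose A ** P)"
  proof -
    have "norm ((P ** (transpose A ** P)) *v x) = norm ((transpose A ** P) *v x)" for x
      by (simp add: nP matrix_vector_mul_assoc[symmetric])
    then show ?thesis by (simp add: spectral_norm_def onorm_def)
  qed
  moreover have "spectral_norm (transpose A ** P) = spectral_norm (transpose A)"
  proof -
    have "norm (adj (transpose A ** P) *v x) = norm (adj (transpose A) *v x)" for x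
      by (simp add: nP' adj_mult matrix_vector_mul_assoc[symmetric])
    then have "spectral_norm (adj (transpose A ** P)) = spectral_norm (adj (transpose A))" by (simp add: spectral_norm_def onorm_def)
    then show ?thesis by simp
  qed
  ultimately show ?thesis by (simp add: matrix_mul_assoc)
qed

lemma tea_preserver_parallel:
  fixes T :: "'a::{real_normed_field,euclidean_space}^'n^'m \<Rightarrow> 'a^'n^'m"
  assumes lin: "mlinear T" and tea: "preserves_pairs tea_pair T"
  shows "preserves_pairs parallel_pair T"
  unfolding preserves_pairs_def
proof (intro allI impI)
  fix A B :: "'a^'n^'m" assume "parallel_pair A B"
  then obtain \<mu> :: 'a where mu: "norm \<mu> = 1" "tea_pair A (mscale \<mu> B)"
    unfolding parallel_pair_def tea_pair_def by (auto simp: spectral_norm_mscale)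
  then have "tea_pair (T A) (T (mscale \<mu> B))" using tea unfolding preserves_pairs_def by blast
  then show "parallel_pair (T A) (T B)" using mu(1)
    unfolding parallel_pair_def tea_pair_def by (auto simp: spectral_norm_mscale mlinear_mscale[OF lin])
qed

text \<open>Suppose all images lie on one line. Choose \<open>outer u v\<close> outside the kernel and \<open>x\<close> orthogonal to \<open>u\<close>. The
complement of \<open>v\<close> contains two orthonormal vectors, and a combination \<open>y\<close> of them puts \<open>outer x y\<close> into the
kernel. The sum and the difference of the two matrices then form a TEA pair with opposite nonzero
images.\<close>
lemma tea_preserver_rank_wide:
  fixes T :: "'a::{real_normed_field,euclidean_space}^'n^'m \<Rightarrow> 'a^'n^'m"
  assumes lin: "mlinear T" and tea: "preserves_pairs tea_pair T" and nz: "T \<noteq> (\<lambda>_. 0)"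
    and m: "CARD('m) \<ge> 2" and n: "CARD('n) \<ge> 3"
  shows "\<not> rank_le_one T"
proof
  assume "rank_le_one T"
  then obtain R where R: "\<And>A. \<exists>c. T A = mscale c R" unfolding rank_le_one_def by blast
  have "\<exists>u v. T (outer u v) \<noteq> 0"
  proof (rule ccontr)
    assume "\<nexists>u v. T (outer u v) \<noteq> 0"
    then have "T A = 0" for A by (subst matrix_sum_outer) (simp add: mlinear_sum[OF lin])
    then show False using nz by auto
  qed
  then obtain u v where uv: "T (outer u v) \<noteq> 0" "norm u = 1" "norm v = 1" using normalize_nonzero[OF lin] by metis
  obtain x where x: "norm x = 1" "hip u x = 0" using exists_orthogonal_unit[OF m] by blast
  have n2: "CARD('n) \<ge> 2" using n by simp
  obtain y1 where y1: "norm y1 = 1" "hip v y1 = 0" using exists_orthogonal_unit[OF n2] by blast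
  obtain y2 where y2: "norm y2 = 1" "hip v y2 = 0" "hip y1 y2 = 0" using exists_orthogonal_unit2[OF n] by blast
  obtain c1 c2 where c: "T (outer x y1) = mscale c1 R" "T (outer x y2) = mscale c2 R" using R by metis
  obtain y where y: "y \<noteq> 0" "hip v y = 0" "T (outer x y) = 0"
  proof (cases "c1 = 0")
    case True
    moreover have "y1 \<noteq> 0" using y1 by auto
    ultimately show ?thesis using that[of y1] y1 c by simp
  next
    case False
    let ?y = "conjugate c2 *s y1 - conjugate c1 *s y2"
    have "hip y2 ?y = - conjugate c1" using y2 by (simp add: hip_simps hip_self hip_commute_0[OF y2(3)])
    then have "?y \<noteq> 0" using False by (metis conjugate_eq_0_iff hip_zero_right neg_equal_0_iff_equal)
    moreover have "T (outer x ?y) = 0"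
      by (simp add: outer_diff_right outer_smult_right mlinear_diff[OF lin] mlinear_mscale[OF lin] c mult.commute)
    ultimately show ?thesis using that[of ?y] y1 y2 by (simp add: hip_simps)
  qed
  define z where "z = (1 / norm y) *\<^sub>R y"
  have z: "norm z = 1" "hip v z = 0" "T (outer x z) = 0"
    using y by (simp_all add: z_def hip_simps outer_scaleR_right mlinear_mscale[OF lin])
  have o: "hip x u = 0" "hip z v = 0" using hip_commute_0 x z by blast+
  have C: "outer u v \<in> orth_block x z" "- outer u v \<in> orth_block x z"
    using outer_orth_block[OF o] outer_orth_block[of x "- u" z v] o by (simp_all add: outer_minus_left hip_minus_right)
  have "tea_pair (outer x z + outer u v) (outer x z + - outer u v)"
    by (rule tea_pair_face[OF x(1) z(1) C(1) _ C(2)]) (use uv in simp_all)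
  then have "tea_pair (T (outer x z + outer u v)) (T (outer x z + - outer u v))"
    using tea unfolding preserves_pairs_def by blast
  then have "tea_pair (T (outer u v)) (- T (outer u v))"
    by (simp only: mlinear_add[OF lin] mlinear_minus[OF lin] z(3)) simp
  then have "T (outer u v) = 0" unfolding tea_pair_def using spectral_norm_0_iff[of "0 :: 'a^'n^'m"] by simp
  then show False using uv by simp
qed

text \<open>The same map seen on the transposed format. It exchanges the roles of rows and columns and so
reduces the case of at least three rows to that of at least three columns.\<close>
definition conj_by_transpose :: "('a::field^'n^'m \<Rightarrow> 'a^'n^'m) \<Rightarrow> 'a^'m^'n \<Rightarrow> 'a^'m^'n" where
  "conj_by_transpose T A = transpose (T (transpose A))"

lemma mlinear_conj_by_transpose: "mlinear T \<Longrightarrow> mlinear (conj_by_transpose T)"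
  by (rule mlinearI) (simp_all add: conj_by_transpose_def transpose_add transpose_mscale mlinear_add mlinear_mscale)

lemma preserves_parallel_conj_by_transpose:
  fixes T :: "'a::{real_normed_field,euclidean_space}^'n^'m \<Rightarrow> 'a^'n^'m"
  assumes "preserves_pairs parallel_pair T"
  shows "preserves_pairs parallel_pair (conj_by_transpose T)"
proof -
  have t: "parallel_pair (transpose A) (transpose B) \<longleftrightarrow> parallel_pair A B" for A B :: "'a^'p^'q"
    by (simp add: parallel_pair_def flip: transpose_add transpose_mscale)
  show ?thesis using assms unfolding preserves_pairs_def conj_by_transpose_def by (metis t)
qed

lemma preserves_tea_conj_by_transpose:
  fixes T :: "'a::{real_normed_field,euclidean_space}^'n^'m \<Rightarrow> 'a^'n^'m"
  assumes "preserves_pairs tea_pair T"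
  shows "preserves_pairs tea_pair (conj_by_transpose T)"
proof -
  have t: "tea_pair (transpose A) (transpose B) \<longleftrightarrow> tea_pair A B" for A B :: "'a^'p^'q"
    by (simp add: tea_pair_def flip: transpose_add)
  show ?thesis using assms unfolding preserves_pairs_def conj_by_transpose_def by (metis t)
qed

lemma rank_le_one_conj_by_transpose: "rank_le_one T \<Longrightarrow> rank_le_one (conj_by_transpose T)"
  unfolding rank_le_one_def conj_by_transpose_def by (metis transpose_mscale)

lemma conj_by_transpose_twice: "conj_by_transpose (conj_by_transpose T) = T"
  by (simp add: conj_by_transpose_def fun_eq_iff)

lemma tea_preserver_rank:
  fixes T :: "'a::{real_normed_field,euclidean_space}^'n^'m \<Rightarrow> 'a^'n^'m"
  assumes lin: "mlinear T" and tea: "preserves_pairs tea_pair T" and nz: "T \<noteq> (\<lambda>_. 0)"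
    and mn: "CARD('m) \<ge> 2" "CARD('n) \<ge> 2" "(CARD('m), CARD('n)) \<noteq> (2, 2)"
  shows "\<not> rank_le_one T"
proof (cases "CARD('n) \<ge> 3")
  case True then show ?thesis using tea_preserver_rank_wide assms by blast
next
  case False
  then have m3: "CARD('m) \<ge> 3" using mn by auto
  have "conj_by_transpose T \<noteq> (\<lambda>_. 0)"
  proof
    assume "conj_by_transpose T = (\<lambda>_. 0)"
    then have "transpose (T A) = 0" for A
      by (metis conj_by_transpose_def transpose_transpose)
    then have "T A = 0" for A
      using spectral_norm_0_iff[of "T A"] spectral_norm_transpose[of "T A"] by (simp add: spectral_norm_0_iff[THEN iffD2])
    then show False using nz by auto
  qed
  from tea_preserver_rank_wide[OF mlinear_conj_by_transpose[OF lin] preserves_tea_conj_by_transpose[OF tea] this mn(2) m3]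
  show ?thesis using rank_le_one_conj_by_transpose by blast
qed

lemma parallel_preserver_scaled_isometry:
  fixes T :: "'a::{real_normed_field,euclidean_space}^'n^'m \<Rightarrow> 'a^'n^'m"
  assumes lin: "mlinear T" and par: "preserves_pairs parallel_pair T" and rk: "\<not> rank_le_one T"
    and mn: "CARD('m) \<ge> 2" "CARD('n) \<ge> 2" "(CARD('m), CARD('n)) \<noteq> (2, 2)"
  shows "\<exists>\<gamma>>0. \<forall>A. spectral_norm (T A) = \<gamma> * spectral_norm A"
proof (cases "CARD('n) \<ge> 3")
  case True then show ?thesis using parallel_preserver_scaled_isometry_wide assms by blast
next
  case False
  then have m3: "CARD('m) \<ge> 3" using mn by auto
  have "\<not> rank_le_one (conj_by_transpose T)"
    using rk rank_le_one_conj_by_transpose[of "conj_by_transpose T"] by (auto simp: conj_by_transpose_twice)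
  then obtain \<gamma> where g: "\<gamma> > 0" "\<And>A. spectral_norm (conj_by_transpose T A) = \<gamma> * spectral_norm A"
    using parallel_preserver_scaled_isometry_wide[OF mlinear_conj_by_transpose[OF lin] preserves_parallel_conj_by_transpose[OF par] mn(2) m3]
    by blast
  have "spectral_norm (T A) = \<gamma> * spectral_norm A" for A
    using g(2)[of "transpose A"] by (simp add: conj_by_transpose_def)
  with g(1) show ?thesis by blast
qed

text \<open>The basis furnished by the definition of the dimension could be infinite, with cardinality
zero; the finite spanning set of matrix units excludes this.\<close>
lemma dim_range_gt_one_iff:
  fixes T :: "'a::{real_normed_field,euclidean_space}^'n^'m \<Rightarrow> 'a^'n^'m"
  shows "mat.dim (range T) > 1 \<longleftrightarrow> \<not> rank_le_one T"
proof
  assume d: "mat.dim (range T) > 1"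
  show "\<not> rank_le_one T"
  proof
    assume "rank_le_one T"
    then obtain R where "\<And>A. \<exists>c. T A = mscale c R" unfolding rank_le_one_def by blast
    then have "range T \<subseteq> mat.span {R}" by (auto simp: mat.span_singleton)
    then have "mat.dim (range T) \<le> card {R}" by (rule mat.dim_le_card) simp
    then show False using d by simp
  qed
next
  assume rk: "\<not> rank_le_one T"
  show "mat.dim (range T) > 1"
  proof (rule ccontr)
    assume d: "\<not> mat.dim (range T) > 1"
    obtain B where B: "B \<subseteq> range T" "mat.independent B" "range T \<subseteq> mat.span B" "card B = mat.dim (range T)"
      using mat.basis_exists by blast
    let ?E = "(\<lambda>(i, j). outer (axis i 1) (axis j 1)) ` UNIV :: ('a^'n^'m) set"
    have E: "A \<in> mat.span ?E" for A
      by (subst matrix_expand) (intro mat.span_sum mat.span_scale mat.span_base, auto)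
    have "finite B" using mat.independent_span_bound[of ?E B] B(2) E by auto
    moreover have "card B \<le> Suc 0" using d B(4) by simp
    ultimately have eq: "\<forall>a\<in>B. \<forall>b\<in>B. a = b" using card_le_Suc0_iff_eq by blast
    obtain b where "B \<subseteq> {b}"
    proof (cases "B = {}")
      case False
      then obtain b where "b \<in> B" by blast
      then show ?thesis using eq that by blast
    qed (use that in blast)
    then have "range T \<subseteq> mat.span {b}" using B(3) mat.span_mono by blast
    then have "rank_le_one T" unfolding rank_le_one_def mat.span_singleton by (intro exI[of _ b]) auto
    with rk show False by simp
  qed
qed

theorem tea_parallel_standard:
  fixes T :: "'a::{real_normed_field,euclidean_space}^'n^'m \<Rightarrow> 'a^'n^'m"
  assumes mn: "CARD('m) \<ge> 2" "CARD('n) \<ge> 2" "(CARD('m), CARD('n)) \<noteq> (2, 2)"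
    and lin: "mlinear T" and nz: "T \<noteq> (\<lambda>_. 0)"
  shows "preserves_pairs tea_pair T \<longleftrightarrow> preserves_pairs parallel_pair T \<and> mat.dim (range T) > 1" (is ?ab)
    and "preserves_pairs tea_pair T \<longleftrightarrow> standard_form {U. unitary U} {V. unitary V} T" (is ?ac)
proof -
  have ab: "preserves_pairs parallel_pair T \<and> mat.dim (range T) > 1" if "preserves_pairs tea_pair T"
    using tea_preserver_parallel[OF lin that] tea_preserver_rank[OF lin that nz mn] dim_range_gt_one_iff by blast
  have bc: "standard_form {U. unitary U} {V. unitary V} T"
    if b: "preserves_pairs parallel_pair T" "mat.dim (range T) > 1"
  proof -
    have rk: "\<not> rank_le_one T" using b(2) dim_range_gt_one_iff by blast
    obtain \<gamma> where g: "\<gamma> > 0" "\<And>A. spectral_norm (T A) = \<gamma> * spectral_norm A"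
      using parallel_preserver_scaled_isometry[OF lin b(1) rk mn] by blast
    define S where "S A = (1 / \<gamma>) *\<^sub>R T A" for A
    have T: "T A = \<gamma> *\<^sub>R S A" for A using g(1) by (simp add: S_def)
    have linS: "mlinear S"
      by (rule mlinearI) (simp_all add: S_def mlinear_add[OF lin] mlinear_mscale[OF lin] scaleR_mscale mat.scale_right_distrib mult.commute)
    have "spectral_norm (S A) = spectral_norm A" for A
      using g by (simp add: S_def scaleR_mscale spectral_norm_mscale norm_divide)
    from spectral_isometry_form[OF linS this mn(1,2)] show ?thesis
    proof (elim disjE exE conjE)
      fix U V assume "unitary U" "unitary V" "\<forall>A. S A = U ** A ** V"
      moreover from this have "\<forall>A. T A = \<gamma> *\<^sub>R (U ** A ** V)" by (simp add: T)
      ultimately show ?thesis unfolding standard_form_def using g(1) by blast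
    next
      fix U V and \<sigma> :: "'m \<Rightarrow> 'n"
      assume "CARD('m) = CARD('n)" "unitary U" "unitary V" "bij \<sigma>" "\<forall>A. S A = U ** transpose_along \<sigma> A ** V"
      moreover from this have "\<forall>A. T A = \<gamma> *\<^sub>R (U ** transpose_along \<sigma> A ** V)" by (simp add: T)
      ultimately show ?thesis unfolding standard_form_def using g(1) by blast
    qed
  qed
  have ca: "preserves_pairs tea_pair T" if "standard_form {U. unitary U} {V. unitary V} T"
  proof -
    have "\<exists>\<gamma>>0. \<forall>A. spectral_norm (T A) = \<gamma> * spectral_norm A"
      using that unfolding standard_form_def
    proof (elim bexE exE conjE disjE)
      fix U :: "'a^'m^'m" and V :: "'a^'n^'n" and \<gamma> :: real
      assume "U \<in> {U. unitary U}" "V \<in> {V. unitary V}" and g0: "\<gamma> > 0" and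
        form: "\<forall>A. T A = \<gamma> *\<^sub>R (U ** A ** V)"
      then show ?thesis
        by (intro exI[of _ \<gamma>])
           (simp add: scaleR_mscale spectral_norm_mscale spectral_norm_unitary_mult spectral_norm_mult_unitary)
    next
      fix U :: "'a^'m^'m" and V :: "'a^'n^'n" and \<gamma> :: real and \<sigma> :: "'m \<Rightarrow> 'n"
      assume "U \<in> {U. unitary U}" "V \<in> {V. unitary V}" and g0: "\<gamma> > 0" and
        form: "bij \<sigma>" "\<forall>A. T A = \<gamma> *\<^sub>R (U ** transpose_along \<sigma> A ** V)"
      then show ?thesis
        by (intro exI[of _ \<gamma>])
           (simp add: scaleR_mscale spectral_norm_mscale spectral_norm_unitary_mult spectral_norm_mult_unitary
             spectral_norm_transpose_along)
    qed
    then obtain \<gamma> where g: "\<gamma> > 0" "\<And>A. spectral_norm (T A) = \<gamma> * spectral_norm A" by blast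
    show ?thesis unfolding preserves_pairs_def tea_pair_def
      using g by (simp add: mlinear_add[OF lin, symmetric] distrib_left[symmetric])
  qed
  show ?ab ?ac using ab bc ca by blast+
qed

lemma unitary_real: "unitary U \<longleftrightarrow> orthogonal_matrix U" for U :: "real^'n^'n"
proof -
  have "adj U = transpose U" by (simp add: adj_def transpose_def vec_eq_iff conjugate_real)
  then show ?thesis using unitary_right[of U] by (auto simp: unitary_def orthogonal_matrix_def)
qed

lemma unitary_complex: "unitary U \<longleftrightarrow> unitary_matrix U" for U :: "complex^'n^'n"
proof -
  have "adj U = conj_transpose U" by (simp add: adj_def conj_transpose_def transpose_def map_matrix_def vec_eq_iff conjugate_complex)
  then show ?thesis using unitary_right[of U] by (auto simp: unitary_def unitary_matrix_def)
qed

theorem theorem1p1: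
  assumes "CARD('m::finite) \<ge> 2" and "CARD('n::finite) \<ge> 2"
    and "(CARD('m), CARD('n)) \<noteq> (2, 2)"
  shows
    "(\<forall>T :: real^'n^'m \<Rightarrow> real^'n^'m.
        Vector_Spaces.linear mscale mscale T \<and> T \<noteq> (\<lambda>_. 0) \<longrightarrow>
        (preserves_pairs tea_pair T \<longleftrightarrow>
           preserves_pairs parallel_pair T \<and> mat.dim (range T) > 1) \<and>
        (preserves_pairs tea_pair T \<longleftrightarrow>
           standard_form {U. orthogonal_matrix U} {V. orthogonal_matrix V} T)) \<and>
     (\<forall>T :: complex^'n^'m \<Rightarrow> complex^'n^'m.
        Vector_Spaces.linear mscale mscale T \<and> T \<noteq> (\<lambda>_. 0) \<longrightarrow>
        (preserves_pairs tea_pair T \<longleftrightarrow>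
           preserves_pairs parallel_pair T \<and> mat.dim (range T) > 1) \<and>
        (preserves_pairs tea_pair T \<longleftrightarrow>
           standard_form {U. unitary_matrix U} {V. unitary_matrix V} T))"
  using tea_parallel_standard[OF assms, where 'a = real] tea_parallel_standard[OF assms, where 'a = complex]
  unfolding unitary_real unitary_complex by blast

end
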